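(* Let $H$ be a separable real Hilbert space, $a\in\mathbb R_+$, $b\in H$ and $Q$ a positive semi-definite trace class operator on $H$. Then there is an HVG-process $Y$ with parameters $(a,b,Q)$. The characteristics $(\beta,\Gamma,\mu)$ of $Y$ are given by $$\beta=ab-\int_{\{|x|>1\}}x\,\mu(dx),\qquad\Gamma=0,\qquad\mu(A)=\int_0^\infty\Phi_t(A)\,a\,t^{-1}e^{-t}\,dt$$ for any Borel set $A\subseteq H\setminus\{0\}$, where $\Phi_t$ denotes the Gaussian measure on $H$ with mean $tb$ and covariance operator $tQ$. Moreover, $\mathrm{E}Y(1)=ab$ and $\mathrm{Cov}\,Y(1)=a\,b\otimes b+aQ$. For any $u\in H$, $\langle u|Y\rangle$ is a variance gamma process. If $b=0$, then $\beta=0$ and $Y$ is symmetric.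
   Context: $\mathbb R_+=[0,\infty)$. An $H$-valued Lévy process $Y$ is a Hilbert space valued variance gamma process (HVG-process) with parameters $(a,b,Q)$ if its Lévy exponent (the function $\rho$ with $\mathrm{E}e^{i\langle u|Y(t)\rangle}=e^{t\rho(u)}$) is $\rho(u)=-a\,\mathrm{Log}\big(1+\tfrac12\langle Qu|u\rangle-i\langle b|u\rangle\big)$, $u\in H$, with $\mathrm{Log}$ the principal branch of the logarithm. A (real) variance gamma process is a real Lévy process equal in law to $W(G(t))$, $t\ge0$, with $W$ a real Brownian motion with drift (variance $\ge0$ allowed to vanish) and $G$ an independent gamma process. Characteristics $(\beta,\Gamma,\mu)$ are taken w.r.t. the truncation $\chi(x)=x1_{\{|x|\le1\}}$: $\rho(u)=i\langle u|\beta\rangle-\frac12\langle\Gamma u|u\rangle+\int(e^{i\langle u|x\rangle}-1-i\langle u|\chi(x)\rangle)\mu(dx)$, with $\mu$ a measure on $H\setminus\{0\}$, $\int(1\wedge|x|^2)\mu(dx)<\infty$. $\mathrm{Cov}(Z)$ is defined by $\langle\mathrm{Cov}(Z)x|y\rangle=\mathrm{E}(\langle Z-\mathrm{E}Z|x\rangle\langle Z-\mathrm{E}Z|y\rangle)$, and $(b\otimes b)z=\langle b|z\rangle b$. Symmetric means that $Y$ and $-Y$ have the same law. *)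

theory Defs
  imports "HOL-Probability.Probability"
begin

text \<open>
  A separable real Hilbert space is a type of sort
  \<open>{real_inner, banach, polish_space}\<close>: \<open>real_inner\<close> and \<open>banach\<close> give a Hilbert space,
  and \<open>polish_space\<close> adds only second countability, which is separability.
\<close>

definition psd_operator :: "('h::real_inner \<Rightarrow> 'h) \<Rightarrow> bool" where
  "psd_operator Q \<longleftrightarrow>
     bounded_linear Q \<and> (\<forall>x y. Q x \<bullet> y = x \<bullet> Q y) \<and> (\<forall>x. 0 \<le> Q x \<bullet> x)"

definition orthonormal_basis :: "'h::real_inner set \<Rightarrow> bool" where
  "orthonormal_basis E \<longleftrightarrow>
     pairwise orthogonal E \<and> (\<forall>e\<in>E. norm e = 1) \<and> closure (span E) = UNIV"

text \<open>
  An operator \<open>T\<close> is of trace class if its absolute value \<open>A = (T\<^sup>* T)\<^sup>1\<^sup>/\<^sup>2\<close> has finite trace.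
  The condition on inner products below says \<open>A A = T\<^sup>* T\<close>; together with positivity it
  characterizes \<open>A\<close>.
\<close>

definition trace_class :: "('h::real_inner \<Rightarrow> 'h) \<Rightarrow> bool" where
  "trace_class T \<longleftrightarrow> bounded_linear T \<and>
     (\<exists>A. psd_operator A \<and> (\<forall>x y. A x \<bullet> A y = T x \<bullet> T y) \<and>
       (\<exists>E. orthonormal_basis E \<and> (\<lambda>e. A e \<bullet> e) summable_on E))"

definition normal_law :: "real \<Rightarrow> real \<Rightarrow> real measure" where
  "normal_law m v =
     (if v = 0 then return borel m else density lborel (\<lambda>x. ennreal (normal_density m (sqrt v) x)))"

text \<open>
  The Gaussian measure with mean \<open>m\<close> and covariance operator \<open>C\<close>: every one-dimensional
  projection is normal (possibly degenerate) with the corresponding mean and variance.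
  A Borel measure on a separable Hilbert space is determined by these projections.
\<close>

definition gaussian_measure :: "'h::real_inner \<Rightarrow> ('h \<Rightarrow> 'h) \<Rightarrow> 'h measure" where
  "gaussian_measure m C =
     (THE \<nu>. sets \<nu> = sets borel \<and>
        (\<forall>u. distr \<nu> borel (\<lambda>x. x \<bullet> u) = normal_law (m \<bullet> u) (C u \<bullet> u)))"

definition is_covariance ::
  "'w measure \<Rightarrow> ('w \<Rightarrow> 'h::{real_inner, banach, second_countable_topology}) \<Rightarrow> ('h \<Rightarrow> 'h) \<Rightarrow> bool"
where
  "is_covariance M Z C \<longleftrightarrow> integrable M Z \<and>
     (let EZ = (LINT \<omega>|M. Z \<omega>) in
      \<forall>x y. integrable M (\<lambda>\<omega>. ((Z \<omega> - EZ) \<bullet> x) * ((Z \<omega> - EZ) \<bullet> y)) \<and>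
            C x \<bullet> y = (LINT \<omega>|M. ((Z \<omega> - EZ) \<bullet> x) * ((Z \<omega> - EZ) \<bullet> y)))"

text \<open>Processes are indexed by the nonnegative reals; values at negative times are irrelevant.\<close>

definition sample_path :: "(real \<Rightarrow> 'w \<Rightarrow> 'b) \<Rightarrow> 'w \<Rightarrow> real \<Rightarrow> 'b" where
  "sample_path X \<omega> = restrict (\<lambda>t. X t \<omega>) {0..}"

definition process_law ::
  "'w measure \<Rightarrow> (real \<Rightarrow> 'w \<Rightarrow> 'b::topological_space) \<Rightarrow> (real \<Rightarrow> 'b) measure" where
  "process_law M X = distr M (Pi\<^sub>M {0..} (\<lambda>_. borel)) (sample_path X)"

definition cadlag :: "(real \<Rightarrow> 'b::topological_space) \<Rightarrow> bool" where
  "cadlag f \<longleftrightarrow>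
     (\<forall>t\<ge>0. (f \<longlongrightarrow> f t) (at_right t)) \<and> (\<forall>t>0. \<exists>l. (f \<longlongrightarrow> l) (at_left t))"

text \<open>Stochastic continuity follows from the path regularity and stationarity of increments.\<close>

definition levy_process ::
  "'w measure \<Rightarrow> (real \<Rightarrow> 'w \<Rightarrow> 'b::{real_normed_vector, second_countable_topology}) \<Rightarrow> bool"
where
  "levy_process M X \<longleftrightarrow> prob_space M \<and>
     (\<forall>t\<ge>0. X t \<in> borel_measurable M) \<and>
     (AE \<omega> in M. X 0 \<omega> = 0) \<and>
     (\<forall>(n::nat) (t::nat \<Rightarrow> real). 0 \<le> t 0 \<and> mono_on {..n} t \<longrightarrow>
        prob_space.indep_vars M (\<lambda>_. borel) (\<lambda>k \<omega>. X (t (Suc k)) \<omega> - X (t k) \<omega>) {..<n}) \<and>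
     (\<forall>s t. 0 \<le> s \<and> s \<le> t \<longrightarrow>
        distr M borel (\<lambda>\<omega>. X t \<omega> - X s \<omega>) = distr M borel (X (t - s))) \<and>
     (AE \<omega> in M. cadlag (\<lambda>t. X t \<omega>))"

definition levy_exponent ::
  "'w measure \<Rightarrow> (real \<Rightarrow> 'w \<Rightarrow> 'h::real_inner) \<Rightarrow> ('h \<Rightarrow> complex) \<Rightarrow> bool" where
  "levy_exponent M Y \<rho> \<longleftrightarrow>
     (\<forall>t\<ge>0. \<forall>u. (LINT \<omega>|M. iexp (u \<bullet> Y t \<omega>)) = exp (complex_of_real t * \<rho> u))"

definition levy_measure :: "'h::real_normed_vector measure \<Rightarrow> bool" where
  "levy_measure \<mu> \<longleftrightarrow> sets \<mu> = sets (restrict_space borel (- {0})) \<and>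
     (\<integral>\<^sup>+ x. ennreal (min 1 ((norm x)\<^sup>2)) \<partial>\<mu>) < \<infinity>"

definition truncation :: "'h::real_normed_vector \<Rightarrow> 'h" where
  "truncation x = (if norm x \<le> 1 then x else 0)"

definition levy_characteristics ::
  "'w measure \<Rightarrow> (real \<Rightarrow> 'w \<Rightarrow> 'h::real_inner) \<Rightarrow> 'h \<Rightarrow> ('h \<Rightarrow> 'h) \<Rightarrow> 'h measure \<Rightarrow> bool"
where
  "levy_characteristics M Y \<beta> \<Gamma> \<mu> \<longleftrightarrow>
     psd_operator \<Gamma> \<and> trace_class \<Gamma> \<and> levy_measure \<mu> \<and>
     levy_exponent M Y (\<lambda>u. \<i> * complex_of_real (u \<bullet> \<beta>) - complex_of_real (\<Gamma> u \<bullet> u) / 2 +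
       (LINT x|\<mu>. iexp (u \<bullet> x) - 1 - \<i> * complex_of_real (u \<bullet> truncation x)))"

text \<open>Brownian motion with drift \<open>m\<close> and variance \<open>v\<close> per unit of time.\<close>

definition brownian_motion :: "real \<Rightarrow> real \<Rightarrow> 'w measure \<Rightarrow> (real \<Rightarrow> 'w \<Rightarrow> real) \<Rightarrow> bool" where
  "brownian_motion m v N W \<longleftrightarrow> 0 \<le> v \<and> levy_process N W \<and>
     (\<forall>t\<ge>0. distr N borel (W t) = normal_law (m * t) (v * t)) \<and>
     (\<forall>\<omega>\<in>space N. continuous_on {0..} (\<lambda>t. W t \<omega>))"

definition gamma_density :: "real \<Rightarrow> real \<Rightarrow> real \<Rightarrow> real" where
  "gamma_density \<alpha> \<theta> x =
     (if x \<le> 0 then 0 else \<theta> powr \<alpha> * x powr (\<alpha> - 1) * exp (- \<theta> * x) / Gamma \<alpha>)"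

text \<open>Gamma process with shape \<open>\<alpha>\<close> per unit of time and rate \<open>\<theta>\<close>.\<close>

definition gamma_process :: "real \<Rightarrow> real \<Rightarrow> 'w measure \<Rightarrow> (real \<Rightarrow> 'w \<Rightarrow> real) \<Rightarrow> bool" where
  "gamma_process \<alpha> \<theta> N G \<longleftrightarrow> 0 < \<alpha> \<and> 0 < \<theta> \<and> levy_process N G \<and>
     (\<forall>t>0. distributed N lborel (G t) (\<lambda>x. ennreal (gamma_density (\<alpha> * t) \<theta> x)))"

text \<open>
  The auxiliary pair \<open>(W, G)\<close> may live on another probability space than \<open>X\<close>. As types cannot
  be quantified, its sample space is taken inside \<open>nat \<Rightarrow> real\<close>, which is rich enough to carry
  any law on a standard Borel space.
\<close>

definition variance_gamma_process :: "'w measure \<Rightarrow> (real \<Rightarrow> 'w \<Rightarrow> real) \<Rightarrow> bool" where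
  "variance_gamma_process M X \<longleftrightarrow> levy_process M X \<and>
     (\<exists>(N :: (nat \<Rightarrow> real) measure) W G m v \<alpha> \<theta>.
        brownian_motion m v N W \<and> gamma_process \<alpha> \<theta> N G \<and>
        prob_space.indep_var N (Pi\<^sub>M {0..} (\<lambda>_. borel)) (sample_path W)
          (Pi\<^sub>M {0..} (\<lambda>_. borel)) (sample_path G) \<and>
        process_law M X = process_law N (\<lambda>t \<omega>. W (G t \<omega>) \<omega>))"

definition hvg_process ::
  "'w measure \<Rightarrow> (real \<Rightarrow> 'w \<Rightarrow> 'h::{real_inner, second_countable_topology}) \<Rightarrow>
    real \<Rightarrow> 'h \<Rightarrow> ('h \<Rightarrow> 'h) \<Rightarrow> bool" where
  "hvg_process M Y a b Q \<longleftrightarrow> levy_process M Y \<and>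
     levy_exponent M Y (\<lambda>u. - complex_of_real a *
       Ln (1 + complex_of_real (Q u \<bullet> u) / 2 - \<i> * complex_of_real (b \<bullet> u)))"

end

theory Submission
  imports Defs
begin

text \<open>
  Finite Borel measures on \<open>H\<close>, and the laws of Levy processes, are determined by their
  characteristic functions. The Gaussian measure with covariance \<open>Q\<close> is built from independent
  standard normals through a Cholesky factorization of the Gram matrix of \<open>Q\<close> along an orthonormal
  basis. Kolmogorov extension on the dyadic times followed by a regularization of the paths gives an
  \<open>H\<close>-valued Brownian motion \<open>B\<close> with drift \<open>b\<close> and covariance \<open>Q\<close> and a gamma process \<open>G\<close>, and
  the HVG-process is the subordination \<open>B (G t)\<close>. The Levy--Khintchine formula is the Frullani
  identity \<open>\<integral> (exp (t w) - 1) a t\<^sup>-\<^sup>1 exp (- t) dt = - a Log (1 - w)\<close> (\<open>t > 0\<close>), applied with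
  \<open>w = i \<langle>b|u\<rangle> - \<langle>Qu|u\<rangle>/2\<close>; mean and covariance of \<open>Y 1\<close> follow from its representation as a
  Gaussian mixture, and \<open>\<langle>u|Y\<rangle>\<close> has the exponent of a real variance gamma process, hence its law.
\<close>

section \<open>Uniqueness of measures with given characteristic functions\<close>

text \<open>Everything after existence concerns an arbitrary HVG-process on an arbitrary probability
  space, where only the Levy exponent is at hand. The constructed process therefore serves for
  existence and, in dimension one, for the pair behind a variance gamma process; all other
  properties are read off from exponents and from the law \<open>mix (mixing_law a)\<close> at time
  one. Characteristic functions of finite linear combinations are the common test for independence,
  stationarity and equality of path laws; on a separable space they suffice because the functionals
  \<open>u \<bullet> x\<close> generate the Borel sets. Paths are what an exponent does not provide.
  Brownian motion and gamma process are limits of the same dyadic step functions, evaluated at the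
  grid point just to the right of \<open>t\<close>, so one computation of finite-dimensional laws
  serves both. Continuity of Brownian paths is drawn from fourth moments, of order
  \<open>t\<^sup>2\<close>; second moments are only of order \<open>t\<close>, which the growing
  number of grid cells cancels. The value \<open>a = 0\<close> is kept apart wherever a gamma law
  enters.\<close>

lemma finite_measure_char_eqI:
  fixes M N :: "real measure"
  assumes "finite_measure M" "finite_measure N"
    and sM [measurable_cong]: "sets M = sets borel" and sN [measurable_cong]: "sets N = sets borel"
    and eq: "\<And>t. (CLINT x|M. iexp (t * x)) = (CLINT x|N. iexp (t * x))"
  shows "M = N"
proof -
  interpret M: finite_measure M by fact
  interpret N: finite_measure N by fact
  have spM: "space M = UNIV" and spN: "space N = UNIV"
    using sets_eq_imp_space_eq[OF sM] sets_eq_imp_space_eq[OF sN] by simp_all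
  \<comment> \<open>Frequency 0 shows that the total masses agree. Dividing by this common mass
    leaves probability distributions, to which Levy uniqueness applies; mass 0 has to be split
    off.\<close>
  have "complex_of_real (measure M (space M)) = complex_of_real (measure N (space N))"
    using eq[of 0] by simp
  then have c: "measure N (space N) = measure M (space M)" by simp
  define c where "c = measure M (space M)"
  show ?thesis
  proof (cases "c = 0")
    case True
    then have "emeasure M (space M) = 0" "emeasure N (space N) = 0"
      using c by (simp_all add: c_def M.emeasure_eq_measure N.emeasure_eq_measure)
    then have "emeasure M A = 0" "emeasure N A = 0" for A
      using emeasure_space[of M A] emeasure_space[of N A] by simp_all
    then show ?thesis by (intro measure_eqI) (simp_all add: sM sN)
  next
    case False
    then have cpos: "c > 0" by (simp add: c_def zero_less_measure_iff order_less_le)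
    have *: "real_distribution (density K (\<lambda>_. ennreal (1/c)))"
      if "finite_measure K" "sets K = sets borel" "measure K (space K) = c" for K :: "real measure"
    proof -
      interpret K: finite_measure K by fact
      have "prob_space (density K (\<lambda>_. ennreal (1/c)))"
        using that(3) cpos by (intro prob_spaceI)
          (simp add: emeasure_density_const K.emeasure_eq_measure ennreal_mult[symmetric])
      with that show ?thesis by (simp add: real_distribution_def real_distribution_axioms_def)
    qed
    have e: "density M (\<lambda>_. ennreal (1/c)) = density N (\<lambda>_. ennreal (1/c))"
    proof (rule Levy_uniqueness[OF * *])
      show "char (density M (\<lambda>_. ennreal (1/c))) = char (density N (\<lambda>_. ennreal (1/c)))"
        unfolding char_def using eq cpos by (simp add: fun_eq_iff integral_density)
    qed (simp_all only: c_def c assms)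
    have "ennreal (1/c) * emeasure M A = ennreal (1/c) * emeasure N A" if "A \<in> sets borel" for A
      
    proof -
      have "emeasure (density M (\<lambda>_. ennreal (1/c))) A = ennreal (1/c) * emeasure M A"
        "emeasure (density N (\<lambda>_. ennreal (1/c))) A = ennreal (1/c) * emeasure N A"
        using that by (simp_all add: emeasure_density_const sM sN)
      with e show ?thesis by simp
    qed
    then have "emeasure M A = emeasure N A" if "A \<in> sets borel" for A
      using that cpos ennreal_mult_cancel_left[of "ennreal (1/c)"] by auto
    then show ?thesis by (intro measure_eqI) (simp_all add: sM sN)
  qed
qed

lemma (in finite_measure) integrable_iexp_mult:
  assumes [measurable]: "f \<in> borel_measurable M" "h \<in> borel_measurable M" and "\<And>x. \<bar>h x\<bar> \<le> B"
  shows "integrable M (\<lambda>x. iexp (f x) * complex_of_real (h x))"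
  using assms(3) by (intro integrable_const_bound[where B=B]) (auto simp: norm_mult)

text \<open>The hypothesis equates the characteristic functions of the images under \<open>g\<close>
  of the finite measures with density \<open>h\<close>. One-dimensional uniqueness identifies these
  images, and the conclusion evaluates them at \<open>A\<close>.\<close>

lemma density_char_eq:
  assumes "finite_measure M" "finite_measure N" and sets [measurable_cong]: "sets N = sets M"
    and [measurable]: "g \<in> borel_measurable M" "h \<in> borel_measurable M"
    and h: "\<And>x. 0 \<le> h x" "\<And>x. h x \<le> B" and A: "A \<in> sets borel"
    and eq: "\<And>t. (CLINT x|M. iexp (t * g x) * complex_of_real (h x)) =
                  (CLINT x|N. iexp (t * g x) * complex_of_real (h x))"
  shows "(LINT x|M. indicator A (g x) * h x) = (LINT x|N. indicator A (g x) * (h x :: real))"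
proof -
  interpret M: finite_measure M by fact
  interpret N: finite_measure N by fact
  let ?D = "\<lambda>K. distr (density K (\<lambda>x. ennreal (h x))) borel g"
  have fin: "finite_measure (?D K)" if "finite_measure K" "sets K = sets M" for K
  proof -
    interpret K: finite_measure K by fact
    note that(2)[measurable_cong]
    have "(\<integral>\<^sup>+x. ennreal (h x) \<partial>K) \<le> (\<integral>\<^sup>+x. ennreal B \<partial>K)"
      using h by (intro nn_integral_mono) (simp add: ennreal_leI)
    also have "\<dots> < \<infinity>" by (simp add: ennreal_mult_less_top K.emeasure_eq_measure)
    finally have "finite_measure (density K (\<lambda>x. ennreal (h x)))"
      by (intro finite_measureI) (simp add: emeasure_density cong: nn_integral_cong)
    then show ?thesis by (rule finite_measure.finite_measure_distr) simp
  qed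
  have int: "(CLINT x|?D K. iexp (t * x)) = (CLINT x|K. iexp (t * g x) * complex_of_real (h x))"
    if "sets K = sets M" for K t
  proof -
    note that[measurable_cong]
    show ?thesis using h
      by (simp add: integral_distr integral_density scaleR_conv_of_real mult.commute)
  qed
  have D: "?D M = ?D N"
    by (rule finite_measure_char_eqI) (simp_all only: fin assms(1,2) sets refl sets_distr int eq)
  have I: "(LINT x|?D K. indicator A x :: real) = (LINT x|K. indicator A (g x) * h x)"
    if "sets K = sets M" for K
  proof -
    note that[measurable_cong]
    have "(LINT x|?D K. indicator A x :: real) = (LINT x|density K (\<lambda>x. ennreal (h x)). indicator A (g x) :: real)"
      using A by (intro integral_distr) auto
    also have "\<dots> = (LINT x|K. indicator A (g x) * h x)"
      using A h by (subst integral_density) (auto simp: mult.commute)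
    finally show ?thesis .
  qed
  show ?thesis by (simp only: I[OF refl, symmetric] I[OF sets, symmetric] D)
qed

lemma finite_measure_restrict_density:
  assumes "finite_measure M" "g \<in> borel_measurable M" "A \<in> sets borel"
  shows "finite_measure (density M (\<lambda>x. ennreal (indicator A (g x))))"
proof -
  interpret M: finite_measure M by fact
  note assms(2,3)[measurable]
  have "(\<integral>\<^sup>+x. ennreal (indicator A (g x)) \<partial>M) \<le> (\<integral>\<^sup>+x. 1 \<partial>M)"
    by (intro nn_integral_mono) (auto simp: indicator_def)
  also have "\<dots> < \<infinity>" by (simp add: less_top[symmetric])
  finally show ?thesis
    by (intro finite_measureI) (simp add: emeasure_density cong: nn_integral_cong)
qed

text \<open>
  The measures with density \<open>1 + cos f\<close> and \<open>1 + sin f\<close> are positive, so one-dimensional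
  uniqueness applies to their images under \<open>g\<close>; this localises the equality of characteristic
  functions to the event \<open>g \<in> A\<close>.
\<close>

lemma char_eq_restrict:
  assumes fin: "finite_measure M" "finite_measure N" and sets [measurable_cong]: "sets N = sets M"
    and F: "\<And>f. f \<in> F \<Longrightarrow> f \<in> borel_measurable M"
    and lin: "\<And>f g r s. f \<in> F \<Longrightarrow> g \<in> F \<Longrightarrow> (\<lambda>x. r * f x + s * g x) \<in> F"
    and eq: "\<And>f. f \<in> F \<Longrightarrow> (CLINT x|M. iexp (f x)) = (CLINT x|N. iexp (f x))"
    and g: "g \<in> F" and A [measurable]: "A \<in> sets borel" and f: "f \<in> F"
  shows "(CLINT x|M. iexp (f x) * complex_of_real (indicator A (g x))) =
         (CLINT x|N. iexp (f x) * complex_of_real (indicator A (g x)))"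
proof -
  interpret M: finite_measure M by fact
  interpret N: finite_measure N by fact
  have [measurable]: "f \<in> borel_measurable M" "g \<in> borel_measurable M" using F f g by auto
  have eqt: "(CLINT x|M. iexp (t * g x + s * f x)) = (CLINT x|N. iexp (t * g x + s * f x))" for t s
    using eq[OF lin[OF g f]] .
  have ii: "integrable K (\<lambda>x. iexp (t * g x + s * f x))" if "finite_measure K" "sets K = sets M" for t s K
  proof -
    note that(2)[measurable_cong]
    show ?thesis using finite_measure.integrable_iexp_mult[OF that(1), of "\<lambda>x. t * g x + s * f x" "\<lambda>_. 1" 1]
      by simp
  qed
  have comb: "(CLINT x|K. p x + q x / c + r x / d) = (CLINT x|K. p x) + (CLINT x|K. q x) / c + (CLINT x|K. r x) / d"
    if "integrable K p" "integrable K q" "integrable K r" for p q r :: "'a \<Rightarrow> complex" and c d K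
    using that by simp
  have iexp_plus: "iexp (x + y) = iexp x * iexp y" for x y
    by (simp add: exp_add distrib_left)
  \<comment> \<open>Euler's formulas turn the weights \<open>1 + cos f\<close> and
    \<open>1 + sin f\<close> into combinations of \<open>iexp (t * g + s * f)\<close> with
    \<open>s\<close> in \<open>0, 1, -1\<close>. These exponents lie in \<open>F\<close>, where
    equality is assumed.\<close>
  have cosE: "iexp x * complex_of_real (1 + cos y) =
      iexp (x + 0 * y) + iexp (x + 1 * y) / 2 + iexp (x + (-1) * y) / 2" for x y
  proof -
    have "complex_of_real (1 + cos y) = 1 + (iexp (1 * y) + iexp ((-1) * y)) / 2"
      using cos_exp_eq[of "complex_of_real y"] by (simp add: cos_of_real[symmetric])
    then show ?thesis unfolding iexp_plus by (simp add: distrib_left add_divide_distrib)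
  qed
  have sinE: "iexp x * complex_of_real (1 + sin y) =
      iexp (x + 0 * y) + iexp (x + 1 * y) / (2*\<i>) + iexp (x + (-1) * y) / (-2*\<i>)" for x y
  proof -
    have "complex_of_real (1 + sin y) = 1 + (iexp (1 * y) - iexp ((-1) * y)) / (2*\<i>)"
      using sin_exp_eq[of "complex_of_real y"] by (simp add: sin_of_real[symmetric])
    then show ?thesis unfolding iexp_plus by (simp add: distrib_left diff_divide_distrib right_diff_distrib mult_ac)
  qed
  have one: "(CLINT x|K. iexp (t * g x) * complex_of_real (1 + cos (f x))) =
     (CLINT x|K. iexp (t * g x + 0 * f x)) + (CLINT x|K. iexp (t * g x + 1 * f x)) / 2
       + (CLINT x|K. iexp (t * g x + (-1) * f x)) / 2"
    if "finite_measure K" "sets K = sets M" for t K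
  proof -
    have e: "iexp (t * g x) * complex_of_real (1 + cos (f x)) =
      iexp (t * g x + 0 * f x) + iexp (t * g x + 1 * f x) / 2 + iexp (t * g x + (-1) * f x) / 2" for x
      by (rule cosE)
    show ?thesis unfolding e by (rule comb[OF ii[OF that] ii[OF that] ii[OF that]])
  qed
  have two: "(CLINT x|K. iexp (t * g x) * complex_of_real (1 + sin (f x))) =
     (CLINT x|K. iexp (t * g x + 0 * f x)) + (CLINT x|K. iexp (t * g x + 1 * f x)) / (2*\<i>)
       + (CLINT x|K. iexp (t * g x + (-1) * f x)) / (-2*\<i>)"
    if "finite_measure K" "sets K = sets M" for t K
  proof -
    have e: "iexp (t * g x) * complex_of_real (1 + sin (f x)) =
      iexp (t * g x + 0 * f x) + iexp (t * g x + 1 * f x) / (2*\<i>) + iexp (t * g x + (-1) * f x) / (-2*\<i>)" for x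
      by (rule sinE)
    show ?thesis unfolding e by (rule comb[OF ii[OF that] ii[OF that] ii[OF that]])
  qed
  have C: "(LINT x|M. indicator A (g x) * (1 + cos (f x))) = (LINT x|N. indicator A (g x) * (1 + cos (f x)))"
    proof (rule density_char_eq[OF fin sets, where B=2])
    show "0 \<le> 1 + cos (f x)" "1 + cos (f x) \<le> 2" for x
      using cos_ge_minus_one[of "f x"] cos_le_one[of "f x"] by linarith+
  qed (simp_all only: one[OF fin(1) refl] one[OF fin(2) sets] eqt A, measurable)
  have S: "(LINT x|M. indicator A (g x) * (1 + sin (f x))) = (LINT x|N. indicator A (g x) * (1 + sin (f x)))"
    proof (rule density_char_eq[OF fin sets, where B=2])
    show "0 \<le> 1 + sin (f x)" "1 + sin (f x) \<le> 2" for x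
      using sin_ge_minus_one[of "f x"] sin_le_one[of "f x"] by linarith+
  qed (simp_all only: two[OF fin(1) refl] two[OF fin(2) sets] eqt A, measurable)
  \<comment> \<open>The weight 1 measures the event \<open>g \<in> A\<close> itself;
    \<open>split\<close> subtracts it from the two previous integrals to isolate cosine and
    sine.\<close>
  have O: "(LINT x|M. indicator A (g x) * (1::real)) = (LINT x|N. indicator A (g x) * (1::real))"
  proof (rule density_char_eq[OF fin sets, where B=1])
    show "(CLINT x|M. iexp (t * g x) * complex_of_real 1) = (CLINT x|N. iexp (t * g x) * complex_of_real 1)" for t
      using eqt[of t 0] by simp
  qed (simp_all add: A)
  have split: "(CLINT x|K. iexp (f x) * complex_of_real (indicator A (g x))) =
     complex_of_real ((LINT x|K. indicator A (g x) * (1 + cos (f x))) - (LINT x|K. indicator A (g x) * 1))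
     + \<i> * complex_of_real ((LINT x|K. indicator A (g x) * (1 + sin (f x))) - (LINT x|K. indicator A (g x) * 1))"
    if "finite_measure K" "sets K = sets M" for K
  proof -
    interpret K: finite_measure K by fact
    note that(2)[measurable_cong]
    have b: "integrable K (\<lambda>x. indicator A (g x) * h x)" if "h \<in> borel_measurable K" "\<And>x. \<bar>h x\<bar> \<le> 1" for h :: "_ \<Rightarrow> real"
      using that by (intro K.integrable_const_bound[where B=1]) (auto simp: indicator_def)
    have d: "(LINT x|K. indicator A (g x) * (1 + h x)) - (LINT x|K. indicator A (g x) * 1) = (LINT x|K. indicator A (g x) * h x)"
      if "h \<in> borel_measurable K" "\<And>x. \<bar>h x\<bar> \<le> 1" for h :: "_ \<Rightarrow> real"
      using b[OF that] b[of "\<lambda>_. 1"] by (simp add: distrib_left)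
    have comb2: "(CLINT x|K. complex_of_real (p x) + \<i> * complex_of_real (q x)) =
        complex_of_real (LINT x|K. p x) + \<i> * complex_of_real (LINT x|K. q x)"
      if "integrable K p" "integrable K q" for p q
      using that by simp
    have e: "iexp (f x) * complex_of_real (indicator A (g x)) =
       complex_of_real (indicator A (g x) * cos (f x)) + \<i> * complex_of_real (indicator A (g x) * sin (f x))" for x
      by (simp add: exp_Euler cos_of_real sin_of_real algebra_simps)
    have "(CLINT x|K. iexp (f x) * complex_of_real (indicator A (g x))) =
       complex_of_real (LINT x|K. indicator A (g x) * cos (f x)) + \<i> * complex_of_real (LINT x|K. indicator A (g x) * sin (f x))"
      unfolding e by (rule comb2) (auto intro!: b)
    then show ?thesis by (subst (1 2) d) auto
  qed
  show ?thesis by (simp only: split[OF fin(1) refl] split[OF fin(2) sets] C S O)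
qed

text \<open>Finite intersections of events \<open>g \<in> A\<close> form an intersection-stable
  generator. Imposing the conditions one at a time, \<open>char_eq_restrict\<close> hands the
  equality of characteristic functions on \<open>F\<close> over to the restricted measures, so that
  induction on the list of conditions ends with a comparison of total masses.\<close>

theorem measure_eqI_char_family:
  fixes M N :: "'a measure" and F :: "('a \<Rightarrow> real) set"
  assumes fin: "finite_measure M" "finite_measure N" and sets: "sets N = sets M"
    and F: "\<And>f. f \<in> F \<Longrightarrow> f \<in> borel_measurable M" and ne: "F \<noteq> {}"
    and lin: "\<And>f g r s. f \<in> F \<Longrightarrow> g \<in> F \<Longrightarrow> (\<lambda>x. r * f x + s * g x) \<in> F"
    and eq: "\<And>f. f \<in> F \<Longrightarrow> (CLINT x|M. iexp (f x)) = (CLINT x|N. iexp (f x))"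
    and gen: "sets M = sigma_sets (space M) {g -` A \<inter> space M | g A. g \<in> F \<and> A \<in> sets borel}"
  shows "M = N"
proof -
  define good where "good l \<longleftrightarrow> (\<forall>p\<in>set l. fst p \<in> F \<and> snd p \<in> sets borel)" for l :: "(('a \<Rightarrow> real) \<times> real set) list"
  define S where "S l = {x \<in> space M. \<forall>p\<in>set l. fst p x \<in> snd p}" for l :: "(('a \<Rightarrow> real) \<times> real set) list"
  have S_Cons: "S ((g, A) # l) = (g -` A \<inter> space M) \<inter> S l" for g A l
    by (auto simp: S_def)
  have S_sets: "S l \<in> sets M" if "good l" for l
    using that
  proof (induction l)
    case Nil
    then show ?case by (simp add: S_def)
  next
    case (Cons p l)
    then have "fst p \<in> borel_measurable M" "snd p \<in> sets borel" "S l \<in> sets M"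
      using F by (auto simp: good_def)
    then show ?case by (cases p) (auto simp: S_Cons intro: measurable_sets)
  qed
  \<comment> \<open>The measures are generalised because the induction step replaces
    \<open>K\<close> and \<open>L\<close> by their restrictions to the event
    \<open>g \<in> A\<close>.\<close>
  have key: "emeasure K (S l) = emeasure L (S l)"
    if "good l" "finite_measure K" "finite_measure L" "sets K = sets M" "sets L = sets M"
      "\<And>f. f \<in> F \<Longrightarrow> (CLINT x|K. iexp (f x)) = (CLINT x|L. iexp (f x))" for l K L
    using that
  proof (induction l arbitrary: K L)
    case Nil
    interpret K: finite_measure K by fact
    interpret L: finite_measure L by fact
    \<comment> \<open>Linearity puts the zero function into \<open>F\<close>; its characteristic
      function is the total mass.\<close>
    obtain f where "f \<in> F" using ne by auto
    then have "(\<lambda>x. 0 * f x + 0 * f x) \<in> F" by (rule lin) fact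
    from Nil(6)[OF this] have "measure K (space K) = measure L (space L)" by simp
    moreover have "space K = space M" "space L = space M"
      using Nil sets_eq_imp_space_eq by blast+
    ultimately show ?case by (simp add: S_def K.emeasure_eq_measure L.emeasure_eq_measure)
  next
    case (Cons p l)
    obtain g A where p: "p = (g, A)" by (cases p)
    with Cons.prems have g: "g \<in> F" and A: "A \<in> sets borel" and l: "good l" by (auto simp: good_def)
    let ?D = "\<lambda>K. density K (\<lambda>x. ennreal (indicator A (g x)))"
    have gm: "g \<in> borel_measurable K" if "sets K = sets M" for K
      using F[OF g] that measurable_cong_sets by blast
    have S: "emeasure (?D K) (S l) = emeasure K (S (p # l))" if "sets K = sets M" for K
    proof -
      have sp: "space K = space M" using that by (rule sets_eq_imp_space_eq)
      have "emeasure (?D K) (S l) = (\<integral>\<^sup>+x. ennreal (indicator A (g x)) * indicator (S l) x \<partial>K)"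
        using gm[OF that] A S_sets[OF l] that by (subst emeasure_density) auto
      also have "\<dots> = (\<integral>\<^sup>+x. indicator (S (p # l)) x \<partial>K)"
        by (intro nn_integral_cong) (auto simp: p S_Cons sp split: split_indicator)
      also have "\<dots> = emeasure K (S (p # l))"
        using S_sets[OF Cons.prems(1)] that by (intro nn_integral_indicator) simp
      finally show ?thesis .
    qed
    have I: "(CLINT x|?D K. iexp (f x)) = (CLINT x|K. iexp (f x) * complex_of_real (indicator A (g x)))"
      if "sets K = sets M" "f \<in> F" for K f
    proof -
      have [measurable]: "f \<in> borel_measurable K" using F[OF that(2)] that(1) measurable_cong_sets by blast
      have [measurable]: "g \<in> borel_measurable K" "A \<in> sets borel" using gm that A by auto
      show ?thesis by (subst integral_density) (auto simp: scaleR_conv_of_real mult.commute)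
    qed
    have "emeasure (?D K) (S l) = emeasure (?D L) (S l)"
    proof (rule Cons.IH[OF l])
      show "finite_measure (?D K)" "finite_measure (?D L)"
        using finite_measure_restrict_density[OF _ gm A] Cons.prems by auto
      show "(CLINT x|?D K. iexp (f x)) = (CLINT x|?D L. iexp (f x))" if f: "f \<in> F" for f
      proof -
        have "(CLINT x|K. iexp (f x) * complex_of_real (indicator A (g x))) =
              (CLINT x|L. iexp (f x) * complex_of_real (indicator A (g x)))"
        proof (rule char_eq_restrict[where F=F])
          show "f \<in> borel_measurable K" if "f \<in> F" for f
            using F[OF that] Cons.prems(4) measurable_cong_sets by blast
        qed (use Cons.prems g A f lin in \<open>simp_all\<close>)
        then show ?thesis using I[OF _ f] Cons.prems(4,5) by simp
      qed
    qed (use Cons.prems in simp_all)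
    then show ?case using S Cons.prems by simp
  qed
  show ?thesis
  proof (rule measure_eqI_generator_eq[where E="S ` Collect good" and \<Omega>="space M" and A="\<lambda>_. S []"])
    show "Int_stable (S ` Collect good)"
    proof (rule Int_stableI)
      fix a b assume "a \<in> S ` Collect good" "b \<in> S ` Collect good"
      then obtain l l' where "a = S l" "b = S l'" "good l" "good l'" by auto
      then have "a \<inter> b = S (l @ l')" "good (l @ l')" by (auto simp: S_def good_def)
      then show "a \<inter> b \<in> S ` Collect good" by auto
    qed
    show "sets M = sigma_sets (space M) (S ` Collect good)"
    proof (rule antisym)
      show "sigma_sets (space M) (S ` Collect good) \<subseteq> sets M"
        using S_sets by (intro sets.sigma_sets_subset) auto
      have "g -` A \<inter> space M \<in> S ` Collect good" if "g \<in> F" "A \<in> sets borel" for g A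
      proof -
        have "g -` A \<inter> space M = S [(g, A)]" by (auto simp: S_def)
        with that show ?thesis by (auto simp: good_def)
      qed
      then show "sets M \<subseteq> sigma_sets (space M) (S ` Collect good)"
        unfolding gen by (intro sigma_sets_mono') auto
    qed
    then show "sets N = sigma_sets (space M) (S ` Collect good)" using sets by simp
    show "emeasure M X = emeasure N X" if "X \<in> S ` Collect good" for X
      using that key fin sets eq by auto
    show "range (\<lambda>_. S []) \<subseteq> S ` Collect good" by (auto simp: good_def)
    show "emeasure M (S []) \<noteq> \<infinity>" for i :: nat
      using finite_measure.emeasure_finite[OF fin(1)] by simp
  qed (auto simp: S_def)
qed

text \<open>Separability makes countably many functionals determine the norm: closed balls are
  countable intersections of half spaces, open balls countable unions of closed ones with rational
  radii, and open sets countable unions of open balls.\<close>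

lemma borel_measurable_inner_iff:
  fixes f :: "'a \<Rightarrow> 'h::{real_inner, second_countable_topology}"
  shows "f \<in> borel_measurable M \<longleftrightarrow> (\<forall>u. (\<lambda>x. u \<bullet> f x) \<in> borel_measurable M)"
proof safe
  fix u assume [measurable]: "f \<in> borel_measurable M"
  show "(\<lambda>x. u \<bullet> f x) \<in> borel_measurable M" by measurable
next
  assume m [measurable]: "\<forall>u. (\<lambda>x. u \<bullet> f x) \<in> borel_measurable M"
  obtain D :: "'h set" where D: "countable D" "\<And>X. open X \<Longrightarrow> X \<noteq> {} \<Longrightarrow> \<exists>d\<in>D. d \<in> X"
    using countable_dense_exists by metis
  \<comment> \<open>Keeping \<open>norm d\<close> on the right avoids normalising \<open>d\<close>.
    If \<open>norm z > q\<close>, then \<open>z\<close> itself violates the condition strictly;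
    violation is an open property, so some \<open>d\<close> in the dense set violates it
    too.\<close>
  have norm_le: "norm z \<le> q \<longleftrightarrow> (\<forall>d\<in>D. d \<bullet> z \<le> q * norm d)" if "0 \<le> q" for z :: 'h and q
  proof
    assume "norm z \<le> q"
    have "d \<bullet> z \<le> q * norm d" for d
    proof -
      have "d \<bullet> z \<le> norm d * norm z" by (rule norm_cauchy_schwarz)
      also have "\<dots> \<le> norm d * q" using \<open>norm z \<le> q\<close> by (rule mult_left_mono) simp
      finally show ?thesis by (simp add: mult.commute)
    qed
    then show "\<forall>d\<in>D. d \<bullet> z \<le> q * norm d" by blast
  next
    assume *: "\<forall>d\<in>D. d \<bullet> z \<le> q * norm d"
    show "norm z \<le> q"
    proof (rule ccontr)
      assume n: "\<not> norm z \<le> q"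
      let ?X = "{y. y \<bullet> z > q * norm y}"
      have "open ?X" by (intro open_Collect_less continuous_intros)
      moreover have "q * norm z < norm z * norm z"
        using n that by (intro mult_strict_right_mono) auto
      then have "z \<in> ?X"
        by (simp add: power2_norm_eq_inner[symmetric] power2_eq_square)
      ultimately obtain d where "d \<in> D" "d \<in> ?X" using D(2)[of ?X] by auto
      with * show False by force
    qed
  qed
  have ball_sets: "f -` ball c r \<inter> space M \<in> sets M" for c r
  proof -
    have "f -` ball c r \<inter> space M =
       {x \<in> space M. \<exists>q\<in>{q\<in>\<rat>. 0 \<le> q \<and> q < r}. \<forall>d\<in>D. d \<bullet> f x - d \<bullet> c \<le> q * norm d}"
    proof (intro set_eqI iffI)
      fix x assume "x \<in> f -` ball c r \<inter> space M"
      then have x: "x \<in> space M" "norm (f x - c) < r" by (auto simp: dist_norm norm_minus_commute)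
      obtain q where q: "q \<in> \<rat>" "norm (f x - c) < q" "q < r" using Rats_dense_in_real[OF x(2)] by auto
      then have "0 \<le> q" using norm_ge_zero[of "f x - c"] by linarith
      then show "x \<in> {x \<in> space M. \<exists>q\<in>{q\<in>\<rat>. 0 \<le> q \<and> q < r}. \<forall>d\<in>D. d \<bullet> f x - d \<bullet> c \<le> q * norm d}"
        using norm_le[of q "f x - c"] q x by (auto simp: inner_diff_right)
    next
      fix x assume "x \<in> {x \<in> space M. \<exists>q\<in>{q\<in>\<rat>. 0 \<le> q \<and> q < r}. \<forall>d\<in>D. d \<bullet> f x - d \<bullet> c \<le> q * norm d}"
      then obtain q where "x \<in> space M" "0 \<le> q" "q < r" "\<forall>d\<in>D. d \<bullet> (f x - c) \<le> q * norm d"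
        by (auto simp: inner_diff_right)
      with norm_le[of q "f x - c"] show "x \<in> f -` ball c r \<inter> space M"
        by (auto simp: dist_norm norm_minus_commute)
    qed
    also have "\<dots> \<in> sets M"
    proof -
      have "countable {q\<in>\<rat>. 0 \<le> q \<and> q < r}"
        by (rule countable_subset[OF _ countable_rat]) auto
      moreover have half: "{x \<in> space M. d \<bullet> f x - d \<bullet> c \<le> q * norm d} \<in> sets M" for d q
      proof -
        have [measurable]: "(\<lambda>x. d \<bullet> f x) \<in> borel_measurable M" using m by blast
        show ?thesis by measurable
      qed
      have "{x \<in> space M. \<forall>d\<in>D. d \<bullet> f x - d \<bullet> c \<le> q * norm d} \<in> sets M" for q
        using half D(1) by (rule sets.sets_Collect_countable_All')
      ultimately show ?thesis
        by (intro sets.sets_Collect_countable_Ex')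
    qed
    finally show ?thesis .
  qed
  show "f \<in> borel_measurable M"
  proof (rule borel_measurableI)
    fix S :: "'h set" assume S: "open S"
    have "f -` S \<inter> space M = (\<Union>d\<in>D. \<Union>q\<in>{q\<in>\<rat>. ball d q \<subseteq> S}. f -` ball d q \<inter> space M)"
    proof (intro set_eqI iffI)
      fix x assume x: "x \<in> f -` S \<inter> space M"
      then obtain e where e: "e > 0" "ball (f x) e \<subseteq> S" using S by (auto simp: open_contains_ball)
      obtain q where q: "q \<in> \<rat>" "0 < q" "q < e / 2" using Rats_dense_in_real[of 0 "e/2"] e by auto
      obtain d where d: "d \<in> D" "d \<in> ball (f x) q" using D(2)[of "ball (f x) q"] q by auto
      have "ball d q \<subseteq> ball (f x) e"
      proof
        fix y assume "y \<in> ball d q"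
        then show "y \<in> ball (f x) e"
          using d q dist_triangle[of "f x" y d] by (auto simp: dist_commute)
      qed
      with e d q x show "x \<in> (\<Union>d\<in>D. \<Union>q\<in>{q\<in>\<rat>. ball d q \<subseteq> S}. f -` ball d q \<inter> space M)"
        by (auto simp: dist_commute)
    qed auto
    also have "\<dots> \<in> sets M"
    proof -
      have "countable {q\<in>\<rat>. ball d q \<subseteq> S}" for d
        by (rule countable_subset[OF _ countable_rat]) auto
      then show ?thesis using D(1) ball_sets by (intro sets.countable_UN'') auto
    qed
    finally show "f -` S \<inter> space M \<in> sets M" .
  qed
qed

text \<open>The index set is arbitrary, since path laws need all nonnegative times. The family
  \<open>F\<close> consists of the linear functionals of finitely many coordinates; two of them are
  added over the union of their index sets, with coefficients extended by 0.\<close>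

theorem measure_eqI_char_PiM:
  fixes M N :: "('i \<Rightarrow> 'h::{real_inner, second_countable_topology}) measure"
  assumes "finite_measure M" "finite_measure N"
    and sM: "sets M = sets (Pi\<^sub>M I (\<lambda>_. borel))" and sN: "sets N = sets (Pi\<^sub>M I (\<lambda>_. borel))"
    and eq: "\<And>J u. finite J \<Longrightarrow> J \<subseteq> I \<Longrightarrow>
      (CLINT x|M. iexp (\<Sum>i\<in>J. u i \<bullet> x i)) = (CLINT x|N. iexp (\<Sum>i\<in>J. u i \<bullet> x i))"
  shows "M = N"
proof (rule measure_eqI_char_family)
  define F where "F = {(\<lambda>x :: 'i \<Rightarrow> 'h. \<Sum>i\<in>J. u i \<bullet> x i) | J u. finite J \<and> J \<subseteq> I}"
  have sp: "space M = (\<Pi>\<^sub>E i\<in>I. UNIV)" using sets_eq_imp_space_eq[OF sM] by (simp add: space_PiM)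
  show "finite_measure M" "finite_measure N" "sets N = sets M" using assms by auto
  show "F \<noteq> {}" by (auto simp: F_def)
  have Fm: "f \<in> borel_measurable (Pi\<^sub>M I (\<lambda>_. borel))" if "f \<in> F" for f
  proof -
    obtain J u where f: "f = (\<lambda>x. \<Sum>i\<in>J. u i \<bullet> x i)" "J \<subseteq> I" using \<open>f \<in> F\<close> unfolding F_def by blast
    have "(\<lambda>x. \<Sum>i\<in>J. u i \<bullet> x i) \<in> borel_measurable (Pi\<^sub>M I (\<lambda>_. borel :: 'h measure))"
    proof (intro borel_measurable_sum borel_measurable_inner borel_measurable_const)
      fix i assume "i \<in> J"
      then have "i \<in> I" using f by auto
      then show "(\<lambda>x. x i) \<in> borel_measurable (Pi\<^sub>M I (\<lambda>_. borel :: 'h measure))" by simp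
    qed
    with f show ?thesis by simp
  qed
  then show "f \<in> borel_measurable M" if "f \<in> F" for f
    using that sM measurable_cong_sets by blast
  show "(\<lambda>x. r * f x + s * g x) \<in> F" if "f \<in> F" "g \<in> F" for f g r s
  proof -
    obtain J u K v where f: "f = (\<lambda>x. \<Sum>i\<in>J. u i \<bullet> x i)" "finite J" "J \<subseteq> I"
      and g: "g = (\<lambda>x. \<Sum>i\<in>K. v i \<bullet> x i)" "finite K" "K \<subseteq> I" using \<open>f \<in> F\<close> \<open>g \<in> F\<close> unfolding F_def by blast
    let ?w = "\<lambda>i. r *\<^sub>R (if i \<in> J then u i else 0) + s *\<^sub>R (if i \<in> K then v i else 0)"
    have "r * f x + s * g x = (\<Sum>i\<in>J \<union> K. ?w i \<bullet> x i)" for x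
    proof -
      have "(\<Sum>i\<in>J. u i \<bullet> x i) = (\<Sum>i\<in>J \<union> K. (if i \<in> J then u i else 0) \<bullet> x i)"
        using f g by (intro sum.mono_neutral_cong_left) auto
      moreover have "(\<Sum>i\<in>K. v i \<bullet> x i) = (\<Sum>i\<in>J \<union> K. (if i \<in> K then v i else 0) \<bullet> x i)"
        using f g by (intro sum.mono_neutral_cong_left) auto
      ultimately show ?thesis unfolding f g
        by (simp add: sum_distrib_left sum.distrib inner_add_left)
    qed
    then have "(\<lambda>x. r * f x + s * g x) = (\<lambda>x. \<Sum>i\<in>J \<union> K. ?w i \<bullet> x i)" by (rule ext)
    moreover have "finite (J \<union> K)" "J \<union> K \<subseteq> I" using f g by auto
    ultimately show ?thesis unfolding F_def by (intro CollectI exI[of _ "J \<union> K"] exI[of _ ?w] conjI)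
  qed
  show "(CLINT x|M. iexp (f x)) = (CLINT x|N. iexp (f x))" if "f \<in> F" for f
    using that eq by (auto simp: F_def)
  let ?G = "{g -` A \<inter> space M | g A. g \<in> F \<and> A \<in> sets borel}"
  show "sets M = sigma_sets (space M) ?G"
  proof (rule antisym)
    have spP: "space M = space (Pi\<^sub>M I (\<lambda>_. borel :: 'h measure))" using sM by (rule sets_eq_imp_space_eq)
    have "?G \<subseteq> sets M" unfolding sM spP using measurable_sets[OF Fm] by blast
    then show "sigma_sets (space M) ?G \<subseteq> sets M" by (rule sets.sigma_sets_subset)
    let ?M0 = "sigma (space M) ?G"
    have G0: "?G \<subseteq> Pow (space M)" by auto
    have F0: "f \<in> borel_measurable ?M0" if "f \<in> F" for f
      using that by (intro measurableI) (auto simp: G0 intro!: sigma_sets.Basic)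
    \<comment> \<open>Measurability of the identity into the product space says that the product
      sets are already generated by \<open>F\<close>; a single coordinate is covered by the
      functionals with \<open>J = {i}\<close>.\<close>
    have "(\<lambda>x. x) \<in> measurable ?M0 (Pi\<^sub>M I (\<lambda>_. borel :: 'h measure))"
    proof (rule measurable_PiM_single')
      fix i assume i: "i \<in> I"
      have "(\<lambda>x. u \<bullet> x i) \<in> F" for u
        using i by (force simp: F_def intro!: exI[of _ "{i}"] exI[of _ "\<lambda>_. u"])
      then show "(\<lambda>x. x i) \<in> borel_measurable ?M0"
        by (subst borel_measurable_inner_iff) (blast intro: F0)
    qed (simp add: space_measure_of_conv sp)
    then have "A \<in> sets ?M0" if "A \<in> sets M" for A
      using that measurable_sets[of "\<lambda>x. x" ?M0 _ A] sets.sets_into_space[OF that] sM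
      by (simp add: space_measure_of[OF G0] Int_absorb2)
    then show "sets M \<subseteq> sigma_sets (space M) ?G" by (auto simp: sets_measure_of[OF G0])
  qed
qed

theorem measure_eqI_char:
  fixes M N :: "'h::{real_inner, second_countable_topology} measure"
  assumes fin: "finite_measure M" "finite_measure N"
    and sM: "sets M = sets borel" and sN: "sets N = sets borel"
    and eq: "\<And>u. (CLINT x|M. iexp (u \<bullet> x)) = (CLINT x|N. iexp (u \<bullet> x))"
  shows "M = N"
proof (rule measure_eqI_char_family)
  define F where "F = range (\<lambda>u x :: 'h. u \<bullet> x)"
  have sp: "space M = UNIV" using sets_eq_imp_space_eq[OF sM] by simp
  have Fm: "f \<in> borel_measurable borel" if "f \<in> F" for f
    using that by (auto simp: F_def)
  then show "f \<in> borel_measurable M" if "f \<in> F" for f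
    using that sM measurable_cong_sets by blast
  show "(\<lambda>x. r * f x + s * g x) \<in> F" if "f \<in> F" "g \<in> F" for f g r s
  proof -
    obtain u v where "f = (\<lambda>x. u \<bullet> x)" "g = (\<lambda>x. v \<bullet> x)" using \<open>f \<in> F\<close> \<open>g \<in> F\<close> by (auto simp: F_def)
    then have "(\<lambda>x. r * f x + s * g x) = (\<lambda>x. (r *\<^sub>R u + s *\<^sub>R v) \<bullet> x)" by (simp add: inner_add_left)
    then show ?thesis unfolding F_def by blast
  qed
  show "(CLINT x|M. iexp (f x)) = (CLINT x|N. iexp (f x))" if "f \<in> F" for f
    using that eq by (auto simp: F_def)
  let ?G = "{g -` A \<inter> space M | g A. g \<in> F \<and> A \<in> sets borel}"
  show "sets M = sigma_sets (space M) ?G"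
  proof (rule antisym)
    have "?G \<subseteq> sets M" using measurable_sets[OF Fm] sM sp by fastforce
    then show "sigma_sets (space M) ?G \<subseteq> sets M" by (rule sets.sigma_sets_subset)
    let ?M0 = "sigma (space M) ?G"
    have G0: "?G \<subseteq> Pow (space M)" by auto
    have F0: "f \<in> borel_measurable ?M0" if "f \<in> F" for f
      using that by (intro measurableI) (auto simp: G0 intro!: sigma_sets.Basic)
    have "(\<lambda>x. u \<bullet> x) \<in> borel_measurable ?M0" for u
      by (rule F0) (auto simp: F_def)
    then have "(\<lambda>x. x) \<in> borel_measurable ?M0"
      by (subst borel_measurable_inner_iff) blast
    then have "A \<in> sets ?M0" if "A \<in> sets M" for A
      using that measurable_sets[of "\<lambda>x. x" ?M0 _ A] sM sp
      by (simp add: space_measure_of[OF G0])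
    then show "sets M \<subseteq> sigma_sets (space M) ?G" by (auto simp: sets_measure_of[OF G0])
  qed
qed (use assms in auto)

section \<open>Laws of Levy processes\<close>

lemma iexp_sum: "iexp (\<Sum>i\<in>I. f i) = (\<Prod>i\<in>I. iexp (f i))"
  by (induction I rule: infinite_finite_induct) (simp_all add: distrib_left exp_add)

lemma (in prob_space) integrable_iexp_comp:
  assumes [measurable]: "f \<in> borel_measurable M"
  shows "integrable M (\<lambda>x. iexp (f x))"
  by (intro integrable_const_bound[where B=1]) auto

text \<open>The factorisation says that the joint law and the product of the marginal laws have the
  same characteristic function. They therefore coincide, which is independence.\<close>

lemma (in prob_space) indep_vars_char:
  fixes X :: "'i \<Rightarrow> 'a \<Rightarrow> 'h::{real_inner, second_countable_topology}"
  assumes fin: "finite I" and rv: "\<And>i. i \<in> I \<Longrightarrow> X i \<in> borel_measurable M"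
    and cf: "\<And>u. (CLINT x|M. iexp (\<Sum>i\<in>I. u i \<bullet> X i x)) = (\<Prod>i\<in>I. CLINT x|M. iexp (u i \<bullet> X i x))"
  shows "indep_vars (\<lambda>_. borel) X I"
proof (cases "I = {}")
  case True
  then show ?thesis by (simp add: indep_vars_def indep_sets_def)
next
  case False
  \<comment> \<open>Outside \<open>I\<close> the family is continued by constants, because the
    product space asks for a probability law at every index.\<close>
  define Y where "Y i = (if i \<in> I then X i else (\<lambda>_. 0))" for i
  have Y [measurable]: "Y i \<in> borel_measurable M" for i using rv by (simp add: Y_def)
  interpret Yp: product_prob_space "\<lambda>i. distr M borel (Y i)" I
    by (rule product_prob_spaceI) (simp add: prob_space_distr)
  have "distr M (Pi\<^sub>M I (\<lambda>_. borel)) (\<lambda>x. \<lambda>i\<in>I. Y i x) = Pi\<^sub>M I (\<lambda>i. distr M borel (Y i))" (is "?L = ?R")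
  proof (rule measure_eqI_char_PiM)
    have m: "(\<lambda>x. \<lambda>i\<in>I. Y i x) \<in> measurable M (Pi\<^sub>M I (\<lambda>_. borel))" by measurable
    show "finite_measure ?L" using m by (rule finite_measure_distr)
    show "finite_measure ?R" by unfold_locales
    show "sets ?R = sets (Pi\<^sub>M I (\<lambda>_. borel))" by (intro sets_PiM_cong) auto
    fix J and u :: "'i \<Rightarrow> 'h" assume J: "finite J" "J \<subseteq> I"
    define v where "v i = (if i \<in> J then u i else 0)" for i
    have vs: "(\<Sum>i\<in>J. u i \<bullet> x i) = (\<Sum>i\<in>I. v i \<bullet> x i)" for x
      unfolding v_def using J fin by (intro sum.mono_neutral_cong_left) auto
    have "(CLINT x|?L. iexp (\<Sum>i\<in>J. u i \<bullet> x i)) = (CLINT x|M. iexp (\<Sum>i\<in>I. v i \<bullet> X i x))"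
      unfolding vs using m
      by (subst integral_distr) (auto intro!: Bochner_Integration.integral_cong sum.cong simp: Y_def)
    also have "\<dots> = (\<Prod>i\<in>I. CLINT x|M. iexp (v i \<bullet> X i x))" by (rule cf)
    also have "\<dots> = (\<Prod>i\<in>I. CLINT x|distr M borel (Y i). iexp (v i \<bullet> x))"
      by (intro prod.cong refl, subst integral_distr) (auto simp: Y_def intro: rv)
    also have "\<dots> = (CLINT x|?R. (\<Prod>i\<in>I. iexp (v i \<bullet> x i)))"
    proof (rule Yp.product_integral_prod[symmetric, OF fin])
      fix i assume "i \<in> I"
      have "prob_space (distr M borel (Y i))" by (rule prob_space_distr) simp
      show "integrable (distr M borel (Y i)) (\<lambda>x. iexp (v i \<bullet> x))"
        by (rule prob_space.integrable_iexp_comp) (simp_all add: prob_space_distr)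
    qed
    also have "\<dots> = (CLINT x|?R. iexp (\<Sum>i\<in>J. u i \<bullet> x i))"
      unfolding vs iexp_sum ..
    finally show "(CLINT x|?L. iexp (\<Sum>i\<in>J. u i \<bullet> x i)) = (CLINT x|?R. iexp (\<Sum>i\<in>J. u i \<bullet> x i))" .
  qed simp
  then have "indep_vars (\<lambda>_. borel) Y I"
    by (subst indep_vars_iff_distr_eq_PiM[OF False]) auto
  then show ?thesis
    by (subst indep_vars_cong[of I I X Y]) (auto simp: Y_def)
qed

lemma (in prob_space) char_indep_sum:
  fixes X :: "'i \<Rightarrow> 'a \<Rightarrow> 'h::{real_inner, second_countable_topology}"
  assumes fin: "finite I" and ind: "indep_vars (\<lambda>_. borel) X I"
  shows "(CLINT x|M. iexp (\<Sum>i\<in>I. u i \<bullet> X i x)) = (\<Prod>i\<in>I. CLINT x|M. iexp (u i \<bullet> X i x))"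
proof -
  have m: "X i \<in> borel_measurable M" if "i \<in> I" for i
    using ind that by (auto simp: indep_vars_def)
  have "indep_vars (\<lambda>_. borel) (\<lambda>i x. iexp (u i \<bullet> X i x)) I"
    by (rule indep_vars_compose2[OF ind]) simp
  from indep_vars_lebesgue_integral[OF fin this]
  show ?thesis unfolding iexp_sum
    by (simp add: integrable_iexp_comp borel_measurable_inner m)
qed

text \<open>Abel summation: an increment enters all later values, so its coefficient is the sum of
  their coefficients.\<close>

lemma sum_inner_abel:
  fixes v y :: "nat \<Rightarrow> 'h::real_inner"
  shows "(\<Sum>k<n. v k \<bullet> y (Suc k)) =
    (\<Sum>k<n. (\<Sum>j=k..<n. v j) \<bullet> (y (Suc k) - y k)) + (\<Sum>j<n. v j) \<bullet> y 0"
proof (induction n)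
  case (Suc n)
  have "(\<Sum>k<Suc n. (\<Sum>j=k..<Suc n. v j) \<bullet> (y (Suc k) - y k)) =
    (\<Sum>k<Suc n. (\<Sum>j=k..<n. v j) \<bullet> (y (Suc k) - y k) + v n \<bullet> (y (Suc k) - y k))"
    by (intro sum.cong) (auto simp: inner_add_left)
  also have "\<dots> = (\<Sum>k<n. (\<Sum>j=k..<n. v j) \<bullet> (y (Suc k) - y k)) + v n \<bullet> (\<Sum>k<Suc n. y (Suc k) - y k)"
    by (simp add: sum.distrib inner_sum_right inner_add_right)
  also have "(\<Sum>k<Suc n. y (Suc k) - y k) = y (Suc n) - y 0" by (rule sum_lessThan_telescope)
  finally show ?case using Suc.IH by (simp add: inner_add_left inner_diff_right)
qed simp

lemma levy_processD:
  assumes "levy_process M X"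
  shows "prob_space M" "\<And>t. 0 \<le> t \<Longrightarrow> X t \<in> borel_measurable M" "AE \<omega> in M. X 0 \<omega> = 0"
    "\<And>n t. 0 \<le> t 0 \<Longrightarrow> mono_on {..n} t \<Longrightarrow>
       prob_space.indep_vars M (\<lambda>_. borel) (\<lambda>k \<omega>. X (t (Suc k)) \<omega> - X (t k) \<omega>) {..<n::nat}"
    "\<And>s t. 0 \<le> s \<Longrightarrow> s \<le> t \<Longrightarrow> distr M borel (\<lambda>\<omega>. X t \<omega> - X s \<omega>) = distr M borel (X (t - s))"
    "AE \<omega> in M. cadlag (\<lambda>t. X t \<omega>)"
  using assms unfolding levy_process_def by blast+

lemma levy_process_char:
  fixes X :: "real \<Rightarrow> 'w \<Rightarrow> 'h::{real_inner, second_countable_topology}"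
  assumes X: "levy_process M X" and t: "0 \<le> t 0" "mono_on {..n} t"
  shows "(CLINT \<omega>|M. iexp (\<Sum>k<n. c k \<bullet> (X (t (Suc k)) \<omega> - X (t k) \<omega>))) =
    (\<Prod>k<n. CLINT \<omega>|M. iexp (c k \<bullet> X (t (Suc k) - t k) \<omega>))"
proof -
  interpret prob_space M using X by (rule levy_processD)
  note m = levy_processD(2)[OF X]
  have t0: "0 \<le> t k" if "k \<le> n" for k
    using t mono_onD[OF t(2), of 0 k] that by auto
  have "(CLINT \<omega>|M. iexp (c k \<bullet> (X (t (Suc k)) \<omega> - X (t k) \<omega>))) = (CLINT \<omega>|M. iexp (c k \<bullet> X (t (Suc k) - t k) \<omega>))"
    if "k < n" for k
  proof -
    have le: "t k \<le> t (Suc k)" "0 \<le> t k" "0 \<le> t (Suc k)"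
      using mono_onD[OF t(2), of k "Suc k"] t0 that by auto
    have [measurable]: "X (t (Suc k)) \<in> borel_measurable M" "X (t k) \<in> borel_measurable M"
      "X (t (Suc k) - t k) \<in> borel_measurable M" using m le by auto
    have "(CLINT \<omega>|M. iexp (c k \<bullet> (X (t (Suc k)) \<omega> - X (t k) \<omega>))) =
      (CLINT x|distr M borel (\<lambda>\<omega>. X (t (Suc k)) \<omega> - X (t k) \<omega>). iexp (c k \<bullet> x))"
      by (subst integral_distr) auto
    also have "\<dots> = (CLINT \<omega>|M. iexp (c k \<bullet> X (t (Suc k) - t k) \<omega>))"
      unfolding levy_processD(5)[OF X le(2,1)] by (subst integral_distr) auto
    finally show ?thesis .
  qed
  then show ?thesis
    by (subst char_indep_sum[OF _ levy_processD(4)[OF X t]]) auto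
qed

lemma measurable_sample_path:
  assumes "\<And>t. 0 \<le> t \<Longrightarrow> X t \<in> borel_measurable M"
  shows "sample_path X \<in> measurable M (Pi\<^sub>M {0..} (\<lambda>_. borel))"
proof -
  have "(\<lambda>\<omega>. \<lambda>t\<in>{0..}. X t \<omega>) \<in> measurable M (Pi\<^sub>M {0..} (\<lambda>_. borel))"
    using assms by (intro measurable_restrict) auto
  then show ?thesis by (simp add: sample_path_def[abs_def])
qed

lemma levy_process_char_coords:
  fixes X :: "real \<Rightarrow> 'w \<Rightarrow> 'h::{real_inner, second_countable_topology}"
  assumes X: "levy_process M X" and t: "t 0 = 0" "mono_on {..n} t"
  shows "(CLINT \<omega>|M. iexp (\<Sum>k<n. v k \<bullet> X (t (Suc k)) \<omega>)) =
    (\<Prod>k<n. CLINT \<omega>|M. iexp ((\<Sum>j=k..<n. v j) \<bullet> X (t (Suc k) - t k) \<omega>))"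
proof -
  have m: "X (t k) \<in> borel_measurable M" if "k \<le> n" for k
    using mono_onD[OF t(2), of 0 k] t(1) that by (intro levy_processD[OF X]) auto
  have "(CLINT \<omega>|M. iexp (\<Sum>k<n. v k \<bullet> X (t (Suc k)) \<omega>)) =
    (CLINT \<omega>|M. iexp (\<Sum>k<n. (\<Sum>j=k..<n. v j) \<bullet> (X (t (Suc k)) \<omega> - X (t k) \<omega>)))"
  proof (rule integral_cong_AE)
    show "AE \<omega> in M. iexp (\<Sum>k<n. v k \<bullet> X (t (Suc k)) \<omega>) =
        iexp (\<Sum>k<n. (\<Sum>j=k..<n. v j) \<bullet> (X (t (Suc k)) \<omega> - X (t k) \<omega>))"
      using levy_processD(3)[OF X]
    proof eventually_elim
      case (elim \<omega>)
      show ?case using sum_inner_abel[of v "\<lambda>k. X (t k) \<omega>" n] elim t(1) by simp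
    qed
    have [measurable]: "(\<lambda>\<omega>. \<Sum>k<n. v k \<bullet> X (t (Suc k)) \<omega>) \<in> borel_measurable M"
      "(\<lambda>\<omega>. \<Sum>k<n. (\<Sum>j=k..<n. v j) \<bullet> (X (t (Suc k)) \<omega> - X (t k) \<omega>)) \<in> borel_measurable M"
      by (intro borel_measurable_sum borel_measurable_inner borel_measurable_diff m borel_measurable_const; simp)+
    show "(\<lambda>\<omega>. iexp (\<Sum>k<n. v k \<bullet> X (t (Suc k)) \<omega>)) \<in> borel_measurable M"
      "(\<lambda>\<omega>. iexp (\<Sum>k<n. (\<Sum>j=k..<n. v j) \<bullet> (X (t (Suc k)) \<omega> - X (t k) \<omega>))) \<in> borel_measurable M"
      by measurable
  qed
  also have "\<dots> = (\<Prod>k<n. CLINT \<omega>|M. iexp ((\<Sum>j=k..<n. v j) \<bullet> X (t (Suc k) - t k) \<omega>))"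
    by (rule levy_process_char[OF X]) (use t in auto)
  finally show ?thesis .
qed

text \<open>The right-hand side involves the process only through characteristic functions at single
  times. This is what makes the path law of a Levy process a function of its one-dimensional
  laws.\<close>

lemma levy_process_char_law:
  fixes X :: "real \<Rightarrow> 'w \<Rightarrow> 'h::{real_inner, second_countable_topology}"
  assumes X: "levy_process M X" and J: "J \<subseteq> {0..}" and t: "t 0 = 0" "mono_on {..n} t"
    and sumJ: "\<And>x :: real \<Rightarrow> 'h. (\<Sum>s\<in>J. u s \<bullet> x s) = (\<Sum>k<n. u (t (Suc k)) \<bullet> x (t (Suc k)))"
  shows "(CLINT x|distr M (Pi\<^sub>M {0..} (\<lambda>_. borel)) (sample_path X). iexp (\<Sum>s\<in>J. u s \<bullet> x s)) =
     (\<Prod>k<n. CLINT \<omega>|M. iexp ((\<Sum>j=k..<n. u (t (Suc j))) \<bullet> X (t (Suc k) - t k) \<omega>))"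
proof -
  have tpos: "0 \<le> t k" if "k \<le> n" for k
    using mono_onD[OF t(2), of 0 k] t(1) that by auto
  have "(CLINT x|distr M (Pi\<^sub>M {0..} (\<lambda>_. borel)) (sample_path X). iexp (\<Sum>s\<in>J. u s \<bullet> x s)) =
    (CLINT \<omega>|M. iexp (\<Sum>s\<in>J. u s \<bullet> sample_path X \<omega> s))"
  proof (rule integral_distr)
    show "sample_path X \<in> M \<rightarrow>\<^sub>M Pi\<^sub>M {0..} (\<lambda>_. borel)"
      by (rule measurable_sample_path[OF levy_processD(2)[OF X]])
    have [measurable]: "(\<lambda>x. \<Sum>s\<in>J. u s \<bullet> x s) \<in> borel_measurable (Pi\<^sub>M {0..} (\<lambda>_. borel :: 'h measure))"
    proof (intro borel_measurable_sum borel_measurable_inner borel_measurable_const)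
      fix i assume "i \<in> J"
      then have "i \<in> {0..}" using J by auto
      then show "(\<lambda>x. x i) \<in> borel_measurable (Pi\<^sub>M {0..} (\<lambda>_. borel :: 'h measure))"
        by (rule measurable_component_singleton)
    qed
    show "(\<lambda>x. iexp (\<Sum>s\<in>J. u s \<bullet> x s)) \<in> borel_measurable (Pi\<^sub>M {0..} (\<lambda>_. borel :: 'h measure))"
      by measurable
  qed
  also have "\<dots> = (CLINT \<omega>|M. iexp (\<Sum>k<n. u (t (Suc k)) \<bullet> X (t (Suc k)) \<omega>))"
  proof -
    have "(\<Sum>s\<in>J. u s \<bullet> sample_path X \<omega> s) = (\<Sum>k<n. u (t (Suc k)) \<bullet> X (t (Suc k)) \<omega>)" for \<omega>
      unfolding sumJ using tpos by (intro sum.cong) (auto simp: sample_path_def)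
    then show ?thesis by simp
  qed
  also have "\<dots> = (\<Prod>k<n. CLINT \<omega>|M. iexp ((\<Sum>j=k..<n. u (t (Suc j))) \<bullet> X (t (Suc k) - t k) \<omega>))"
    by (rule levy_process_char_coords[OF X t])
  finally show ?thesis .
qed

theorem process_law_eqI:
  fixes X :: "real \<Rightarrow> 'w \<Rightarrow> 'h::{real_inner, second_countable_topology}"
    and Y :: "real \<Rightarrow> 'v \<Rightarrow> 'h"
  assumes X: "levy_process M X" and Y: "levy_process N Y"
    and eq: "\<And>t u. 0 \<le> t \<Longrightarrow> (CLINT \<omega>|M. iexp (u \<bullet> X t \<omega>)) = (CLINT \<omega>|N. iexp (u \<bullet> Y t \<omega>))"
  shows "process_law M X = process_law N Y"
  unfolding process_law_def
proof (rule measure_eqI_char_PiM)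
  note mX = measurable_sample_path[OF levy_processD(2)[OF X]] and mY = measurable_sample_path[OF levy_processD(2)[OF Y]]
  interpret M: prob_space M using X by (rule levy_processD)
  interpret N: prob_space N using Y by (rule levy_processD)
  show "finite_measure (distr M (Pi\<^sub>M {0..} (\<lambda>_. borel)) (sample_path X))"
    "finite_measure (distr N (Pi\<^sub>M {0..} (\<lambda>_. borel)) (sample_path Y))"
    using mX mY by (auto intro: M.finite_measure_distr N.finite_measure_distr)
  fix J :: "real set" and u :: "real \<Rightarrow> 'h" assume J: "finite J" "J \<subseteq> {0..}"
  define l n where "l = sorted_list_of_set J" and "n = card J"
  have l: "sorted l" "distinct l" "set l = J" "length l = n" using J by (auto simp: l_def n_def)
  \<comment> \<open>The grid consists of 0 followed by the times of \<open>J\<close> in increasing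
    order. With \<open>t 0 = 0\<close>, where the process vanishes almost surely, every coordinate
    is a sum of increments.\<close>
  define t where "t k = (case k of 0 \<Rightarrow> 0 | Suc j \<Rightarrow> l ! j)" for k
  have t0: "t 0 = 0" and tS: "t (Suc k) = l ! k" for k by (auto simp: t_def)
  have mono: "mono_on {..n} t"
  proof (rule mono_onI)
    fix r s assume rs: "r \<in> {..n}" "s \<in> {..n}" "r \<le> s"
    show "t r \<le> t s"
    proof (cases r)
      case 0
      show ?thesis
      proof (cases s)
        case (Suc j)
        then have "l ! j \<in> J" using rs l nth_mem[of j l] by auto
        then show ?thesis using 0 Suc J by (auto simp: t_def)
      qed (use 0 in simp)
    next
      case (Suc i)
      then obtain j where "s = Suc j" "i \<le> j" "j < n" using rs by (cases s) auto
      then show ?thesis using Suc l sorted_nth_mono[of l i j] by (simp add: tS)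
    qed
  qed
  have sumJ: "(\<Sum>s\<in>J. u s \<bullet> x s) = (\<Sum>k<n. u (t (Suc k)) \<bullet> x (t (Suc k)))" for x :: "real \<Rightarrow> 'h"
    unfolding tS using sum.reindex_bij_betw[OF bij_betw_nth[OF l(2), of "{..<n}" J], of "\<lambda>s. u s \<bullet> x s"] l by simp
  have tpos: "0 \<le> t k" if "k \<le> n" for k
    using mono_onD[OF mono, of 0 k] t0 that by auto
  note main = levy_process_char_law[where J=J and u=u, OF _ J(2) t0 mono sumJ]
  show "(CLINT x|distr M (Pi\<^sub>M {0..} (\<lambda>_. borel)) (sample_path X). iexp (\<Sum>s\<in>J. u s \<bullet> x s)) =
    (CLINT x|distr N (Pi\<^sub>M {0..} (\<lambda>_. borel)) (sample_path Y). iexp (\<Sum>s\<in>J. u s \<bullet> x s))"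
    unfolding main[OF X] main[OF Y]
    using mono_onD[OF mono] by (intro prod.cong refl eq) auto
qed auto

section \<open>Positive operators of trace class\<close>

lemma psd_operatorD:
  assumes "psd_operator A"
  shows "bounded_linear A" "A x \<bullet> y = x \<bullet> A y" "0 \<le> A x \<bullet> x"
  using assms unfolding psd_operator_def by blast+

text \<open>Forms rather than operators, because the Cholesky elimination below subtracts rank-one
  forms and its remainders stay in this class.\<close>

definition psd_form :: "('h::real_vector \<Rightarrow> 'h \<Rightarrow> real) \<Rightarrow> bool" where
  "psd_form f \<longleftrightarrow> (\<forall>x y. f x y = f y x) \<and> (\<forall>x. linear (f x)) \<and> (\<forall>x. 0 \<le> f x x)"

lemma psd_formD:
  assumes "psd_form f"
  shows "f x y = f y x" "linear (f x)" "0 \<le> f x x"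
    "f x (y + z) = f x y + f x z" "f x (c *\<^sub>R y) = c * f x y"
    "f (y + z) x = f y x + f z x" "f (c *\<^sub>R y) x = c * f y x" "f x 0 = 0"
proof -
  show s: "f x y = f y x" and l: "linear (f x)" and "0 \<le> f x x" for x y
    using assms unfolding psd_form_def by blast+
  show "f x (y + z) = f x y + f x z" "f x (c *\<^sub>R y) = c * f x y" "f x 0 = 0" for x y z
    using l by (simp_all add: linear_add linear_cmul linear_0)
  then show "f (y + z) x = f y x + f z x" "f (c *\<^sub>R y) x = c * f y x"
    using s by metis+
qed

lemma psd_form_cauchy_schwarz:
  assumes f: "psd_form f"
  shows "(f x y)\<^sup>2 \<le> f x x * f y y"
proof -
  note D = psd_formD[OF f]
  have q: "0 \<le> f x x + 2 * t * f x y + t\<^sup>2 * f y y" for t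
  proof -
    have "0 \<le> f (x + t *\<^sub>R y) (x + t *\<^sub>R y)" by (rule D)
    also have "\<dots> = f x x + t * f y x + (t * (f x y + t * f y y))"
      by (simp add: D(4,5,6,7) algebra_simps)
    also have "f y x = f x y" by (rule D)
    finally show ?thesis by (simp add: power2_eq_square algebra_simps)
  qed
  show ?thesis
  proof (cases "f y y = 0")
    case True
    have "f x y = 0"
    proof (rule ccontr)
      assume n: "f x y \<noteq> 0"
      \<comment> \<open>With \<open>f y y = 0\<close> the quadratic is affine in \<open>t\<close>;
        at this value of \<open>t\<close> it equals \<open>-1\<close>.\<close>
      then show False using q[of "- (f x x + 1) / (2 * f x y)"] True D(3)[of x] by (simp add: field_simps)
    qed
    then show ?thesis using True by simp
  next
    case False
    then have p: "f y y > 0" using D(3)[of y] by simp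
    have "0 \<le> f x x + 2 * (- f x y / f y y) * f x y + (- f x y / f y y)\<^sup>2 * f y y" by (rule q)
    also have "\<dots> = f x x - (f x y)\<^sup>2 / f y y"
      using p by (simp add: power2_eq_square field_simps)
    finally show ?thesis using p by (simp add: field_simps)
  qed
qed

lemma psd_form_operator:
  assumes "psd_operator A"
  shows "psd_form (\<lambda>x y. A x \<bullet> y)"
  unfolding psd_form_def using psd_operatorD[OF assms]
  by (auto simp: inner_commute bounded_linear.linear bounded_linear_inner_right)

text \<open>Cauchy-Schwarz for the form of \<open>A\<close> at \<open>x\<close> and
  \<open>A x\<close>, after which one factor \<open>(norm (A x))\<^sup>2\<close> cancels. The
  quadratic form thus controls the operator, which is how positivity enters the uniqueness of square
  roots.\<close>

lemma psd_operator_norm_le: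
  assumes A: "psd_operator A"
  shows "(norm (A x))\<^sup>2 \<le> onorm A * (A x \<bullet> x)"
proof (cases "A x = 0")
  case False
  note bl = psd_operatorD(1)[OF A]
  have "((norm (A x))\<^sup>2)\<^sup>2 = (A x \<bullet> A x)\<^sup>2" by (simp add: power2_norm_eq_inner)
  also have "\<dots> \<le> (A x \<bullet> x) * (A (A x) \<bullet> A x)"
    using psd_form_cauchy_schwarz[OF psd_form_operator[OF A], of x "A x"] .
  also have "\<dots> \<le> (A x \<bullet> x) * (onorm A * (norm (A x))\<^sup>2)"
  proof (rule mult_left_mono)
    have "A (A x) \<bullet> A x \<le> norm (A (A x)) * norm (A x)" by (rule norm_cauchy_schwarz)
    also have "\<dots> \<le> (onorm A * norm (A x)) * norm (A x)"
      by (intro mult_right_mono onorm[OF bl]) simp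
    finally show "A (A x) \<bullet> A x \<le> onorm A * (norm (A x))\<^sup>2" by (simp add: power2_eq_square)
  qed (rule psd_operatorD(3)[OF A])
  finally have "(norm (A x))\<^sup>2 * (norm (A x))\<^sup>2 \<le> (onorm A * (A x \<bullet> x)) * (norm (A x))\<^sup>2"
    by (simp add: power2_eq_square algebra_simps)
  then show ?thesis by (rule mult_right_le_imp_le) (simp add: False)
next
  case True
  then show ?thesis using psd_operatorD(3)[OF A, of x] onorm_pos_le[OF psd_operatorD(1)[OF A]] by simp
qed

text \<open>
  Uniqueness of the positive square root: with \<open>D = A - B\<close> and \<open>S = A + B\<close> the hypothesis says
  \<open>S D = - D S\<close>, so \<open>\<langle>S D x, D x\<rangle> = - \<langle>S x, D\<^sup>2 x\<rangle>\<close>; along vectors almost attaining the norm of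
  \<open>D\<close> the right-hand side is close to \<open>- \<parallel>D\<parallel>\<^sup>2 \<langle>S x, x\<rangle>\<close>.
\<close>

lemma psd_operator_eqI:
  fixes A B :: "'h::real_inner \<Rightarrow> 'h"
  assumes A: "psd_operator A" and B: "psd_operator B" and eq: "\<And>x y. A x \<bullet> A y = B x \<bullet> B y"
  shows "A = B"
proof -
  note a = psd_operatorD[OF A] and b = psd_operatorD[OF B]
  define D where "D x = A x - B x" for x
  define S where "S x = A x + B x" for x
  have blD: "bounded_linear D" unfolding D_def[abs_def] by (intro bounded_linear_sub a b)
  have blS: "bounded_linear S" unfolding S_def[abs_def] by (intro bounded_linear_add a b)
  define L where "L = onorm D"
  define K where "K = onorm S"
  define C where "C = onorm A + onorm B"
  have L0: "0 \<le> L" and K0: "0 \<le> K" and C0: "0 \<le> C"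
    using onorm_pos_le blD blS a(1) b(1) by (auto simp: L_def K_def C_def intro!: add_nonneg_nonneg)
  have nD: "norm (D x) \<le> L * norm x" for x unfolding L_def by (rule onorm[OF blD])
  have nS: "norm (S x) \<le> K * norm x" for x unfolding K_def by (rule onorm[OF blS])
  have anti: "D x \<bullet> S y = - (S x \<bullet> D y)" for x y
    using eq[of x y] by (simp add: D_def S_def inner_diff_left inner_diff_right inner_add_left inner_add_right)
  have Dself: "D x \<bullet> y = x \<bullet> D y" for x y
    using a(2)[of x y] b(2)[of x y] by (simp add: D_def inner_diff_left inner_diff_right)
  have Spos: "0 \<le> S x \<bullet> x" for x
    using a(3)[of x] b(3)[of x] by (simp add: S_def inner_add_left)
  \<comment> \<open>Here the positivity of \<open>A\<close> and of \<open>B\<close> separately is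
    used: each of the two vectors is bounded by its own quadratic form, and these forms add up to
    that of \<open>S\<close>.\<close>
  have D_S: "(norm (D x))\<^sup>2 \<le> 2 * C * (S x \<bullet> x)" for x
  proof -
    have "norm (D x) \<le> norm (A x) + norm (B x)" unfolding D_def by (rule norm_triangle_ineq4)
    then have "(norm (D x))\<^sup>2 \<le> (norm (A x) + norm (B x))\<^sup>2" by (rule power_mono) simp
    also have "\<dots> \<le> 2 * (norm (A x))\<^sup>2 + 2 * (norm (B x))\<^sup>2"
      using sum_squares_bound[of "norm (A x)" "norm (B x)"] by (simp add: power2_sum)
    also have "\<dots> \<le> 2 * (onorm A * (A x \<bullet> x)) + 2 * (onorm B * (B x \<bullet> x))"
      using psd_operator_norm_le[OF A, of x] psd_operator_norm_le[OF B, of x] by linarith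
    also have "\<dots> \<le> 2 * (C * (A x \<bullet> x)) + 2 * (C * (B x \<bullet> x))"
      using onorm_pos_le[OF a(1)] onorm_pos_le[OF b(1)] a(3)[of x] b(3)[of x]
      by (intro add_mono mult_left_mono mult_right_mono) (auto simp: C_def)
    finally show ?thesis by (simp add: S_def inner_add_left algebra_simps)
  qed
  have norm2_diff: "(norm (y - c *\<^sub>R x))\<^sup>2 = (norm y)\<^sup>2 - 2 * c * (y \<bullet> x) + c\<^sup>2 * (norm x)\<^sup>2" for x y :: 'h and c
    by (simp add: power2_norm_eq_inner inner_diff_left inner_diff_right inner_commute algebra_simps power2_eq_square[of c])
  have "L = 0"
  proof (rule ccontr)
    assume "L \<noteq> 0"
    with L0 have Lp: "L > 0" by simp
    \<comment> \<open>The parameter \<open>s\<close> measures how far \<open>x\<close> is from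
      attaining the norm of \<open>D\<close>. As \<open>s\<close> tends to 0 the inequality becomes
      \<open>L^4 \<le> 0\<close>.\<close>
    have bound: "L\<^sup>2 * (L\<^sup>2 - s\<^sup>2) \<le> 2 * C * K * L * s" if s: "0 < s" "s < L" for s
    proof -
      have s2: "s\<^sup>2 < L\<^sup>2" using s by (intro power_strict_mono) auto
      obtain x where x: "norm (D x) > sqrt (L\<^sup>2 - s\<^sup>2) * norm x"
      proof (rule ccontr)
        assume "\<not> thesis"
        then have "norm (D x) \<le> sqrt (L\<^sup>2 - s\<^sup>2) * norm x" for x
          using that linorder_not_le by blast
        then have "L \<le> sqrt (L\<^sup>2 - s\<^sup>2)" unfolding L_def
          using s2 by (intro onorm_bound) (auto simp: L_def)
        moreover have "sqrt (L\<^sup>2 - s\<^sup>2) < L"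
          using s Lp by (intro real_less_lsqrt) auto
        ultimately show False by simp
      qed
      \<comment> \<open>The error made in treating \<open>x\<close> as an eigenvector of the square
        of \<open>D\<close> for the value \<open>L\<^sup>2\<close>. Expanding its square shows that
        it is at most \<open>L * s * norm x\<close>.\<close>
      define w where "w = D (D x) - L\<^sup>2 *\<^sub>R x"
      have xne: "norm x > 0" using x linear_0[OF bounded_linear.linear[OF blD]] by (cases "x = 0") auto
      have dx: "(norm (D x))\<^sup>2 \<ge> (L\<^sup>2 - s\<^sup>2) * (norm x)\<^sup>2"
      proof -
        have "(sqrt (L\<^sup>2 - s\<^sup>2) * norm x)\<^sup>2 \<le> (norm (D x))\<^sup>2"
          using x s2 by (intro power_mono) auto
        then show ?thesis using s2 by (simp add: power_mult_distrib)
      qed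
      have "(norm w)\<^sup>2 = (norm (D (D x)))\<^sup>2 - 2 * L\<^sup>2 * (D (D x) \<bullet> x) + L^4 * (norm x)\<^sup>2"
        using norm2_diff[of "D (D x)" "L\<^sup>2" x] by (simp add: w_def flip: power_mult)
      also have "D (D x) \<bullet> x = (norm (D x))\<^sup>2"
        using Dself[of "D x" x] by (simp add: power2_norm_eq_inner)
      also have "(norm (D (D x)))\<^sup>2 \<le> L\<^sup>2 * (norm (D x))\<^sup>2"
        using power_mono[OF nD[of "D x"], of 2] by (simp add: power_mult_distrib)
      also have "L\<^sup>2 * (norm (D x))\<^sup>2 - 2 * L\<^sup>2 * (norm (D x))\<^sup>2 + L^4 * (norm x)\<^sup>2
          = L\<^sup>2 * (L\<^sup>2 * (norm x)\<^sup>2 - (norm (D x))\<^sup>2)"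
        by (simp add: algebra_simps power4_eq_xxxx power2_eq_square)
      also have "\<dots> \<le> L\<^sup>2 * (s\<^sup>2 * (norm x)\<^sup>2)"
        using dx by (intro mult_left_mono) (auto simp: algebra_simps)
      finally have "(norm w)\<^sup>2 \<le> (L * s * norm x)\<^sup>2" by (simp add: power_mult_distrib mult_ac)
      then have w: "norm w \<le> L * s * norm x"
        by (rule power2_le_imp_le) (use Lp s in simp)
      have "L\<^sup>2 * (S x \<bullet> x) \<le> - (w \<bullet> S x)"
      proof -
        have "0 \<le> S (D x) \<bullet> D x" by (rule Spos)
        also have "\<dots> = - (D (D x) \<bullet> S x)" using anti[of "D x" x] by simp
        also have "\<dots> = - (w \<bullet> S x) - L\<^sup>2 * (S x \<bullet> x)"
          by (simp add: w_def inner_diff_left inner_commute[of x])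
        finally show ?thesis by simp
      qed
      also have "\<dots> \<le> norm w * norm (S x)"
        using norm_cauchy_schwarz[of "- w" "S x"] by simp
      also have "\<dots> \<le> (L * s * norm x) * (K * norm x)"
        by (intro mult_mono w nS) (use Lp s in auto)
      finally have Sx: "L\<^sup>2 * (S x \<bullet> x) \<le> K * L * s * (norm x)\<^sup>2" by (simp add: power2_eq_square algebra_simps)
      have "L\<^sup>2 * (L\<^sup>2 - s\<^sup>2) * (norm x)\<^sup>2 \<le> L\<^sup>2 * (2 * C * (S x \<bullet> x))"
        using order_trans[OF dx D_S] by (simp add: mult.assoc mult_left_mono)
      also have "\<dots> = 2 * C * (L\<^sup>2 * (S x \<bullet> x))" by simp
      also have "\<dots> \<le> 2 * C * (K * L * s * (norm x)\<^sup>2)"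
        using Sx C0 by (intro mult_left_mono) auto
      finally have "(L\<^sup>2 * (L\<^sup>2 - s\<^sup>2)) * (norm x)\<^sup>2 \<le> (2 * C * K * L * s) * (norm x)\<^sup>2"
        by (simp add: mult_ac)
      then show ?thesis using xne by simp
    qed
    have "L\<^sup>2 * (L\<^sup>2 - 0\<^sup>2) \<le> 2 * C * K * L * 0"
    proof (rule tendsto_le[OF trivial_limit_at_right_real])
      show "((\<lambda>s. L\<^sup>2 * (L\<^sup>2 - s\<^sup>2)) \<longlongrightarrow> L\<^sup>2 * (L\<^sup>2 - 0\<^sup>2)) (at_right (0::real))"
        "((\<lambda>s. 2 * C * K * L * s) \<longlongrightarrow> 2 * C * K * L * 0) (at_right (0::real))"
        by (intro tendsto_intros)+
      show "eventually (\<lambda>s. L\<^sup>2 * (L\<^sup>2 - s\<^sup>2) \<le> 2 * C * K * L * s) (at_right (0::real))"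
        using eventually_at_right_less[of "0::real"] eventually_at_right_real[OF Lp]
        by eventually_elim (use bound in auto)
    qed
    then show False using Lp by (simp add: mult_le_0_iff)
  qed
  then have "D x = 0" for x using nD[of x] by simp
  then show ?thesis by (auto simp: D_def fun_eq_iff)
qed

text \<open>Distinct basis vectors are at distance \<open>sqrt 2\<close>, so points of a countable
  dense set chosen within 1/2 of them are distinct as well.\<close>

lemma orthonormal_basis_countable:
  fixes E :: "'h::{real_inner, second_countable_topology} set"
  assumes E: "orthonormal_basis E"
  shows "countable E"
proof -
  obtain D :: "'h set" where D: "countable D" "\<And>X. open X \<Longrightarrow> X \<noteq> {} \<Longrightarrow> \<exists>d\<in>D. d \<in> X"
    using countable_dense_exists by metis
  have "\<exists>d\<in>D. d \<in> ball e (1/2)" for e :: 'h using D(2)[of "ball e (1/2)"] by auto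
  then obtain f where f: "\<And>e :: 'h. f e \<in> D" "\<And>e. f e \<in> ball e (1/2)" by metis
  have "inj_on f E"
  proof (rule inj_onI, rule ccontr)
    fix x y assume xy: "x \<in> E" "y \<in> E" "f x = f y" "x \<noteq> y"
    then have o: "x \<bullet> y = 0" "norm x = 1" "norm y = 1"
      using E by (auto simp: orthonormal_basis_def pairwise_def orthogonal_def)
    have "dist x y < 1/2 + 1/2"
      using f(2)[of x] f(2)[of y] xy(3) dist_triangle_half_r[of "f x" x 1 y] by (auto simp: dist_commute)
    then have "(norm (x - y))\<^sup>2 < 1\<^sup>2"
      by (intro power_strict_mono) (auto simp: dist_norm)
    moreover have "(norm (x - y))\<^sup>2 = (norm x)\<^sup>2 + (norm y)\<^sup>2"
      using o(1) by (simp add: power2_norm_eq_inner inner_diff_left inner_diff_right inner_commute)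
    ultimately show False using o by simp
  qed
  moreover have "countable (f ` E)"
    using f(1) by (intro countable_subset[OF _ D(1)]) auto
  ultimately show ?thesis using countable_image_inj_on by blast
qed

text \<open>An orthonormal basis as a sequence; it is padded with zeros, which the finite sums ignore.\<close>

lemma trace_class_psd_sequence:
  fixes Q :: "'h::{real_inner, second_countable_topology} \<Rightarrow> 'h"
  assumes Q: "psd_operator Q" and tc: "trace_class Q"
  obtains e :: "nat \<Rightarrow> 'h" where "\<And>i j. i \<noteq> j \<Longrightarrow> e i \<bullet> e j = 0" "\<And>i. e i = 0 \<or> e i \<bullet> e i = 1"
    "closure (span (range e)) = UNIV" "summable (\<lambda>i. Q (e i) \<bullet> e i)"
proof -
  obtain A E where A: "psd_operator A" "\<And>x y. A x \<bullet> A y = Q x \<bullet> Q y"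
    and E: "orthonormal_basis E" "(\<lambda>e. A e \<bullet> e) summable_on E"
    using tc unfolding trace_class_def by blast
  \<comment> \<open>The witness \<open>A\<close> is the absolute value of \<open>Q\<close>, and
    \<open>Q\<close>, being positive, is its own absolute value. The series in the definition of
    trace class is therefore the trace of \<open>Q\<close>.\<close>
  have "A = Q" using A Q by (intro psd_operator_eqI)
  with E have sm: "(\<lambda>e. Q e \<bullet> e) summable_on E" by simp
  have cE: "countable E" by (rule orthonormal_basis_countable) fact
  define e where "e n = (if n \<in> to_nat_on E ` E then from_nat_into E n else 0)" for n
  have e1: "e n \<in> E" if "n \<in> to_nat_on E ` E" for n
    using that cE by (auto simp: e_def)
  have e0: "e n = 0" if "n \<notin> to_nat_on E ` E" for n
    using that by (simp add: e_def)
  have einj: "inj_on e (to_nat_on E ` E)"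
    using cE by (auto simp: inj_on_def e_def)
  have one: "x \<bullet> x = 1" if "x \<in> E" for x
    using E(1) that by (auto simp: orthonormal_basis_def norm_eq_1)
  have orth: "x \<bullet> y = 0" if "x \<in> E" "y \<in> E" "x \<noteq> y" for x y
    using E(1) that by (auto simp: orthonormal_basis_def pairwise_def orthogonal_def)
  show thesis
  proof
    show "e i \<bullet> e j = 0" if "i \<noteq> j" for i j
    proof (cases "i \<in> to_nat_on E ` E \<and> j \<in> to_nat_on E ` E")
      case True
      then show ?thesis using orth e1 einj that by (metis inj_onD)
    qed (use e0 in auto)
    show "e i = 0 \<or> e i \<bullet> e i = 1" for i using e0 e1 one by blast
    have "E \<subseteq> range e"
    proof
      fix x assume "x \<in> E"
      then have "e (to_nat_on E x) = x" using cE by (simp add: e_def)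
      then show "x \<in> range e" by (metis rangeI)
    qed
    then have "closure (span E) \<subseteq> closure (span (range e))"
      by (intro closure_mono span_mono)
    then show "closure (span (range e)) = UNIV"
      using E(1) by (auto simp: orthonormal_basis_def)
    show "summable (\<lambda>i. Q (e i) \<bullet> e i)"
    proof (rule bounded_imp_summable)
      show "0 \<le> Q (e i) \<bullet> e i" for i by (rule psd_operatorD[OF Q])
      show "(\<Sum>k\<le>n. Q (e k) \<bullet> e k) \<le> infsum (\<lambda>e. Q e \<bullet> e) E" for n
      proof -
        let ?F = "{..n} \<inter> to_nat_on E ` E"
        have "(\<Sum>k\<le>n. Q (e k) \<bullet> e k) = (\<Sum>k\<in>?F. Q (e k) \<bullet> e k)"
          using e0 by (intro sum.mono_neutral_right) auto
        also have "\<dots> = (\<Sum>x\<in>e ` ?F. Q x \<bullet> x)"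
          using einj by (subst sum.reindex) (auto intro: inj_on_subset)
        also have "\<dots> \<le> infsum (\<lambda>e. Q e \<bullet> e) E"
          using e1 by (intro finite_sum_le_infsum[OF sm]) (auto intro: psd_operatorD[OF Q])
        finally show ?thesis .
      qed
    qed
  qed
qed

text \<open>The partial sum is the orthogonal projection of \<open>u\<close>. Once \<open>n\<close>
  exceeds all indices occurring in some \<open>v\<close> of the span close to \<open>u\<close>,
  Pythagoras shows that it is at least as close to \<open>u\<close> as \<open>v\<close> is.\<close>

lemma orthogonal_expansion_tendsto:
  fixes e :: "nat \<Rightarrow> 'h::real_inner"
  assumes orth: "\<And>i j. i \<noteq> j \<Longrightarrow> e i \<bullet> e j = 0" and one: "\<And>i. e i = 0 \<or> e i \<bullet> e i = 1"
    and dense: "closure (span (range e)) = UNIV"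
  shows "(\<lambda>n. \<Sum>j<n. (u \<bullet> e j) *\<^sub>R e j) \<longlonglongrightarrow> u"
proof (rule metric_LIMSEQ_I)
  fix r :: real assume r: "0 < r"
  let ?u = "\<lambda>n. \<Sum>j<n. (u \<bullet> e j) *\<^sub>R e j"
  have "u \<in> closure (span (range e))" using dense by simp
  then obtain v where v: "v \<in> span (range e)" "dist v u < r"
    using r by (auto simp: closure_approachable)
  obtain t c where t: "finite t" "t \<subseteq> range e" "v = (\<Sum>a\<in>t. c a *\<^sub>R a)"
    using v(1) unfolding span_explicit by blast
  obtain T where T: "finite T" "t = e ` T" using t(1,2) by (meson finite_subset_image)
  obtain N where N: "T \<subseteq> {..<N}" using T(1) finite_nat_iff_bounded by blast
  have "dist (?u n) u < r" if n: "n \<ge> N" for n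
  proof -
    have rem: "(u - ?u n) \<bullet> e j = 0" if "j < n" for j
    proof -
      have "?u n \<bullet> e j = (\<Sum>i<n. (u \<bullet> e i) * (e i \<bullet> e j))" by (simp add: inner_sum_left)
      also have "\<dots> = (\<Sum>i\<in>{j}. (u \<bullet> e i) * (e i \<bullet> e j))"
        using orth that by (intro sum.mono_neutral_right) auto
      also have "\<dots> = u \<bullet> e j" using one[of j] by auto
      finally show ?thesis by (simp add: inner_diff_left)
    qed
    have "(u - ?u n) \<bullet> (?u n - v) = 0"
    proof -
      have "(u - ?u n) \<bullet> ?u n = 0" using rem by (simp add: inner_sum_right)
      moreover have "(u - ?u n) \<bullet> v = 0"
        unfolding t(3) inner_sum_right using rem N n T(2) by (intro sum.neutral) auto
      ultimately show ?thesis by (simp add: inner_diff_right)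
    qed
    then have "(norm (u - v))\<^sup>2 = (norm (u - ?u n))\<^sup>2 + (norm (?u n - v))\<^sup>2"
      using norm_add_Pythagorean[of "u - ?u n" "?u n - v"] by (simp add: orthogonal_def)
    then have "(norm (u - ?u n))\<^sup>2 \<le> (norm (u - v))\<^sup>2" by simp
    then have "norm (u - ?u n) \<le> norm (u - v)" by (rule power2_le_imp_le) simp
    then show ?thesis using v(2) by (simp add: dist_norm norm_minus_commute)
  qed
  then show "\<exists>N. \<forall>n\<ge>N. dist (?u n) u < r" by blast
qed

text \<open>Symmetric Gaussian elimination: the form left after the directions \<open>e 0\<close>,
  ..., \<open>e (k - 1)\<close> have been removed, that is, a Schur complement. At a zero pivot the
  quotient is 0 and nothing is subtracted.\<close>

primrec cholesky_rest :: "(nat \<Rightarrow> 'h) \<Rightarrow> ('h \<Rightarrow> 'h \<Rightarrow> real) \<Rightarrow> nat \<Rightarrow> 'h \<Rightarrow> 'h \<Rightarrow> real" where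
  "cholesky_rest e f 0 = f"
| "cholesky_rest e f (Suc k) = (\<lambda>x y. cholesky_rest e f k x y -
     cholesky_rest e f k (e k) x * cholesky_rest e f k (e k) y / cholesky_rest e f k (e k) (e k))"

definition cholesky :: "(nat \<Rightarrow> 'h) \<Rightarrow> ('h \<Rightarrow> 'h \<Rightarrow> real) \<Rightarrow> nat \<Rightarrow> 'h \<Rightarrow> real" where
  "cholesky e f k x = cholesky_rest e f k (e k) x / sqrt (cholesky_rest e f k (e k) (e k))"

lemma psd_form_cholesky_rest:
  assumes "psd_form f"
  shows "psd_form (cholesky_rest e f k)"
proof (induction k)
  case (Suc k)
  let ?g = "cholesky_rest e f k"
  note D = psd_formD[OF Suc]
  have "0 \<le> ?g x x - ?g (e k) x * ?g (e k) x / ?g (e k) (e k)" for x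
  proof (cases "?g (e k) (e k) = 0")
    case False
    then have "?g (e k) (e k) > 0" using D(3)[of "e k"] by simp
    then show ?thesis using psd_form_cauchy_schwarz[OF Suc, of "e k" x]
      by (simp add: field_simps power2_eq_square)
  qed (simp add: D)
  moreover have "linear (\<lambda>y. ?g x y - ?g (e k) x * ?g (e k) y / ?g (e k) (e k))" for x
    by (rule linearI) (simp_all add: D(4,5) algebra_simps add_divide_distrib)
  ultimately show ?case
    unfolding psd_form_def cholesky_rest.simps using D(1) by (simp add: mult.commute)
qed (use assms in simp)

text \<open>Each step annihilates its own vector and keeps the earlier ones annihilated. If the
  pivot vanishes, Cauchy-Schwarz makes its whole row vanish, so the division by zero does no
  harm.\<close>

lemma cholesky_rest_eq_0:
  assumes f: "psd_form f" and "j < k"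
  shows "cholesky_rest e f k (e j) x = 0"
  using \<open>j < k\<close>
proof (induction k arbitrary: x)
  case (Suc k)
  let ?g = "cholesky_rest e f k"
  note g = psd_form_cholesky_rest[OF f, of e k]
  note D = psd_formD[OF g]
  show ?case
  proof (cases "j = k")
    case True
    have "?g (e k) x = 0" if "?g (e k) (e k) = 0"
      using psd_form_cauchy_schwarz[OF g, of "e k" x] that by simp
    then show ?thesis using True by auto
  next
    case False
    then have "?g (e j) y = 0" for y using Suc by simp
    then show ?thesis using D(1)[of "e k" "e j"] by simp
  qed
qed simp

lemma cholesky_linear:
  assumes "psd_form f"
  shows "cholesky e f k (\<Sum>i\<in>I. c i *\<^sub>R x i) = (\<Sum>i\<in>I. c i * cholesky e f k (x i))"
proof -
  note l = psd_formD(2)[OF psd_form_cholesky_rest[OF assms], of e k "e k"]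
  show ?thesis
    by (simp add: cholesky_def linear_sum[OF l] linear_cmul[OF l] sum_divide_distrib)
qed

lemma cholesky_upper:
  assumes "psd_form f" "j < k"
  shows "cholesky e f k (e j) = 0"
  using cholesky_rest_eq_0[OF assms, of e "e k"] psd_formD(1)[OF psd_form_cholesky_rest[OF assms(1)], of e k "e k" "e j"]
  by (simp add: cholesky_def)

lemma cholesky_decomposition:
  assumes f: "psd_form f"
  shows "f x y = (\<Sum>k<n. cholesky e f k x * cholesky e f k y) + cholesky_rest e f n x y"
proof (induction n)
  case (Suc n)
  have "cholesky e f n x * cholesky e f n y =
    cholesky_rest e f n (e n) x * cholesky_rest e f n (e n) y / cholesky_rest e f n (e n) (e n)"
    using psd_formD(3)[OF psd_form_cholesky_rest[OF f], of e n "e n"]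
    by (simp add: cholesky_def)
  then show ?case using Suc by simp
qed simp

text \<open>A combination of the first \<open>n\<close> vectors is annihilated by the remainder
  after \<open>n\<close> steps, so the finite decomposition is exact for it.\<close>

lemma cholesky_square:
  assumes f: "psd_form f" and x: "x = (\<Sum>j<n. c j *\<^sub>R e j)"
  shows "f x x = (\<Sum>k<n. (cholesky e f k x)\<^sup>2)"
proof -
  note g = psd_form_cholesky_rest[OF f, of e n]
  have "cholesky_rest e f n y x = 0" for y
    unfolding x using cholesky_rest_eq_0[OF f] psd_formD(1)[OF g, of y]
    by (subst linear_sum[OF psd_formD(2)[OF g]]) (auto simp: psd_formD(5)[OF g] intro!: sum.neutral)
  then show ?thesis using cholesky_decomposition[OF f, of x x e n] by (simp add: power2_eq_square)
qed

section \<open>Gaussian measures\<close>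

lemma ennreal_power2_le_imp_le:
  fixes x :: ennreal
  assumes "x\<^sup>2 \<le> (ennreal c)\<^sup>2" "0 \<le> c"
  shows "x \<le> ennreal c"
proof (cases x)
  case (real r)
  then have "r\<^sup>2 \<le> c\<^sup>2" using assms by (simp add: ennreal_power)
  then have "r \<le> c" using assms(2) by (rule power2_le_imp_le)
  then show ?thesis unfolding real by (rule ennreal_leI)
next
  case top
  then show ?thesis using assms by (simp add: ennreal_power top_unique)
qed

section \<open>One-dimensional normal laws: affine images, characteristic functions, moments\<close>

lemma normal_law_eq_distr:
  assumes "0 \<le> v"
  shows "normal_law m v = distr std_normal_distribution borel (\<lambda>x. m + sqrt v * x)"
proof -
  interpret real_distribution std_normal_distribution by (rule real_dist_normal_dist)
  show ?thesis
  proof (cases "v = 0")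
    case True
    then show ?thesis by (simp add: normal_law_def distr_const)
  next
    case False
    with assms have v: "0 < sqrt v" by simp
    have "distributed std_normal_distribution lborel (\<lambda>x. x) std_normal_density"
      by (simp add: distributed_def distr_id2)
    from normal_density_affine[OF this, of "sqrt v" m] v
    have "distributed std_normal_distribution lborel (\<lambda>x. m + sqrt v * x) (normal_density m (sqrt v))"
      by simp
    then have "distr std_normal_distribution lborel (\<lambda>x. m + sqrt v * x) = density lborel (normal_density m (sqrt v))"
      by (rule distributed_distr_eq_density)
    moreover have "distr std_normal_distribution lborel (\<lambda>x. m + sqrt v * x) = distr std_normal_distribution borel (\<lambda>x. m + sqrt v * x)"
      by (rule distr_cong) auto
    ultimately show ?thesis using False by (simp add: normal_law_def)
  qed
qed

lemma sets_normal_law [simp, measurable_cong]: "sets (normal_law m v) = sets borel"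
  by (simp add: normal_law_def)

lemma prob_space_normal_law: "0 \<le> v \<Longrightarrow> prob_space (normal_law m v)"
proof -
  assume v: "0 \<le> v"
  interpret real_distribution std_normal_distribution by (rule real_dist_normal_dist)
  show ?thesis unfolding normal_law_eq_distr[OF v] by (rule prob_space_distr) simp
qed

lemma char_std_normal: "(CLINT x|std_normal_distribution. iexp (t * x)) = complex_of_real (exp (- t\<^sup>2 / 2))"
  using fun_cong[OF char_std_normal_distribution, of t] unfolding char_def .

lemma char_normal_law:
  assumes "0 \<le> v"
  shows "(CLINT x|normal_law m v. iexp (t * x)) = exp (\<i> * complex_of_real (t * m) - complex_of_real (v * t\<^sup>2 / 2))"
proof -
  have "(CLINT x|normal_law m v. iexp (t * x)) = (CLINT x|std_normal_distribution. iexp (t * (m + sqrt v * x)))"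
    unfolding normal_law_eq_distr[OF assms] by (subst integral_distr) auto
  also have "\<dots> = (CLINT x|std_normal_distribution. iexp (t * m) * iexp ((t * sqrt v) * x))"
    by (intro Bochner_Integration.integral_cong refl) (simp add: exp_add[symmetric] algebra_simps)
  also have "\<dots> = iexp (t * m) * (CLINT x|std_normal_distribution. iexp ((t * sqrt v) * x))"
    by (rule integral_mult_right_zero)
  also have "\<dots> = iexp (t * m) * exp (complex_of_real (- (t * sqrt v)\<^sup>2 / 2))"
    unfolding char_std_normal by (simp only: exp_of_real)
  also have "\<dots> = exp (\<i> * complex_of_real (t * m) - complex_of_real (v * t\<^sup>2 / 2))"
    using assms unfolding exp_add[symmetric]
    by (intro arg_cong[where f=exp]) (simp add: power_mult_distrib mult.commute flip: of_real_power)
  finally show ?thesis .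
qed

lemma normal_law_eqI:
  fixes K :: "real measure"
  assumes "finite_measure K" "sets K = sets borel" "0 \<le> v"
    and "\<And>t. (CLINT x|K. iexp (t * x)) = exp (\<i> * complex_of_real (t * m) - complex_of_real (v * t\<^sup>2 / 2))"
  shows "K = normal_law m v"
proof (rule finite_measure_char_eqI)
  show "finite_measure (normal_law m v)"
    using prob_space_normal_law[OF assms(3)] by (rule prob_space.finite_measure)
qed (simp_all only: assms char_normal_law[OF assms(3)] sets_normal_law)

lemma normal_law_moments:
  assumes "0 \<le> v"
  shows "integrable (normal_law 0 v) (\<lambda>x. x ^ n)"
    "(LINT x|normal_law 0 v. x) = 0" "(LINT x|normal_law 0 v. x\<^sup>2) = v" "(LINT x|normal_law 0 v. x ^ 4) = 3 * v\<^sup>2"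
proof -
  have i: "integrable std_normal_distribution (\<lambda>x. x ^ n)" for n
    by (rule integrable_std_normal_distribution_moment)
  then show "integrable (normal_law 0 v) (\<lambda>x. x ^ n)"
    unfolding normal_law_eq_distr[OF assms]
    by (subst integrable_distr_eq) (auto simp: power_mult_distrib)
  show "(LINT x|normal_law 0 v. x) = 0"
    unfolding normal_law_eq_distr[OF assms]
    using integral_std_normal_distribution_moment_odd[of 1] by (subst integral_distr) auto
  show "(LINT x|normal_law 0 v. x\<^sup>2) = v"
    unfolding normal_law_eq_distr[OF assms]
    using std_normal_distribution_even_moments(1)[of 1] assms by (subst integral_distr) (auto simp: power_mult_distrib)
  have "sqrt v ^ 4 = (sqrt v ^ 2) ^ 2" by (simp flip: power_mult)
  then have s4: "sqrt v ^ 4 = v\<^sup>2" using assms by simp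
  show "(LINT x|normal_law 0 v. x ^ 4) = 3 * v\<^sup>2"
    unfolding normal_law_eq_distr[OF assms]
    using std_normal_distribution_even_moments(1)[of 2] assms
    by (subst integral_distr) (auto simp: power_mult_distrib fact_numeral s4)
qed

lemma nn_integral_normal_law:
  assumes "0 \<le> v"
  shows "(\<integral>\<^sup>+x. ennreal (x\<^sup>2) \<partial>normal_law 0 v) = ennreal v"
    "(\<integral>\<^sup>+x. ennreal (x ^ 4) \<partial>normal_law 0 v) = ennreal (3 * v\<^sup>2)"
proof -
  have "(\<integral>\<^sup>+x. ennreal (x\<^sup>2) \<partial>normal_law 0 v) = ennreal (LINT x|normal_law 0 v. x\<^sup>2)"
    by (rule nn_integral_eq_integral[OF normal_law_moments(1)[OF assms]]) simp
  then show "(\<integral>\<^sup>+x. ennreal (x\<^sup>2) \<partial>normal_law 0 v) = ennreal v"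
    by (simp only: normal_law_moments(3)[OF assms])
  have "(\<integral>\<^sup>+x. ennreal (x ^ 4) \<partial>normal_law 0 v) = ennreal (LINT x|normal_law 0 v. x ^ 4)"
    by (rule nn_integral_eq_integral[OF normal_law_moments(1)[OF assms]]) simp
  then show "(\<integral>\<^sup>+x. ennreal (x ^ 4) \<partial>normal_law 0 v) = ennreal (3 * v\<^sup>2)"
    by (simp only: normal_law_moments(4)[OF assms])
qed

text \<open>
  The Cholesky factor of the Gram matrix of \<open>Q\<close> along the basis produces the Gaussian coordinates
  as finite combinations of independent standard normals; finiteness of the trace makes the
  coordinates almost surely square summable.
\<close>

theorem gaussian_exists:
  fixes Q :: "'h::{real_inner, banach, second_countable_topology} \<Rightarrow> 'h"
  assumes Q: "psd_operator Q" and tc: "trace_class Q"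
  obtains \<gamma> :: "'h measure" where "prob_space \<gamma>" "sets \<gamma> = sets borel"
    "\<And>u. (CLINT x|\<gamma>. iexp (u \<bullet> x)) = exp (- complex_of_real (Q u \<bullet> u / 2))"
    "(\<integral>\<^sup>+x. ennreal (norm x ^ 4) \<partial>\<gamma>) < \<infinity>"
proof -
  obtain e :: "nat \<Rightarrow> 'h" where orth: "\<And>i j. i \<noteq> j \<Longrightarrow> e i \<bullet> e j = 0" and one: "\<And>i. e i = 0 \<or> e i \<bullet> e i = 1"
    and dense: "closure (span (range e)) = UNIV" and sq: "summable (\<lambda>i. Q (e i) \<bullet> e i)"
    using trace_class_psd_sequence[OF Q tc] by blast
  define f where "f = (\<lambda>x y. Q x \<bullet> y)"
  have f: "psd_form f" unfolding f_def by (rule psd_form_operator[OF Q])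
  define q where "q j = Q (e j) \<bullet> e j" for j
  have q0: "0 \<le> q j" for j unfolding q_def by (rule psd_operatorD[OF Q])
  define T where "T = (\<Sum>j. q j)"
  have sumq: "(\<Sum>j<n. q j) \<le> T" for n
    unfolding T_def using sq q0 by (intro sum_le_suminf) (auto simp: q_def)
  have T0: "0 \<le> T" using sumq[of 0] by simp
  interpret SN: real_distribution std_normal_distribution by (rule real_dist_normal_dist)
  interpret P: product_prob_space "\<lambda>_::nat. std_normal_distribution" UNIV ..
  define M where "M = Pi\<^sub>M (UNIV :: nat set) (\<lambda>_. std_normal_distribution)"
  interpret M: prob_space M unfolding M_def by (rule P.prob_space_axioms)
  have coord [measurable]: "(\<lambda>\<omega>. \<omega> k) \<in> borel_measurable M" for k
  proof -
    have "(\<lambda>\<omega>. \<omega> k) \<in> measurable M std_normal_distribution" unfolding M_def by measurable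
    then show ?thesis by (simp cong: measurable_cong_sets)
  qed
  have dcoord: "distr M borel (\<lambda>\<omega>. \<omega> k) = std_normal_distribution" for k
  proof -
    have "distr M borel (\<lambda>\<omega>. \<omega> k) = distr M std_normal_distribution (\<lambda>\<omega>. \<omega> k)"
      by (rule distr_cong) auto
    then show ?thesis unfolding M_def using P.PiM_component[of k] by simp
  qed
  have indep: "M.indep_vars (\<lambda>_. borel) (\<lambda>k \<omega>. \<omega> k) {..<n}" for n
  proof (cases "n = 0")
    case True
    then show ?thesis by (simp add: M.indep_vars_def M.indep_sets_def)
  next
    case False
    have "distr M (Pi\<^sub>M {..<n} (\<lambda>_. borel)) (\<lambda>x. restrict x {..<n}) =
       distr M (Pi\<^sub>M {..<n} (\<lambda>_. std_normal_distribution)) (\<lambda>x. restrict x {..<n})"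
      by (intro distr_cong refl sets_PiM_cong) auto
    also have "\<dots> = Pi\<^sub>M {..<n} (\<lambda>_. std_normal_distribution)"
      unfolding M_def by (rule P.distr_PiM_restrict_finite) auto
    finally show ?thesis
      using False by (subst M.indep_vars_iff_distr_eq_PiM') (auto simp: dcoord restrict_def)
  qed
  \<comment> \<open>The coordinate \<open>X j\<close> is row \<open>j\<close> of the Cholesky factor
    applied to independent standard normals. The factor is triangular, so any sum over
    \<open>k < n\<close> with \<open>n > j\<close> gives the same value; \<open>X_n\<close> uses
    this to treat several coordinates at once.\<close>
  define X where "X j \<omega> = (\<Sum>k\<le>j. cholesky e f k (e j) * \<omega> k)" for j \<omega>
  have [measurable]: "X j \<in> borel_measurable M" for j unfolding X_def[abs_def] by measurable
  have X_n: "X j \<omega> = (\<Sum>k<n. cholesky e f k (e j) * \<omega> k)" if "j < n" for j n \<omega>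
    unfolding X_def using that cholesky_upper[OF f] by (intro sum.mono_neutral_left) auto
  \<comment> \<open>By independence the exponent is the sum of the squared Cholesky coefficients of
    \<open>x\<close>. As \<open>x\<close> is a combination of the first \<open>n\<close> basis
    vectors, this sum is exactly \<open>f x x\<close>.\<close>
  have char_lin: "(CLINT \<omega>|M. iexp (\<Sum>j<n. c j * X j \<omega>)) = exp (- complex_of_real (f x x / 2))"
    if x: "x = (\<Sum>j<n. c j *\<^sub>R e j)" for x c n
  proof -
    have "(\<Sum>j<n. c j * X j \<omega>) = (\<Sum>k<n. cholesky e f k x \<bullet> \<omega> k)" for \<omega>
    proof -
      have "(\<Sum>j<n. c j * X j \<omega>) = (\<Sum>j<n. \<Sum>k<n. c j * cholesky e f k (e j) * \<omega> k)"
        by (intro sum.cong) (auto simp: X_n sum_distrib_left mult_ac)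
      also have "\<dots> = (\<Sum>k<n. \<Sum>j<n. c j * cholesky e f k (e j) * \<omega> k)" by (rule sum.swap)
      also have "\<dots> = (\<Sum>k<n. cholesky e f k x \<bullet> \<omega> k)"
        unfolding x cholesky_linear[OF f] by (simp add: sum_distrib_right)
      finally show ?thesis .
    qed
    then have "(CLINT \<omega>|M. iexp (\<Sum>j<n. c j * X j \<omega>)) =
        (\<Prod>k<n. CLINT \<omega>|M. iexp (cholesky e f k x \<bullet> \<omega> k))"
      using M.char_indep_sum[OF _ indep, of n "\<lambda>k. cholesky e f k x"] by simp
    also have "\<dots> = (\<Prod>k<n. exp (complex_of_real (- (cholesky e f k x)\<^sup>2 / 2)))"
    proof (intro prod.cong refl)
      fix k
      have "(CLINT \<omega>|M. iexp (cholesky e f k x \<bullet> \<omega> k)) =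
          (CLINT y|distr M borel (\<lambda>\<omega>. \<omega> k). iexp (cholesky e f k x * y))"
        by (subst integral_distr) auto
      then show "(CLINT \<omega>|M. iexp (cholesky e f k x \<bullet> \<omega> k)) = exp (complex_of_real (- (cholesky e f k x)\<^sup>2 / 2))"
        unfolding dcoord char_std_normal by (simp only: exp_of_real)
    qed
    also have "\<dots> = exp (\<Sum>k<n. complex_of_real (- (cholesky e f k x)\<^sup>2 / 2))" by (simp only: exp_sum[OF finite_lessThan])
    also have "(\<Sum>k<n. complex_of_real (- (cholesky e f k x)\<^sup>2 / 2)) = - complex_of_real (f x x / 2)"
      unfolding cholesky_square[OF f x] by (simp add: sum_negf sum_divide_distrib)
    finally show ?thesis .
  qed
  have dX: "distr M borel (X j) = normal_law 0 (q j)" for j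
  proof (rule normal_law_eqI)
    show "finite_measure (distr M borel (X j))" by (rule M.finite_measure_distr) simp
    fix t :: real
    have x: "t *\<^sub>R e j = (\<Sum>i<Suc j. (if i = j then t else 0) *\<^sub>R e i)"
      by (simp add: sum.delta if_distrib[where f="\<lambda>c. c *\<^sub>R _"] cong: if_cong)
    have Xt: "(\<Sum>i<Suc j. (if i = j then t else 0) * X i \<omega>) = t * X j \<omega>" for \<omega>
      by (simp add: if_distrib[where f="\<lambda>c. c * _"] cong: if_cong)
    have ff: "f (t *\<^sub>R e j) (t *\<^sub>R e j) = q j * t\<^sup>2"
    proof -
      have "q j = f (e j) (e j)" by (simp add: q_def f_def)
      then show ?thesis by (simp add: psd_formD(5,7)[OF f] power2_eq_square)
    qed
    from char_lin[OF x] have "(CLINT \<omega>|M. iexp (t * X j \<omega>)) = exp (- complex_of_real (f (t *\<^sub>R e j) (t *\<^sub>R e j) / 2))"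
      unfolding Xt .
    then show "(CLINT x|distr M borel (X j). iexp (t * x)) = exp (\<i> * complex_of_real (t * 0) - complex_of_real (q j * t\<^sup>2 / 2))"
      unfolding ff by (subst integral_distr) auto
  qed (use q0 in auto)
  have X2: "(\<integral>\<^sup>+\<omega>. ennreal ((X j \<omega>)\<^sup>2) \<partial>M) = ennreal (q j)" for j
    using nn_integral_normal_law(1)[OF q0, of j] unfolding dX[symmetric] by (subst (asm) nn_integral_distr) auto
  have X4: "(\<integral>\<^sup>+\<omega>. ennreal (X j \<omega> ^ 4) \<partial>M) = ennreal (3 * (q j)\<^sup>2)" for j
    using nn_integral_normal_law(2)[OF q0, of j] unfolding dX[symmetric] by (subst (asm) nn_integral_distr) auto
  \<comment> \<open>Cauchy-Schwarz with the normal fourth moments \<open>3 * (q i)\<^sup>2\<close>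
    and \<open>3 * (q j)\<^sup>2\<close>. Summed over \<open>i\<close> and \<open>j\<close> this
    bounds the fourth moment of every partial sum by \<open>3 * T\<^sup>2\<close>, where
    \<open>T\<close> is the trace.\<close>
  have XX: "(\<integral>\<^sup>+\<omega>. ennreal ((X i \<omega>)\<^sup>2) * ennreal ((X j \<omega>)\<^sup>2) \<partial>M) \<le> ennreal (3 * q i * q j)" for i j
  proof -
    let ?I = "\<integral>\<^sup>+\<omega>. ennreal ((X i \<omega>)\<^sup>2) * ennreal ((X j \<omega>)\<^sup>2) \<partial>M"
    have p: "ennreal ((X j \<omega>)\<^sup>2) ^ 2 = ennreal (X j \<omega> ^ 4)" for j \<omega>
      by (simp add: ennreal_power flip: power_mult)
    have "?I\<^sup>2 \<le> (\<integral>\<^sup>+\<omega>. ennreal ((X i \<omega>)\<^sup>2) ^ 2 \<partial>M) * (\<integral>\<^sup>+\<omega>. ennreal ((X j \<omega>)\<^sup>2) ^ 2 \<partial>M)"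
      by (rule Cauchy_Schwarz_nn_integral) auto
    also have "\<dots> = ennreal (3 * (q i)\<^sup>2) * ennreal (3 * (q j)\<^sup>2)" by (simp only: p X4)
    also have "\<dots> = (ennreal (3 * q i * q j))\<^sup>2"
      using q0 by (simp add: ennreal_power ennreal_mult[symmetric] power2_eq_square mult_ac)
    finally show ?thesis
      using q0 by (intro ennreal_power2_le_imp_le) auto
  qed
  define V where "V n \<omega> = (\<Sum>j<n. (X j \<omega>)\<^sup>2)" for n \<omega>
  have V4: "(\<integral>\<^sup>+\<omega>. ennreal ((V n \<omega>)\<^sup>2) \<partial>M) \<le> ennreal (3 * T\<^sup>2)" for n
  proof -
    have "(\<integral>\<^sup>+\<omega>. ennreal ((V n \<omega>)\<^sup>2) \<partial>M) = (\<integral>\<^sup>+\<omega>. (\<Sum>i<n. \<Sum>j<n. ennreal ((X i \<omega>)\<^sup>2) * ennreal ((X j \<omega>)\<^sup>2)) \<partial>M)"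
      by (intro nn_integral_cong) (simp add: V_def power2_eq_square[of "sum _ _"] sum_product ennreal_mult[symmetric] sum_nonneg)
    also have "\<dots> = (\<Sum>i<n. \<Sum>j<n. \<integral>\<^sup>+\<omega>. ennreal ((X i \<omega>)\<^sup>2) * ennreal ((X j \<omega>)\<^sup>2) \<partial>M)"
      by (simp add: nn_integral_sum)
    also have "\<dots> \<le> (\<Sum>i<n. \<Sum>j<n. ennreal (3 * q i * q j))"
      by (intro sum_mono XX)
    also have "\<dots> = ennreal (3 * (\<Sum>i<n. q i)\<^sup>2)"
      unfolding power2_eq_square sum_product using q0 by (simp add: sum_distrib_left mult.assoc sum_nonneg)
    also have "\<dots> \<le> ennreal (3 * T\<^sup>2)"
      using sumq[of n] q0 by (intro ennreal_leI mult_left_mono power_mono sum_nonneg) auto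
    finally show ?thesis .
  qed
  have sumX: "AE \<omega> in M. summable (\<lambda>j. (X j \<omega>)\<^sup>2)"
  proof -
    have "(\<integral>\<^sup>+\<omega>. (\<Sum>j. ennreal ((X j \<omega>)\<^sup>2)) \<partial>M) = (\<Sum>j. ennreal (q j))"
      by (subst nn_integral_suminf) (auto simp: X2)
    also have "\<dots> = ennreal T" unfolding T_def using q0 sq by (intro suminf_ennreal2) (auto simp: q_def)
    finally have "AE \<omega> in M. (\<Sum>j. ennreal ((X j \<omega>)\<^sup>2)) \<noteq> \<infinity>"
      by (intro nn_integral_PInf_AE) auto
    then show ?thesis
      by eventually_elim (auto intro: summable_suminf_not_top)
  qed
  define Z where "Z n \<omega> = (\<Sum>j<n. X j \<omega> *\<^sub>R e j)" for n \<omega>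
  have [measurable]: "Z n \<in> borel_measurable M" for n unfolding Z_def[abs_def] by measurable
  \<comment> \<open>Only an inequality, since a padding vector \<open>e j = 0\<close> loses its
    term.\<close>
  have normZ: "(norm (\<Sum>j\<in>I. X j \<omega> *\<^sub>R e j))\<^sup>2 \<le> (\<Sum>j\<in>I. (X j \<omega>)\<^sup>2)" if "finite I" for I \<omega>
  proof -
    have "(norm (\<Sum>j\<in>I. X j \<omega> *\<^sub>R e j))\<^sup>2 = (\<Sum>j\<in>I. \<Sum>i\<in>I. X j \<omega> * (X i \<omega> * (e i \<bullet> e j)))"
      by (simp add: power2_norm_eq_inner inner_sum_left inner_sum_right sum_distrib_left)
    also have "\<dots> = (\<Sum>j\<in>I. \<Sum>i\<in>{j}. X j \<omega> * (X i \<omega> * (e i \<bullet> e j)))"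
      using that orth by (intro sum.cong refl sum.mono_neutral_right) auto
    also have "\<dots> \<le> (\<Sum>j\<in>I. (X j \<omega>)\<^sup>2)"
    proof (rule sum_mono)
      fix j show "(\<Sum>i\<in>{j}. X j \<omega> * (X i \<omega> * (e i \<bullet> e j))) \<le> (X j \<omega>)\<^sup>2"
        using one[of j] by (auto simp: power2_eq_square)
    qed
    finally show ?thesis .
  qed
  have convZ: "AE \<omega> in M. convergent (\<lambda>n. Z n \<omega>)"
    using sumX
  proof eventually_elim
    case (elim \<omega>)
    have "Cauchy (\<lambda>n. Z n \<omega>)"
    proof (rule metric_CauchyI)
      fix r :: real assume r: "0 < r"
      obtain N where N: "\<And>m n. N \<le> m \<Longrightarrow> norm (\<Sum>j=m..<n. (X j \<omega>)\<^sup>2) < r\<^sup>2"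
        using elim r unfolding summable_Cauchy by (meson zero_less_power)
      have *: "dist (Z m \<omega>) (Z n \<omega>) < r" if "N \<le> m" "m \<le> n" for m n
      proof -
        have "Z n \<omega> - Z m \<omega> = (\<Sum>j=m..<n. X j \<omega> *\<^sub>R e j)"
          unfolding Z_def lessThan_atLeast0 by (rule sum_diff_nat_ivl) (use that in auto)
        then have "(norm (Z n \<omega> - Z m \<omega>))\<^sup>2 < r\<^sup>2"
          using normZ[of "{m..<n}" \<omega>] N[OF that(1), of n] by (simp add: sum_nonneg)
        then show ?thesis using r by (simp add: dist_norm norm_minus_commute power2_less_imp_less)
      qed
      then have "dist (Z m \<omega>) (Z n \<omega>) < r" if "N \<le> m" "N \<le> n" for m n
        using that by (metis dist_commute nle_le)
      then show "\<exists>M. \<forall>m\<ge>M. \<forall>n\<ge>M. dist (Z m \<omega>) (Z n \<omega>) < r" by blast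
    qed
    then show ?case by (rule Cauchy_convergent)
  qed
  define Y where "Y \<omega> = lim (\<lambda>n. Z n \<omega>)" for \<omega>
  have [measurable]: "Y \<in> borel_measurable M"
    unfolding Y_def[abs_def] by (rule borel_measurable_lim_metric) simp
  have ZY: "AE \<omega> in M. (\<lambda>n. Z n \<omega>) \<longlonglongrightarrow> Y \<omega>"
    using convZ by eventually_elim (simp add: Y_def convergent_LIMSEQ_iff)
  define \<gamma> where "\<gamma> = distr M borel Y"
  have h1: "prob_space \<gamma>" unfolding \<gamma>_def by (rule M.prob_space_distr) simp
  have h2: "sets \<gamma> = sets borel" by (simp add: \<gamma>_def)
  \<comment> \<open>The pairing of \<open>u\<close> with \<open>Z n\<close> sees only the projection
    of \<open>u\<close> onto the first \<open>n\<close> basis vectors, where \<open>char_lin\<close>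
    applies. Both sides then pass to the limit, the right one by continuity of
    \<open>Q\<close>.\<close>
  have h3: "(CLINT x|\<gamma>. iexp (u \<bullet> x)) = exp (- complex_of_real (Q u \<bullet> u / 2))" for u
    proof (rule LIMSEQ_unique)
      let ?u = "\<lambda>n. \<Sum>j<n. (u \<bullet> e j) *\<^sub>R e j"
      have "(\<lambda>n. CLINT \<omega>|M. iexp (u \<bullet> Z n \<omega>)) \<longlonglongrightarrow> (CLINT \<omega>|M. iexp (u \<bullet> Y \<omega>))"
      proof (rule integral_dominated_convergence[where w="\<lambda>_. 1"])
        show "AE \<omega> in M. (\<lambda>n. iexp (u \<bullet> Z n \<omega>)) \<longlonglongrightarrow> iexp (u \<bullet> Y \<omega>)"
          using ZY by eventually_elim (intro tendsto_intros)
      qed auto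
      moreover have "(CLINT \<omega>|M. iexp (u \<bullet> Z n \<omega>)) = exp (- complex_of_real (Q (?u n) \<bullet> ?u n / 2))" for n
      proof -
        have "u \<bullet> Z n \<omega> = (\<Sum>j<n. (u \<bullet> e j) * X j \<omega>)" for \<omega>
          by (simp add: Z_def inner_sum_right mult.commute)
        then show ?thesis
          using char_lin[of "?u n" "\<lambda>j. u \<bullet> e j" n, OF refl] by (simp only: f_def)
      qed
      moreover have "(CLINT x|\<gamma>. iexp (u \<bullet> x)) = (CLINT \<omega>|M. iexp (u \<bullet> Y \<omega>))"
        unfolding \<gamma>_def by (subst integral_distr) auto
      ultimately show "(\<lambda>n. exp (- complex_of_real (Q (?u n) \<bullet> ?u n / 2))) \<longlonglongrightarrow> (CLINT x|\<gamma>. iexp (u \<bullet> x))" by simp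
      have "?u \<longlonglongrightarrow> u" by (rule orthogonal_expansion_tendsto[OF orth one dense])
      then show "(\<lambda>n. exp (- complex_of_real (Q (?u n) \<bullet> ?u n / 2))) \<longlonglongrightarrow> exp (- complex_of_real (Q u \<bullet> u / 2))"
        using bounded_linear.tendsto[OF psd_operatorD(1)[OF Q]] by (intro tendsto_intros) auto
    qed
  have h4: "(\<integral>\<^sup>+x. ennreal (norm x ^ 4) \<partial>\<gamma>) < \<infinity>"
  proof -
    have "(\<integral>\<^sup>+x. ennreal (norm x ^ 4) \<partial>\<gamma>) = (\<integral>\<^sup>+\<omega>. ennreal (norm (Y \<omega>) ^ 4) \<partial>M)"
      unfolding \<gamma>_def by (subst nn_integral_distr) auto
    also have "\<dots> = (\<integral>\<^sup>+\<omega>. liminf (\<lambda>n. ennreal (norm (Z n \<omega>) ^ 4)) \<partial>M)"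
    proof (rule nn_integral_cong_AE)
      show "AE \<omega> in M. ennreal (norm (Y \<omega>) ^ 4) = liminf (\<lambda>n. ennreal (norm (Z n \<omega>) ^ 4))"
        using ZY
      proof eventually_elim
        case (elim \<omega>)
        then have "(\<lambda>n. ennreal (norm (Z n \<omega>) ^ 4)) \<longlonglongrightarrow> ennreal (norm (Y \<omega>) ^ 4)"
          by (intro tendsto_intros)
        then show ?case by (intro lim_imp_Liminf[symmetric]) simp_all
      qed
    qed
    \<comment> \<open>Fatou's lemma transfers the bound, which is uniform in \<open>n\<close>, to
      the limit \<open>Y\<close>.\<close>
    also have "\<dots> \<le> liminf (\<lambda>n. \<integral>\<^sup>+\<omega>. ennreal (norm (Z n \<omega>) ^ 4) \<partial>M)"
      by (rule nn_integral_liminf) auto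
    also have "\<dots> \<le> ennreal (3 * T\<^sup>2)"
    proof (rule Liminf_le)
      have "(\<integral>\<^sup>+\<omega>. ennreal (norm (Z n \<omega>) ^ 4) \<partial>M) \<le> ennreal (3 * T\<^sup>2)" for n
      proof -
        have "norm (Z n \<omega>) ^ 4 \<le> (V n \<omega>)\<^sup>2" for \<omega>
          using power_mono[OF normZ[of "{..<n}" \<omega>], of 2] by (simp add: Z_def V_def flip: power_mult)
        then have "(\<integral>\<^sup>+\<omega>. ennreal (norm (Z n \<omega>) ^ 4) \<partial>M) \<le> (\<integral>\<^sup>+\<omega>. ennreal ((V n \<omega>)\<^sup>2) \<partial>M)"
          by (intro nn_integral_mono ennreal_leI)
        also note V4
        finally show ?thesis .
      qed
      then show "\<forall>\<^sub>F n in sequentially. (\<integral>\<^sup>+\<omega>. ennreal (norm (Z n \<omega>) ^ 4) \<partial>M) \<le> ennreal (3 * T\<^sup>2)" by simp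
    qed simp
    also have "\<dots> < \<infinity>" by simp
    finally show ?thesis .
  qed
  show thesis by (rule that[OF h1 h2 h3 h4])
qed

section \<open>Gamma laws\<close>

lemma gamma_kernel_integral:
  fixes a l :: real
  assumes a: "0 < a" and l: "0 < l"
  shows "has_bochner_integral lborel (\<lambda>x. indicator {0<..} x * (x powr (a - 1) * exp (- (l * x)))) (Gamma a * l powr (- a))"
proof (rule has_bochner_integral_nn_integral)
  let ?f = "\<lambda>x. indicator {0<..} x * (x powr (a - 1) * exp (- (l * x)))"
  have base: "(\<integral>\<^sup>+x. ennreal (indicator {0<..} x * (x powr (a - 1) * exp (- x))) \<partial>lborel) = ennreal (Gamma a)"
  proof -
    have "(\<integral>\<^sup>+x. ennreal (indicator {0..} x * (x powr (a - 1) / exp x)) \<partial>lborel) = ennreal (Gamma a)"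
      by (rule nn_integral_has_integral_lebesgue[OF _ Gamma_integral_real[OF a]]) simp
    moreover have "indicator {0..} x * (x powr (a - 1) / exp x) = indicator {0<..} x * (x powr (a - 1) * exp (- x))" for x :: real
      by (cases "x = 0") (auto simp: indicator_def exp_minus divide_inverse)
    ultimately show ?thesis by simp
  qed
  have "(\<integral>\<^sup>+x. ennreal (?f x) \<partial>lborel) = ennreal \<bar>1 / l\<bar> * (\<integral>\<^sup>+x. ennreal (?f (0 + (1/l) * x)) \<partial>lborel)"
    using l by (intro nn_integral_real_affine) auto
  also have "(\<lambda>x. ennreal (?f (0 + (1/l) * x))) = (\<lambda>x. ennreal (l powr (1 - a)) * ennreal (indicator {0<..} x * (x powr (a - 1) * exp (- x))))"
  proof
    fix x
    have "?f (0 + (1/l) * x) = l powr (1 - a) * (indicator {0<..} x * (x powr (a - 1) * exp (- x)))"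
    proof (cases "0 < x")
      case True
      then have "(x / l) powr (a - 1) = l powr (1 - a) * x powr (a - 1)"
        using l by (simp add: powr_divide powr_diff field_simps)
      then show ?thesis using True l by (simp add: indicator_def)
    next
      case False
      then have "x / l \<le> 0" using l by (simp add: divide_nonpos_pos)
      then show ?thesis using False by (simp add: indicator_def)
    qed
    then show "ennreal (?f (0 + (1/l) * x)) = ennreal (l powr (1 - a)) * ennreal (indicator {0<..} x * (x powr (a - 1) * exp (- x)))"
      by (simp add: ennreal_mult'')
  qed
  also have "ennreal \<bar>1 / l\<bar> * (\<integral>\<^sup>+x. ennreal (l powr (1 - a)) * ennreal (indicator {0<..} x * (x powr (a - 1) * exp (- x))) \<partial>lborel)
     = ennreal (1 / l) * (ennreal (l powr (1 - a)) * ennreal (Gamma a))"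
    using l by (subst nn_integral_cmult) (auto simp: base)
  also have "\<dots> = ennreal (Gamma a * l powr (- a))"
    using l a by (simp add: ennreal_mult[symmetric] powr_diff powr_minus field_simps)
  finally show "(\<integral>\<^sup>+x. ennreal (?f x) \<partial>lborel) = ennreal (Gamma a * l powr (- a))" .
  show "0 \<le> Gamma a * l powr (- a)" using a by simp
qed auto

lemma gchoose_minus_power:
  fixes a x :: "'a::field_char_0"
  shows "((- a) gchoose n) * (- x) ^ n = pochhammer a n / fact n * x ^ n"
proof -
  have "((- a) gchoose n) * (- x) ^ n = ((- 1) ^ n * pochhammer a n / fact n) * ((- 1) ^ n * x ^ n)"
    by (simp only: gbinomial_pochhammer minus_minus power_minus[of x])
  also have "\<dots> = ((- 1) ^ n * (- 1) ^ n) * (pochhammer a n / fact n * x ^ n)"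
    by (simp only: mult_ac times_divide_eq_left times_divide_eq_right)
  also have "(- 1) ^ n * (- 1) ^ n = (1 :: 'a)"
    by (simp flip: power_mult_distrib)
  finally show ?thesis by simp
qed

text \<open>
  Expanding \<open>exp (- w x) = exp (- l x) exp ((l - w) x)\<close> in powers of \<open>l - w\<close> gives a binomial series,
  which converges once the real number \<open>l\<close> is so large that \<open>\<bar>l - w\<bar> < l\<close>.
\<close>

lemma gamma_laplace_kernel:
  fixes a :: real and w :: complex
  assumes a: "0 < a" and w: "0 < Re w"
  shows "integrable lborel (\<lambda>x. complex_of_real (indicator {0<..} x * x powr (a - 1)) * exp (- (w * complex_of_real x)))" (is "integrable _ ?g")
    and "(CLINT x|lborel. complex_of_real (indicator {0<..} x * x powr (a - 1)) * exp (- (w * complex_of_real x))) =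
      complex_of_real (Gamma a) * exp (- (complex_of_real a * Ln w))"
proof -
  have wn: "w \<noteq> 0" using w by auto
  \<comment> \<open>The disc around \<open>l\<close> of radius \<open>l\<close> contains
    \<open>w\<close> as soon as \<open>2 * l * Re w\<close> exceeds the square of the modulus of
    \<open>w\<close>. The choice makes it twice that square.\<close>
  define l where "l = (cmod w)\<^sup>2 / Re w"
  have lp: "0 < l" using w wn by (simp add: l_def)
  have lw: "cmod (complex_of_real l - w) < l"
  proof -
    have "(cmod (complex_of_real l - w))\<^sup>2 = l\<^sup>2 - 2 * l * Re w + (cmod w)\<^sup>2"
      unfolding cmod_power2 by (simp add: power2_eq_square algebra_simps)
    also have "\<dots> = l\<^sup>2 - (cmod w)\<^sup>2" using w by (simp add: l_def)
    also have "\<dots> < l\<^sup>2" using wn by simp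
    finally show ?thesis using lp by (simp add: power2_less_imp_less)
  qed
  define r where "r = cmod (complex_of_real l - w) / l"
  have r: "0 \<le> r" "r < 1" using lw lp by (auto simp: r_def)
  define k where "k n x = indicator {0<..} x * (x powr (a + real n - 1) * exp (- (l * x)))" for n x
  have k: "has_bochner_integral lborel (k n) (Gamma (a + real n) * l powr (- (a + real n)))" for n
    unfolding k_def using a lp by (intro gamma_kernel_integral) auto
  have k0: "0 \<le> k n x" for n x by (simp add: k_def)
  define c where "c n = (complex_of_real l - w) ^ n / fact n" for n
  define f where "f n x = c n * complex_of_real (k n x)" for n x
  have kint: "integrable lborel (k n)" "(LINT x|lborel. k n x) = Gamma (a + real n) * l powr (- (a + real n))" for n
    using k[of n] by (auto simp: has_bochner_integral_iff)
  have Gn: "Gamma (a + real n) * l powr (- (a + real n)) = Gamma a * l powr (- a) * (pochhammer a n / l ^ n)" for n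
  proof -
    have "Gamma (a + real n) = pochhammer a n * Gamma a"
    proof -
      have "a \<notin> \<int>\<^sub>\<le>\<^sub>0" using a by (auto elim!: nonpos_Ints_cases)
      then show ?thesis using pochhammer_Gamma[of a n] Gamma_real_pos[OF a] by simp
    qed
    moreover have "l powr (- (a + real n)) = l powr (- a) / l ^ n"
      using lp by (simp add: powr_diff powr_realpow)
    ultimately show ?thesis by simp
  qed
  have f_sums: "(\<lambda>n. f n x) sums ?g x" for x
  proof (cases "0 < x")
    case True
    have "(\<lambda>n. complex_of_real (x powr (a - 1) * exp (- (l * x))) * (((complex_of_real l - w) * complex_of_real x) ^ n /\<^sub>R fact n)) sums
       (complex_of_real (x powr (a - 1) * exp (- (l * x))) * exp ((complex_of_real l - w) * complex_of_real x))"
      by (intro sums_mult exp_converges)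
    moreover have "complex_of_real (x powr (a - 1) * exp (- (l * x))) * (((complex_of_real l - w) * complex_of_real x) ^ n /\<^sub>R fact n) = f n x" for n
    proof -
      have "x powr (a + real n - 1) = x powr (a - 1) * x ^ n"
        using True by (simp add: powr_add[symmetric] powr_realpow[symmetric] algebra_simps)
      then show ?thesis using True
        by (simp add: f_def c_def k_def power_mult_distrib scaleR_conv_of_real divide_inverse mult_ac)
    qed
    moreover have "complex_of_real (x powr (a - 1) * exp (- (l * x))) * exp ((complex_of_real l - w) * complex_of_real x) = ?g x"
      using True by (simp add: exp_of_real[symmetric] mult.assoc exp_add[symmetric] algebra_simps)
    ultimately show ?thesis by (simp only:)
  qed (simp add: f_def k_def)
  have fint: "integrable lborel (f n)" for n
    unfolding f_def using kint(1)[of n] by (intro integrable_mult_right integrable_of_real)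
  have f_norm: "(\<integral>x. norm (f n x) \<partial>lborel) = Gamma a * l powr (- a) * (pochhammer a n / fact n * r ^ n)" for n
  proof -
    have "(\<integral>x. norm (f n x) \<partial>lborel) = cmod (c n) * (LINT x|lborel. k n x)"
      by (simp add: f_def norm_mult k0)
    then show ?thesis unfolding kint Gn
      by (simp add: c_def r_def norm_divide norm_power power_divide)
  qed
  have summ: "summable (\<lambda>n. \<integral>x. norm (f n x) \<partial>lborel)"
  proof -
    \<comment> \<open>For \<open>a > 0\<close> the binomial coefficients of exponent
      \<open>-a\<close>, with the sign of \<open>(- r) ^ n\<close>, are all positive. The norms
      therefore form a convergent binomial series at \<open>r < 1\<close>, which permits termwise
      integration.\<close>
    have "summable (\<lambda>n. ((- a) gchoose n) * (- r) ^ n)"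
      using gen_binomial_real[of "- r" "- a"] r by (auto simp: sums_iff)
    moreover have "((- a) gchoose n) * (- r) ^ n = pochhammer a n / fact n * r ^ n" for n
      by (rule gchoose_minus_power)
    ultimately show ?thesis unfolding f_norm by (intro summable_mult) simp
  qed
  have aes: "AE x in lborel. summable (\<lambda>n. norm (f n x))"
  proof (rule AE_I2)
    fix x :: real
    show "summable (\<lambda>n. norm (f n x))"
    proof (cases "0 < x")
      case True
      have "norm (f n x) = x powr (a - 1) * exp (- (l * x)) * ((cmod (complex_of_real l - w) * x) ^ n /\<^sub>R fact n)" for n
      proof -
        have "x powr (a + real n - 1) = x powr (a - 1) * x ^ n"
          using True by (simp add: powr_add[symmetric] powr_realpow[symmetric] algebra_simps)
        moreover have "cmod (c n) = cmod (complex_of_real l - w) ^ n / fact n"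
          by (simp add: c_def norm_divide norm_power)
        ultimately show ?thesis using True
          by (simp add: f_def k_def norm_mult norm_power power_mult_distrib divide_inverse mult_ac)
      qed
      then show ?thesis by (simp only: summable_mult summable_exp_generic)
    qed (simp add: f_def k_def)
  qed
  have gsum: "?g = (\<lambda>x. \<Sum>n. f n x)" using f_sums by (auto simp: fun_eq_iff sums_iff)
  show "integrable lborel ?g"
    unfolding gsum by (rule integrable_suminf[OF fint aes summ])
  have 1: "(\<lambda>n. integral\<^sup>L lborel (f n)) sums integral\<^sup>L lborel ?g"
    unfolding gsum using sums_integral[OF fint aes summ] by simp
  have 2: "(\<lambda>n. integral\<^sup>L lborel (f n)) sums (complex_of_real (Gamma a * l powr (- a)) * (1 + (- (complex_of_real l - w) / complex_of_real l)) powr (- complex_of_real a))"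
  proof -
    have "(\<lambda>n. complex_of_real (Gamma a * l powr (- a)) * (((- complex_of_real a) gchoose n) * (- (complex_of_real l - w) / complex_of_real l) ^ n))
       sums (complex_of_real (Gamma a * l powr (- a)) * (1 + (- (complex_of_real l - w) / complex_of_real l)) powr (- complex_of_real a))"
    proof (intro sums_mult gen_binomial_complex)
      show "cmod (- (complex_of_real l - w) / complex_of_real l) < 1"
        using r lp by (simp add: r_def norm_divide norm_minus_commute)
    qed
    moreover have "integral\<^sup>L lborel (f n) = complex_of_real (Gamma a * l powr (- a)) * (((- complex_of_real a) gchoose n) * (- (complex_of_real l - w) / complex_of_real l) ^ n)" for n
    proof -
      have "integral\<^sup>L lborel (f n) = c n * complex_of_real (LINT x|lborel. k n x)"
        unfolding f_def by simp
      also have "\<dots> = c n * complex_of_real (Gamma a * l powr (- a) * (pochhammer a n / l ^ n))"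
        by (simp only: kint Gn)
      also have "\<dots> = complex_of_real (Gamma a * l powr (- a)) * (pochhammer (complex_of_real a) n / fact n * ((complex_of_real l - w) / complex_of_real l) ^ n)"
        by (simp add: c_def power_divide pochhammer_of_real)
      also have "pochhammer (complex_of_real a) n / fact n * ((complex_of_real l - w) / complex_of_real l) ^ n =
        ((- complex_of_real a) gchoose n) * (- ((complex_of_real l - w) / complex_of_real l)) ^ n"
        by (rule gchoose_minus_power[symmetric])
      finally show ?thesis by (simp only: minus_divide_left)
    qed
    ultimately show ?thesis by simp
  qed
  have "1 + (- (complex_of_real l - w) / complex_of_real l) = w / complex_of_real l"
    using lp by (simp add: field_simps)
  \<comment> \<open>Division by a positive real changes \<open>Ln w\<close> by a real number only,
    so the principal branches match and \<open>l\<close> cancels.\<close>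
  moreover have "(w / complex_of_real l) powr (- complex_of_real a) = exp (- (complex_of_real a * Ln w)) * complex_of_real (l powr a)"
    using wn lp by (simp add: powr_def Ln_divide_of_real exp_of_real[symmetric] exp_add[symmetric] algebra_simps)
  moreover have "complex_of_real (l powr (- a)) * complex_of_real (l powr a) = 1"
    using lp by (simp add: powr_minus flip: of_real_mult)
  ultimately have "complex_of_real (Gamma a * l powr (- a)) * (1 + (- (complex_of_real l - w) / complex_of_real l)) powr (- complex_of_real a)
      = complex_of_real (Gamma a) * exp (- (complex_of_real a * Ln w))"
    by (simp add: mult_ac)
  then show "integral\<^sup>L lborel ?g = complex_of_real (Gamma a) * exp (- (complex_of_real a * Ln w))"
    using sums_unique2[OF 1 2] by simp
qed

section \<open>Gamma laws of rate one: moments and Laplace transform\<close>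

definition gamma_law :: "real \<Rightarrow> real measure" where
  "gamma_law s = density lborel (\<lambda>x. ennreal (gamma_density s 1 x))"

lemma gamma_density_1: "gamma_density s 1 x = indicator {0<..} x * (x powr (s - 1) * exp (- (1 * x))) / Gamma s"
  by (simp add: gamma_density_def indicator_def)

lemma gamma_density_nonneg: "0 < s \<Longrightarrow> 0 \<le> gamma_density s 1 x"
  by (simp add: gamma_density_1)

lemma gamma_density_measurable [measurable]: "gamma_density s 1 \<in> borel_measurable borel"
  unfolding gamma_density_1[abs_def] by measurable

lemma sets_gamma_law [simp, measurable_cong]: "sets (gamma_law s) = sets borel"
  by (simp add: gamma_law_def)

lemma gamma_law_powr_moment:
  assumes s: "0 < s" and p: "0 \<le> p"
  shows "has_bochner_integral (gamma_law s) (\<lambda>x. x powr p * indicator {0<..} x) (Gamma (s + p) / Gamma s)"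
proof -
  have "has_bochner_integral lborel (\<lambda>x. indicator {0<..} x * (x powr (s + p - 1) * exp (- (1 * x)))) (Gamma (s + p) * 1 powr (- (s + p)))"
    using s p by (intro gamma_kernel_integral) auto
  then have "has_bochner_integral lborel (\<lambda>x. indicator {0<..} x * (x powr (s + p - 1) * exp (- (1 * x))) / Gamma s) (Gamma (s + p) * 1 powr (- (s + p)) / Gamma s)"
    by (intro has_bochner_integral_divide_zero) auto
  moreover have "indicator {0<..} x * (x powr (s + p - 1) * exp (- (1 * x))) / Gamma s =
      gamma_density s 1 x *\<^sub>R (x powr p * indicator {0<..} x)" for x
    by (auto simp: gamma_density_1 indicator_def powr_add[symmetric] algebra_simps)
  ultimately have "has_bochner_integral lborel (\<lambda>x. gamma_density s 1 x *\<^sub>R (x powr p * indicator {0<..} x)) (Gamma (s + p) / Gamma s)"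
    by simp
  then show ?thesis unfolding gamma_law_def
    by (intro has_bochner_integral_density) (auto simp: gamma_density_nonneg[OF s])
qed

lemma prob_space_gamma_law:
  assumes s: "0 < s"
  shows "prob_space (gamma_law s)"
proof (rule prob_spaceI)
  have "has_bochner_integral lborel (\<lambda>x. indicator {0<..} x * (x powr (s - 1) * exp (- (1 * x))) / Gamma s) (Gamma s * 1 powr (- s) / Gamma s)"
    using s by (intro has_bochner_integral_divide_zero gamma_kernel_integral) auto
  then have "has_bochner_integral lborel (gamma_density s 1) 1"
    using Gamma_real_pos[OF s] by (simp add: gamma_density_1[abs_def])
  then have "(\<integral>\<^sup>+x. ennreal (gamma_density s 1 x) \<partial>lborel) = 1"
    using nn_integral_eq_integral[of lborel "gamma_density s 1"] gamma_density_nonneg[OF s]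
    by (auto simp: has_bochner_integral_iff)
  then show "emeasure (gamma_law s) (space (gamma_law s)) = 1"
    by (simp add: gamma_law_def emeasure_density)
qed

lemma gamma_law_pos: "AE x in gamma_law s. 0 < x"
  unfolding gamma_law_def by (subst AE_density) (auto simp: gamma_density_def)

lemma gamma_law_moments:
  assumes s: "0 < s"
  shows "integrable (gamma_law s) (\<lambda>x. x)" "(LINT x|gamma_law s. x) = s"
    "integrable (gamma_law s) (\<lambda>x. x\<^sup>2)" "(LINT x|gamma_law s. x\<^sup>2) = s\<^sup>2 + s"
proof -
  have G1: "Gamma (s + 1) = s * Gamma s"
    using s by (intro Gamma_plus1) (auto elim!: nonpos_Ints_cases)
  have G2: "Gamma (s + 2) = (s + 1) * (s * Gamma s)"
  proof -
    have "s + 1 \<notin> \<int>\<^sub>\<le>\<^sub>0" using s by (auto elim!: nonpos_Ints_cases)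
    from Gamma_plus1[OF this] show ?thesis by (simp add: G1 add.assoc)
  qed
  have G0: "Gamma s \<noteq> 0" using Gamma_real_pos[OF s] by simp
  then have G3: "Gamma (s + 2) / Gamma s = s\<^sup>2 + s" by (simp add: G2 power2_eq_square field_simps)
  have ae1: "AE x in gamma_law s. x powr 1 * indicator {0<..} x = x"
    and ae2: "AE x in gamma_law s. x powr 2 * indicator {0<..} x = x\<^sup>2"
    using gamma_law_pos by (eventually_elim, simp add: powr_numeral)+
  have "has_bochner_integral (gamma_law s) (\<lambda>x. x) s"
    using gamma_law_powr_moment[OF s, of 1] ae1 G0 by (subst has_bochner_integral_cong_AE[symmetric, OF _ _ ae1]) (auto simp: G1)
  then show "integrable (gamma_law s) (\<lambda>x. x)" "(LINT x|gamma_law s. x) = s"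
    by (auto simp: has_bochner_integral_iff)
  have "has_bochner_integral (gamma_law s) (\<lambda>x. x\<^sup>2) (s\<^sup>2 + s)"
    using gamma_law_powr_moment[OF s, of 2] ae2
    by (subst has_bochner_integral_cong_AE[symmetric, OF _ _ ae2]) (auto simp: G3)
  then show "integrable (gamma_law s) (\<lambda>x. x\<^sup>2)" "(LINT x|gamma_law s. x\<^sup>2) = s\<^sup>2 + s"
    by (auto simp: has_bochner_integral_iff)
qed

lemma gamma_law_laplace:
  assumes s: "0 < s" and z: "0 \<le> Re z"
  shows "(CLINT x|gamma_law s. exp (- (z * complex_of_real x))) = exp (- (complex_of_real s * Ln (1 + z)))"
proof -
  have w: "0 < Re (1 + z)" using z by simp
  have "(CLINT x|gamma_law s. exp (- (z * complex_of_real x))) =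
      (CLINT x|lborel. complex_of_real (indicator {0<..} x * x powr (s - 1)) * exp (- ((1 + z) * complex_of_real x)) / complex_of_real (Gamma s))"
    unfolding gamma_law_def
  proof (subst integral_density)
    show "(CLINT x|lborel. gamma_density s 1 x *\<^sub>R exp (- (z * complex_of_real x))) =
      (CLINT x|lborel. complex_of_real (indicator {0<..} x * x powr (s - 1)) * exp (- ((1 + z) * complex_of_real x)) / complex_of_real (Gamma s))"
    proof (intro Bochner_Integration.integral_cong refl)
      fix x :: real
      have "exp (- ((1 + z) * complex_of_real x)) = complex_of_real (exp (- (1 * x))) * exp (- (z * complex_of_real x))"
        by (simp add: exp_of_real[symmetric] exp_add[symmetric] algebra_simps)
      then show "gamma_density s 1 x *\<^sub>R exp (- (z * complex_of_real x)) =
          complex_of_real (indicator {0<..} x * x powr (s - 1)) * exp (- ((1 + z) * complex_of_real x)) / complex_of_real (Gamma s)"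
        by (simp add: gamma_density_1 scaleR_conv_of_real)
    qed
  qed (auto simp: gamma_density_nonneg[OF s])
  also have "\<dots> = exp (- (complex_of_real s * Ln (1 + z)))"
    using gamma_laplace_kernel(2)[OF s w] Gamma_real_pos[OF s] by simp
  finally show ?thesis .
qed

section \<open>The Frullani integral\<close>

lemma integrable_pair_mult:
  fixes f g :: "_ \<Rightarrow> real"
  assumes "sigma_finite_measure M" "sigma_finite_measure N" and f: "integrable M f" and g: "integrable N g"
  shows "integrable (M \<Otimes>\<^sub>M N) (\<lambda>p. f (fst p) * g (snd p))"
    and "(LINT p|(M \<Otimes>\<^sub>M N). f (fst p) * g (snd p)) = (LINT x|M. f x) * (LINT y|N. g y)"
proof -
  interpret M: sigma_finite_measure M by fact
  interpret N: sigma_finite_measure N by fact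
  interpret P: pair_sigma_finite M N ..
  have [measurable]: "f \<in> borel_measurable M" "g \<in> borel_measurable N" using f g by auto
  show i: "integrable (M \<Otimes>\<^sub>M N) (\<lambda>p. f (fst p) * g (snd p))"
  proof (rule P.Fubini_integrable)
    show "integrable M (\<lambda>x. LINT y|N. norm (f (fst (x, y)) * g (snd (x, y))))"
      using f by (simp add: abs_mult)
    show "AE x in M. integrable N (\<lambda>y. f (fst (x, y)) * g (snd (x, y)))"
      using g by simp
  qed simp
  show "(LINT p|(M \<Otimes>\<^sub>M N). f (fst p) * g (snd p)) = (LINT x|M. f x) * (LINT y|N. g y)"
    using P.integral_fst'[OF i] by simp
qed

text \<open>The segment from 1 to \<open>1 + z\<close> stays in the right half plane, away from the
  branch cut, so the principal logarithm is a primitive along it.\<close>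

lemma integral_Ln_path:
  assumes z: "0 \<le> Re z"
  shows "(CLINT r|lborel. indicator {0..1} r *\<^sub>R (z / (1 + complex_of_real r * z))) = Ln (1 + z)"
proof -
  have pos: "0 < Re (1 + complex_of_real r * z)" if "0 \<le> r" for r
    using z that by (simp add: add_pos_nonneg)
  have nz: "1 + complex_of_real r * z \<noteq> 0" if "0 \<le> r" for r
    using pos[OF that] by (metis less_irrefl zero_complex.simps(1))
  have "(CLINT r|lborel. indicator {0..1} r *\<^sub>R (z / (1 + complex_of_real r * z))) = Ln (1 + complex_of_real 1 * z) - Ln (1 + complex_of_real 0 * z)"
  proof (rule integral_FTC_Icc)
    fix r :: real assume r: "0 \<le> r" "r \<le> 1"
    have nn: "1 + complex_of_real r * z \<notin> \<real>\<^sub>\<le>\<^sub>0"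
      using pos[OF r(1)] by (auto simp: complex_nonpos_Reals_iff)
    have "((\<lambda>r. Ln (1 + r * z)) has_field_derivative z / (1 + complex_of_real r * z)) (at (complex_of_real r))"
      using nn by (auto intro!: derivative_eq_intros simp: field_simps)
    then show "((\<lambda>r. Ln (1 + complex_of_real r * z)) has_vector_derivative z / (1 + complex_of_real r * z)) (at r within {0..1})"
      by (rule has_vector_derivative_real_field)
  next
    show "continuous_on {0..1} (\<lambda>r. z / (1 + complex_of_real r * z))"
      using nz by (intro continuous_intros) auto
  qed simp
  then show ?thesis by simp
qed

text \<open>The factor \<open>1 / t\<close> disappears when \<open>(exp (- (z * t)) - 1) / t\<close>
  is written as the integral of \<open>- z * exp (- (r * z * t))\<close> over \<open>r\<close> in
  \<open>[0, 1]\<close>. After exchanging the integrals the one in \<open>t\<close> is exponential,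
  and the one in \<open>r\<close> is \<open>integral_Ln_path\<close>.\<close>

lemma frullani:
  assumes z: "0 \<le> Re z"
  shows "(CLINT t|lborel. complex_of_real (indicator {0<..} t * (inverse t * exp (- t))) * (exp (- (z * complex_of_real t)) - 1)) = - Ln (1 + z)"
proof -
  define F where "F = (\<lambda>(t, r). (indicator {0<..} t * indicator {0..1} r) *\<^sub>R (- z * exp (- ((1 + complex_of_real r * z) * complex_of_real t))))"
  have [measurable]: "F \<in> borel_measurable (lborel \<Otimes>\<^sub>M lborel)"
    unfolding F_def by measurable
  have e: "has_bochner_integral lborel (\<lambda>x. indicator {0<..} x * (x powr (1 - 1) * exp (- (1 * x)))) (Gamma 1 * 1 powr (- 1 :: real))"
    by (rule gamma_kernel_integral) auto
  \<comment> \<open>For \<open>0 \<le> Re z\<close> the integrand is dominated by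
    \<open>exp (- t) * cmod z\<close> on a strip of width 1. The factor
    \<open>t powr (1 - 1)\<close> equals 1 for positive \<open>t\<close>; it lets the gamma kernel
    of shape 1 supply integrability.\<close>
  have Fint: "integrable (lborel \<Otimes>\<^sub>M lborel) F"
  proof (rule Bochner_Integration.integrable_bound)
    show "integrable (lborel \<Otimes>\<^sub>M lborel) (\<lambda>p. (indicator {0<..} (fst p) * (fst p powr (1 - 1) * exp (- (1 * fst p)))) * (indicator {0..1::real} (snd p) * cmod z))"
      by (rule integrable_pair_mult) (use e in \<open>auto simp: has_bochner_integral_iff lborel.sigma_finite_measure_axioms\<close>)
    have Fb: "norm (F (t, r)) \<le> norm ((indicator {0<..} t * (t powr (1 - 1) * exp (- (1 * t)))) * (indicator {0..1} r * cmod z))" for t r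
    proof (cases "0 < t \<and> 0 \<le> r \<and> r \<le> 1")
      case True
      then have "0 \<le> r * Re z * t" using z by simp
      then have "exp (- ((1 + r * Re z) * t)) \<le> exp (- t)" by (simp add: algebra_simps)
      then have "exp (- ((1 + r * Re z) * t)) * cmod z \<le> exp (- t) * cmod z" by (intro mult_right_mono) auto
      then show ?thesis using True by (simp add: F_def norm_mult mult.commute)
    qed (auto simp: F_def indicator_def)
    then show "AE p in lborel \<Otimes>\<^sub>M lborel. norm (F p) \<le> norm ((indicator {0<..} (fst p) * (fst p powr (1 - 1) * exp (- (1 * fst p)))) * (indicator {0..1} (snd p) * cmod z))"
      using Fb[of "fst p" "snd p" for p] by (intro AE_I2) (simp only: prod.collapse)
  qed measurable
  have inner_r: "(CLINT r|lborel. F (t, r)) = complex_of_real (indicator {0<..} t * (inverse t * exp (- t))) * (exp (- (z * complex_of_real t)) - 1)" for t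
  proof (cases "0 < t")
    case True
    let ?G = "\<lambda>r. complex_of_real (inverse t) * exp (- ((1 + complex_of_real r * z) * complex_of_real t))"
    have "(CLINT r|lborel. indicator {0..1} r *\<^sub>R (- z * exp (- ((1 + complex_of_real r * z) * complex_of_real t)))) = ?G 1 - ?G 0"
    proof (rule integral_FTC_Icc)
      fix r :: real
      have "((\<lambda>r. complex_of_real (inverse t) * exp (- ((1 + r * z) * complex_of_real t))) has_field_derivative
         (- z * exp (- ((1 + complex_of_real r * z) * complex_of_real t)))) (at (complex_of_real r))"
        using True by (auto intro!: derivative_eq_intros simp: field_simps)
      then show "(?G has_vector_derivative (- z * exp (- ((1 + complex_of_real r * z) * complex_of_real t)))) (at r within {0..1})"
        by (rule has_vector_derivative_real_field)
    qed (auto intro!: continuous_intros)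
    also have "?G 1 - ?G 0 = complex_of_real (inverse t * exp (- t)) * (exp (- (z * complex_of_real t)) - 1)"
      by (simp add: exp_of_real[symmetric] exp_add[symmetric] algebra_simps)
    finally show ?thesis using True by (simp add: F_def)
  qed (simp add: F_def)
  have inner_t: "(CLINT t|lborel. F (t, r)) = - (indicator {0..1} r *\<^sub>R (z / (1 + complex_of_real r * z)))" for r
  proof (cases "r \<in> {0..1}")
    case True
    let ?w = "1 + complex_of_real r * z"
    have w: "0 < Re ?w" using True z by (simp add: add_pos_nonneg)
    then have wn: "?w \<noteq> 0" by (metis less_irrefl zero_complex.simps(1))
    have eq: "F (t, r) = (- z) * (complex_of_real (indicator {0<..} t * t powr (1 - 1)) * exp (- (?w * complex_of_real t)))" for t
      using True by (simp add: F_def indicator_def scaleR_conv_of_real)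
    have "(CLINT t|lborel. F (t, r)) = (- z) * (complex_of_real (Gamma 1) * exp (- (complex_of_real 1 * Ln ?w)))"
      unfolding eq integral_mult_right_zero by (subst gamma_laplace_kernel(2)[OF zero_less_one w]) (rule refl)
    then show ?thesis using True wn by (simp add: exp_minus divide_inverse)
  qed (simp add: F_def)
  have "(CLINT t|lborel. CLINT r|lborel. F (t, r)) = (CLINT r|lborel. CLINT t|lborel. F (t, r))"
    using lborel_pair.Fubini_integral[of "\<lambda>t r. F (t, r)"] Fint by simp
  then show ?thesis
    unfolding inner_r inner_t using integral_Ln_path[OF z] by simp
qed

section \<open>Construction of processes on the dyadic times\<close>

lemma char_PiM:
  fixes \<nu> :: "'i \<Rightarrow> 'h::{real_inner, second_countable_topology} measure"
  assumes p: "\<And>i. prob_space (\<nu> i)" and s: "\<And>i. sets (\<nu> i) = sets borel"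
    and J: "finite J" "J \<subseteq> I"
  shows "(CLINT \<omega>|Pi\<^sub>M I \<nu>. iexp (\<Sum>i\<in>J. u i \<bullet> \<omega> i)) = (\<Prod>i\<in>J. CLINT x|\<nu> i. iexp (u i \<bullet> x))"
proof -
  interpret product_prob_space \<nu> I by (rule product_prob_spaceI) (rule p)
  have c [measurable]: "(\<lambda>x. x i) \<in> borel_measurable (Pi\<^sub>M J \<nu>)" if "i \<in> J" for i
  proof -
    have "(\<lambda>x. x i) \<in> measurable (Pi\<^sub>M J \<nu>) (\<nu> i)" using that by (rule measurable_component_singleton)
    then show ?thesis using measurable_cong_sets[OF refl s] by blast
  qed
  have i: "integrable (\<nu> i) (\<lambda>x. iexp (u i \<bullet> x))" for i
  proof -
    have "(\<lambda>x. u i \<bullet> x) \<in> borel_measurable (\<nu> i)"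
      unfolding measurable_cong_sets[OF s refl] by measurable
    then show ?thesis by (rule prob_space.integrable_iexp_comp[OF p])
  qed
  have m: "(\<lambda>x. iexp (\<Sum>i\<in>J. u i \<bullet> x i)) \<in> borel_measurable (Pi\<^sub>M J \<nu>)"
  proof -
    have [measurable]: "(\<lambda>x. \<Sum>i\<in>J. u i \<bullet> x i) \<in> borel_measurable (Pi\<^sub>M J \<nu>)"
      by (intro borel_measurable_sum borel_measurable_inner borel_measurable_const c)
    show ?thesis by measurable
  qed
  have "(CLINT \<omega>|Pi\<^sub>M I \<nu>. iexp (\<Sum>i\<in>J. u i \<bullet> \<omega> i)) = (CLINT \<omega>|Pi\<^sub>M I \<nu>. iexp (\<Sum>i\<in>J. u i \<bullet> restrict \<omega> J i))"
    by (intro Bochner_Integration.integral_cong refl arg_cong[where f="\<lambda>x. iexp x"] sum.cong) auto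
  also have "\<dots> = (CLINT x|distr (Pi\<^sub>M I \<nu>) (Pi\<^sub>M J \<nu>) (\<lambda>x. restrict x J). iexp (\<Sum>i\<in>J. u i \<bullet> x i))"
  proof (rule integral_distr[symmetric])
    show "(\<lambda>x. restrict x J) \<in> measurable (Pi\<^sub>M I \<nu>) (Pi\<^sub>M J \<nu>)"
      by (rule measurable_restrict_subset[OF J(2)])
  qed (rule m)
  also have "\<dots> = (CLINT x|Pi\<^sub>M J \<nu>. \<Prod>i\<in>J. iexp (u i \<bullet> x i))"
    unfolding distr_PiM_restrict_finite[OF J] iexp_sum ..
  also have "\<dots> = (\<Prod>i\<in>J. CLINT x|\<nu> i. iexp (u i \<bullet> x))"
    by (rule product_integral_prod[OF J(1)]) (rule i)
  finally show ?thesis .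
qed

lemma sum_pairs: "(\<Sum>i<m. f (2 * i) + f (Suc (2 * i))) = (\<Sum>i<2 * m. f i :: 'a::comm_monoid_add)" for m :: nat
  by (induction m) (auto simp: add.assoc)

text \<open>An increment over the block from \<open>j k\<close> to \<open>j (Suc k)\<close> is a sum
  of elementary increments, so \<open>c\<close> takes the value \<open>u k\<close> on that block,
  and identically distributed factors contribute a power. One \<open>c\<close> has to serve both
  equations, whence the existential form.\<close>

lemma block_sums:
  fixes j :: "nat \<Rightarrow> nat" and u :: "nat \<Rightarrow> 'h::real_inner" and \<phi> :: "'h \<Rightarrow> complex"
  assumes "mono_on {..m} j"
  shows "\<exists>c. (\<forall>\<omega>. (\<Sum>k<m. u k \<bullet> ((\<Sum>i<j (Suc k). \<omega> i) - (\<Sum>i<j k. \<omega> i))) = (\<Sum>i=j 0..<j m. c i \<bullet> \<omega> i)) \<and>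
    (\<Prod>i=j 0..<j m. \<phi> (c i)) = (\<Prod>k<m. \<phi> (u k) ^ (j (Suc k) - j k))"
  using assms
proof (induction m)
  case 0
  then show ?case by auto
next
  case (Suc m)
  have "mono_on {..m} j" using Suc.prems by (rule mono_on_subset) auto
  with Suc.IH obtain c where
    c: "\<And>\<omega>. (\<Sum>k<m. u k \<bullet> ((\<Sum>i<j (Suc k). \<omega> i) - (\<Sum>i<j k. \<omega> i))) = (\<Sum>i=j 0..<j m. c i \<bullet> \<omega> i)"
    "(\<Prod>i=j 0..<j m. \<phi> (c i)) = (\<Prod>k<m. \<phi> (u k) ^ (j (Suc k) - j k))" by auto
  have le: "j 0 \<le> j m" "j m \<le> j (Suc m)" using Suc.prems by (auto intro: mono_onD)
  define c' where "c' i = (if i < j m then c i else u m)" for i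
  have "(\<Sum>k<Suc m. u k \<bullet> ((\<Sum>i<j (Suc k). \<omega> i) - (\<Sum>i<j k. \<omega> i))) = (\<Sum>i=j 0..<j (Suc m). c' i \<bullet> \<omega> i)" for \<omega>
  proof -
    have "(\<Sum>i<j (Suc m). \<omega> i) - (\<Sum>i<j m. \<omega> i) = (\<Sum>i=j m..<j (Suc m). \<omega> i)"
      unfolding lessThan_atLeast0 by (rule sum_diff_nat_ivl) (use le in auto)
    moreover have "(\<Sum>i=j 0..<j (Suc m). c' i \<bullet> \<omega> i) = (\<Sum>i=j 0..<j m. c' i \<bullet> \<omega> i) + (\<Sum>i=j m..<j (Suc m). c' i \<bullet> \<omega> i)"
      using le by (simp add: sum.atLeastLessThan_concat)
    moreover have "(\<Sum>i=j 0..<j m. c' i \<bullet> \<omega> i) = (\<Sum>i=j 0..<j m. c i \<bullet> \<omega> i)"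
      "(\<Sum>i=j m..<j (Suc m). c' i \<bullet> \<omega> i) = (\<Sum>i=j m..<j (Suc m). u m \<bullet> \<omega> i)"
      by (auto intro!: sum.cong simp: c'_def)
    ultimately show ?thesis using c(1)[of \<omega>] by (simp add: inner_sum_right)
  qed
  moreover have "(\<Prod>i=j 0..<j (Suc m). \<phi> (c' i)) = (\<Prod>k<Suc m. \<phi> (u k) ^ (j (Suc k) - j k))"
  proof -
    have "(\<Prod>i=j 0..<j (Suc m). \<phi> (c' i)) = (\<Prod>i=j 0..<j m. \<phi> (c' i)) * (\<Prod>i=j m..<j (Suc m). \<phi> (c' i))"
      using le by (simp add: prod.atLeastLessThan_concat)
    moreover have "(\<Prod>i=j 0..<j m. \<phi> (c' i)) = (\<Prod>i=j 0..<j m. \<phi> (c i))"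
      "(\<Prod>i=j m..<j (Suc m). \<phi> (c' i)) = (\<Prod>i=j m..<j (Suc m). \<phi> (u m))"
      by (auto intro!: prod.cong simp: c'_def)
    ultimately show ?thesis using c(2) by simp
  qed
  ultimately show ?case by blast
qed

text \<open>
  The coordinate \<open>\<omega> (n, j)\<close> stands for the value of the process at time \<open>j / 2 ^ n\<close>.
\<close>

theorem dyadic_process_exists:
  fixes \<nu> :: "nat \<Rightarrow> 'h::{real_inner, polish_space} measure" and \<psi> :: "'h \<Rightarrow> complex"
  assumes p: "\<And>n. prob_space (\<nu> n)" and s: "\<And>n. sets (\<nu> n) = sets borel"
    and cf: "\<And>n u. (CLINT x|\<nu> n. iexp (u \<bullet> x)) = exp (\<psi> u / 2 ^ n)"
  obtains N :: "(nat \<times> nat \<Rightarrow> 'h) measure" where "prob_space N" "sets N = sets (Pi\<^sub>M UNIV (\<lambda>_. borel))"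
    "AE \<omega> in N. \<forall>n j. \<omega> (n, j) = \<omega> (Suc n, 2 * j)" "AE \<omega> in N. \<forall>n. \<omega> (n, 0) = 0"
    "\<And>n m j u. mono_on {..m} j \<Longrightarrow>
      (CLINT \<omega>|N. iexp (\<Sum>k<m. u k \<bullet> (\<omega> (n, j (Suc k)) - \<omega> (n, j k)))) =
      (\<Prod>k<m. exp (of_nat (j (Suc k) - j k) * \<psi> (u k) / 2 ^ n))"
proof -
  define \<Omega> where "\<Omega> n = Pi\<^sub>M (UNIV :: nat set) (\<lambda>_. \<nu> n)" for n
  have p\<Omega>: "prob_space (\<Omega> n)" for n unfolding \<Omega>_def using p by (intro prob_space_PiM)
  have s\<Omega> [measurable_cong]: "sets (\<Omega> n) = sets (Pi\<^sub>M UNIV (\<lambda>_. borel))" for n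
    unfolding \<Omega>_def using s by (intro sets_PiM_cong) auto
  have coord [measurable]: "(\<lambda>\<omega>. \<omega> i) \<in> borel_measurable (\<Omega> n)" for i n
    using measurable_component_singleton[of i UNIV "\<lambda>_. borel :: 'h measure"] measurable_cong_sets[OF s\<Omega> refl] by blast
  have char\<Omega>: "(CLINT \<omega>|\<Omega> n. iexp (\<Sum>i\<in>J. u i \<bullet> \<omega> i)) = (\<Prod>i\<in>J. exp (\<psi> (u i) / 2 ^ n))" if "finite J" for n J u
    unfolding \<Omega>_def using char_PiM[of "\<lambda>_. \<nu> n" J UNIV u, OF p s that] by (simp only: cf) simp
  \<comment> \<open>Adding neighbouring increments passes from level \<open>n + 1\<close> to level
    \<open>n\<close>. Since the exponent is halved from one level to the next, \<open>ps\<close>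
    maps one product law to the other; this is the consistency condition of Kolmogorov
    extension.\<close>
  define ps where "ps = (\<lambda>\<omega> :: nat \<Rightarrow> 'h. \<lambda>k. \<omega> (2 * k) + \<omega> (Suc (2 * k)))"
  have ps [measurable]: "ps \<in> measurable (\<Omega> n) (Pi\<^sub>M UNIV (\<lambda>_. borel))" for n
    unfolding ps_def by (rule measurable_PiM_single') auto
  have ps_distr: "distr (\<Omega> (Suc n)) (Pi\<^sub>M UNIV (\<lambda>_. borel)) ps = \<Omega> n" for n
  proof (rule measure_eqI_char_PiM)
    interpret prob_space "\<Omega> (Suc n)" by (rule p\<Omega>)
    show "finite_measure (distr (\<Omega> (Suc n)) (Pi\<^sub>M UNIV (\<lambda>_. borel)) ps)" by (rule finite_measure_distr) simp
    show "finite_measure (\<Omega> n)" using p\<Omega> by (rule prob_space.finite_measure)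
    fix J :: "nat set" and u :: "nat \<Rightarrow> 'h" assume J: "finite J"
    define K where "K = (\<lambda>k. 2 * k) ` J \<union> (\<lambda>k. Suc (2 * k)) ` J"
    have Ksum: "(\<Sum>i\<in>K. g i) = (\<Sum>k\<in>J. g (2 * k)) + (\<Sum>k\<in>J. g (Suc (2 * k)))" for g :: "nat \<Rightarrow> real"
      unfolding K_def using J by (subst sum.union_disjoint) (auto simp: sum.reindex inj_on_def, presburger?)
    have Kprod: "(\<Prod>i\<in>K. g i) = (\<Prod>k\<in>J. g (2 * k)) * (\<Prod>k\<in>J. g (Suc (2 * k)))" for g :: "nat \<Rightarrow> complex"
      unfolding K_def using J by (subst prod.union_disjoint) (auto simp: prod.reindex inj_on_def, presburger?)
    have "(CLINT x|distr (\<Omega> (Suc n)) (Pi\<^sub>M UNIV (\<lambda>_. borel)) ps. iexp (\<Sum>i\<in>J. u i \<bullet> x i)) =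
        (CLINT \<omega>|\<Omega> (Suc n). iexp (\<Sum>i\<in>J. u i \<bullet> ps \<omega> i))"
      by (rule integral_distr) (auto intro!: borel_measurable_sum)
    also have "\<dots> = (CLINT \<omega>|\<Omega> (Suc n). iexp (\<Sum>i\<in>K. u (i div 2) \<bullet> \<omega> i))"
      unfolding Ksum by (simp add: ps_def inner_add_right sum.distrib)
    also have "\<dots> = (\<Prod>i\<in>K. exp (\<psi> (u (i div 2)) / 2 ^ Suc n))"
      using J by (intro char\<Omega>) (auto simp: K_def)
    also have "\<dots> = (\<Prod>k\<in>J. exp (\<psi> (u k) / 2 ^ n))"
      unfolding Kprod by (simp add: prod.distrib[symmetric] exp_add[symmetric])
    also have "\<dots> = (CLINT x|\<Omega> n. iexp (\<Sum>i\<in>J. u i \<bullet> x i))" using char\<Omega>[OF J] by simp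
    finally show "(CLINT x|distr (\<Omega> (Suc n)) (Pi\<^sub>M UNIV (\<lambda>_. borel)) ps. iexp (\<Sum>i\<in>J. u i \<bullet> x i)) =
      (CLINT x|\<Omega> n. iexp (\<Sum>i\<in>J. u i \<bullet> x i))" .
  qed (auto simp: s\<Omega>)
  \<comment> \<open>The value at time \<open>j / 2 ^ n\<close>, computed at a finer level
    \<open>N\<close>, is the sum of the first \<open>j * 2 ^ (N - n)\<close> increments. The
    subtraction is truncated, so this is meant for \<open>n \<le> N\<close>.\<close>
  define S where "S N \<omega> q = (\<Sum>i<snd q * 2 ^ (N - fst q). \<omega> i)" for N and \<omega> :: "nat \<Rightarrow> 'h" and q :: "nat \<times> nat"
  have Sm [measurable]: "(\<lambda>\<omega>. restrict (S N \<omega>) J) \<in> measurable (\<Omega> n) (Pi\<^sub>M J (\<lambda>_. borel))" for N J n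
    unfolding S_def restrict_def[abs_def] by (rule measurable_PiM_single') auto
  have Sps: "S N (ps \<omega>) q = S (Suc N) \<omega> q" if "fst q \<le> N" for N \<omega> q
  proof -
    have "snd q * 2 ^ (Suc N - fst q) = 2 * (snd q * 2 ^ (N - fst q))"
      using that by (simp add: Suc_diff_le)
    then show ?thesis unfolding S_def ps_def sum_pairs by (simp only:)
  qed
  define D where "D N J = distr (\<Omega> N) (Pi\<^sub>M J (\<lambda>_. borel)) (\<lambda>\<omega>. restrict (S N \<omega>) J)" for N J
  have D_Suc: "D (Suc N) J = D N J" if "\<And>q. q \<in> J \<Longrightarrow> fst q \<le> N" for N J
  proof -
    have "D N J = distr (distr (\<Omega> (Suc N)) (Pi\<^sub>M UNIV (\<lambda>_. borel)) ps) (Pi\<^sub>M J (\<lambda>_. borel)) (\<lambda>\<omega>. restrict (S N \<omega>) J)"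
      unfolding D_def ps_distr ..
    also have "\<dots> = distr (\<Omega> (Suc N)) (Pi\<^sub>M J (\<lambda>_. borel)) ((\<lambda>\<omega>. restrict (S N \<omega>) J) \<circ> ps)"
      using Sm[of N J N] by (intro distr_distr) (auto simp: measurable_cong_sets[OF s\<Omega> refl])
    also have "\<dots> = D (Suc N) J"
      unfolding D_def using Sps that by (intro distr_cong refl) (auto simp: restrict_def fun_eq_iff)
    finally show ?thesis ..
  qed
  have D_le: "D N' J = D N J" if "\<And>q. q \<in> J \<Longrightarrow> fst q \<le> N" "N \<le> N'" for N N' J
    using that(2)
  proof (induction N' rule: dec_induct)
    case (step M)
    have "D (Suc M) J = D M J" by (rule D_Suc) (use that(1) step(1) in \<open>auto intro: order_trans\<close>)
    then show ?case using step by simp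
  qed simp
  \<comment> \<open>The finest level occurring in \<open>J\<close>, with 0 inserted for the empty
    set. By \<open>D_le\<close> every finer level yields the same marginal law, so the marginals
    \<open>P J\<close> are consistent.\<close>
  define lev where "lev J = Max (insert 0 (fst ` J))" for J :: "(nat \<times> nat) set"
  have lev: "fst q \<le> lev J" if "finite J" "q \<in> J" for J q
    unfolding lev_def using that by (intro Max_ge) auto
  define P where "P J = D (lev J) J" for J
  have P_D: "P J = D N J" if "finite J" "\<And>q. q \<in> J \<Longrightarrow> fst q \<le> N" for J N
  proof -
    have "lev J \<le> N" unfolding lev_def using that by (subst Max_le_iff) auto
    then show ?thesis unfolding P_def using lev[OF that(1)] by (intro D_le[symmetric]) auto
  qed
  have pD: "prob_space (D N J)" for N J
    unfolding D_def by (rule prob_space.prob_space_distr[OF p\<Omega>]) simp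
  interpret K: polish_projective UNIV P
  proof (rule polish_projective.intro, rule projective_family.intro)
    fix J H :: "(nat \<times> nat) set" assume JH: "J \<subseteq> H" "finite H"
    have "distr (P H) (Pi\<^sub>M J (\<lambda>_. borel)) (\<lambda>f. restrict f J) =
       distr (\<Omega> (lev H)) (Pi\<^sub>M J (\<lambda>_. borel)) ((\<lambda>f. restrict f J) \<circ> (\<lambda>\<omega>. restrict (S (lev H) \<omega>) H))"
      unfolding P_def D_def using JH by (intro distr_distr measurable_restrict_subset) auto
    also have "\<dots> = D (lev H) J"
      unfolding D_def using JH by (intro distr_cong refl) (auto simp: restrict_def fun_eq_iff)
    also have "\<dots> = P J"
      using JH lev[OF JH(2)] by (intro P_D[symmetric]) (auto intro: finite_subset)
    finally show "P J = distr (P H) (Pi\<^sub>M J (\<lambda>_. borel)) (\<lambda>f. restrict f J)" ..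
  next
    fix J :: "(nat \<times> nat) set"
    show "prob_space (P J)" unfolding P_def by (rule pD)
  qed
  define N where "N = K.lim"
  have sN [measurable_cong]: "sets N = sets (Pi\<^sub>M UNIV (\<lambda>_. borel))" by (simp add: N_def)
  interpret N: prob_space N unfolding N_def by (rule K.P.prob_space_axioms)
  have coordN [measurable]: "(\<lambda>\<omega>. \<omega> q) \<in> borel_measurable N" for q
    using measurable_component_singleton[of q UNIV "\<lambda>_. borel :: 'h measure"] measurable_cong_sets[OF sN refl] by blast
  have rN [measurable]: "(\<lambda>\<omega>. restrict \<omega> J) \<in> measurable N (Pi\<^sub>M J (\<lambda>_. borel))" for J
    using measurable_restrict_subset[of J UNIV "\<lambda>_. borel :: 'h measure"] measurable_cong_sets[OF sN refl] by blast
  have dN: "distr N (Pi\<^sub>M J (\<lambda>_. borel)) (\<lambda>\<omega>. restrict \<omega> J) = D M J"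
    if J: "finite J" "\<And>q. q \<in> J \<Longrightarrow> fst q \<le> M" for J M
  proof (rule measure_eqI)
    show "sets (distr N (Pi\<^sub>M J (\<lambda>_. borel)) (\<lambda>\<omega>. restrict \<omega> J)) = sets (D M J)" by (simp add: D_def)
    fix A assume "A \<in> sets (distr N (Pi\<^sub>M J (\<lambda>_. borel)) (\<lambda>\<omega>. restrict \<omega> J))"
    then have A: "A \<in> sets (Pi\<^sub>M J (\<lambda>_. borel))" by simp
    have "emeasure (distr N (Pi\<^sub>M J (\<lambda>_. borel)) (\<lambda>\<omega>. restrict \<omega> J)) A = emeasure K.lim (K.emb UNIV J A)"
      unfolding emeasure_distr[OF rN A] by (simp add: N_def prod_emb_def space_PiM)
    also have "\<dots> = emeasure (P J) A" using A J by (intro K.emeasure_lim_emb) auto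
    finally show "emeasure (distr N (Pi\<^sub>M J (\<lambda>_. borel)) (\<lambda>\<omega>. restrict \<omega> J)) A = emeasure (D M J) A"
      using P_D[OF J] by simp
  qed
  \<comment> \<open>A relation that holds identically between two partial sums at a common level is
    passed to the extension through a two-coordinate marginal. It yields both the refinement
    property and the start at 0.\<close>
  have AE_coord: "AE \<omega> in N. R (\<omega> q) (\<omega> r)"
    if R: "{x \<in> space (Pi\<^sub>M {q, r} (\<lambda>_. borel)). R (x q) (x r)} \<in> sets (Pi\<^sub>M {q, r} (\<lambda>_. borel :: 'h measure))"
      and S: "\<And>\<omega>. R (S L \<omega> q) (S L \<omega> r)" and L: "fst q \<le> L" "fst r \<le> L" for R q r L
  proof -
    have "AE x in D L {q, r}. R (x q) (x r)"
      unfolding D_def by (subst AE_distr_iff) (use R S in auto)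
    then have "AE x in distr N (Pi\<^sub>M {q, r} (\<lambda>_. borel)) (\<lambda>\<omega>. restrict \<omega> {q, r}). R (x q) (x r)"
      using L by (subst dN) auto
    then have "AE \<omega> in N. R (restrict \<omega> {q, r} q) (restrict \<omega> {q, r} r)"
      by (rule AE_distrD[rotated]) measurable
    then show ?thesis by simp
  qed
  show thesis
  proof (rule that[of N])
    show "prob_space N" by unfold_locales
    show "sets N = sets (Pi\<^sub>M UNIV (\<lambda>_. borel))" by (rule sN)
    have "AE \<omega> in N. \<omega> (n, j) = \<omega> (Suc n, 2 * j)" for n j
      by (rule AE_coord[of "(n, j)" "(Suc n, 2 * j)" "(=)" "Suc n"]) (auto simp: S_def mult.commute)
    then show "AE \<omega> in N. \<forall>n j. \<omega> (n, j) = \<omega> (Suc n, 2 * j)" by (simp add: AE_all_countable)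
    have "AE \<omega> in N. \<omega> (n, 0) = 0" for n
      by (rule AE_coord[of "(n, 0)" "(n, 0)" "\<lambda>x y. x = 0" n]) (auto simp: S_def)
    then show "AE \<omega> in N. \<forall>n. \<omega> (n, 0) = 0" by (simp add: AE_all_countable)
    fix n m :: nat and j :: "nat \<Rightarrow> nat" and u :: "nat \<Rightarrow> 'h" assume j: "mono_on {..m} j"
    define J where "J = (\<lambda>k. (n, j k)) ` {..m}"
    have J: "finite J" "\<And>q. q \<in> J \<Longrightarrow> fst q \<le> n" by (auto simp: J_def)
    define F where "F x = (\<Sum>k<m. u k \<bullet> (x (n, j (Suc k)) - x (n, j k)))" for x :: "nat \<times> nat \<Rightarrow> 'h"
    have Fm [measurable]: "F \<in> borel_measurable (Pi\<^sub>M J (\<lambda>_. borel))"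
      unfolding F_def[abs_def]
    proof (intro borel_measurable_sum borel_measurable_inner borel_measurable_const borel_measurable_diff)
      fix k assume "k \<in> {..<m}"
      then have "(n, j (Suc k)) \<in> J" "(n, j k) \<in> J" by (auto simp: J_def)
      then show "(\<lambda>x. x (n, j (Suc k))) \<in> borel_measurable (Pi\<^sub>M J (\<lambda>_. borel :: 'h measure))"
        "(\<lambda>x. x (n, j k)) \<in> borel_measurable (Pi\<^sub>M J (\<lambda>_. borel :: 'h measure))"
        by (auto intro: measurable_component_singleton)
    qed
    have Fr: "F (restrict x J) = F x" for x
      unfolding F_def by (intro sum.cong refl) (auto simp: J_def)
    obtain c where c: "\<And>\<omega>. (\<Sum>k<m. u k \<bullet> ((\<Sum>i<j (Suc k). \<omega> i) - (\<Sum>i<j k. \<omega> i))) = (\<Sum>i=j 0..<j m. c i \<bullet> \<omega> i)"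
      "(\<Prod>i=j 0..<j m. exp (\<psi> (c i) / 2 ^ n)) = (\<Prod>k<m. exp (\<psi> (u k) / 2 ^ n) ^ (j (Suc k) - j k))"
      using block_sums[OF j, of u "\<lambda>u. exp (\<psi> u / 2 ^ n)"] by blast
    have "(CLINT \<omega>|N. iexp (F \<omega>)) = (CLINT x|distr N (Pi\<^sub>M J (\<lambda>_. borel)) (\<lambda>\<omega>. restrict \<omega> J). iexp (F x))"
      by (subst integral_distr) (auto simp: Fr)
    also have "\<dots> = (CLINT \<omega>|\<Omega> n. iexp (F (restrict (S n \<omega>) J)))"
    proof -
      have "distr N (Pi\<^sub>M J (\<lambda>_. borel)) (\<lambda>\<omega>. restrict \<omega> J) = distr (\<Omega> n) (Pi\<^sub>M J (\<lambda>_. borel)) (\<lambda>\<omega>. restrict (S n \<omega>) J)"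
        using dN[OF J] by (simp only: D_def)
      moreover have "(CLINT x|distr (\<Omega> n) (Pi\<^sub>M J (\<lambda>_. borel)) (\<lambda>\<omega>. restrict (S n \<omega>) J). iexp (F x)) =
          (CLINT \<omega>|\<Omega> n. iexp (F (restrict (S n \<omega>) J)))"
        by (rule integral_distr) auto
      ultimately show ?thesis by (simp only:)
    qed
    also have "\<dots> = (CLINT \<omega>|\<Omega> n. iexp (\<Sum>i=j 0..<j m. c i \<bullet> \<omega> i))"
      unfolding Fr c(1)[symmetric] by (simp add: S_def F_def)
    also have "\<dots> = (\<Prod>k<m. exp (\<psi> (u k) / 2 ^ n) ^ (j (Suc k) - j k))"
      by (subst char\<Omega>) (simp_all only: c(2) finite_atLeastLessThan)
    also have "\<dots> = (\<Prod>k<m. exp (of_nat (j (Suc k) - j k) * \<psi> (u k) / 2 ^ n))"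
      by (simp add: exp_of_nat_mult[symmetric])
    finally show "(CLINT \<omega>|N. iexp (\<Sum>k<m. u k \<bullet> (\<omega> (n, j (Suc k)) - \<omega> (n, j k)))) = (\<Prod>k<m. exp (of_nat (j (Suc k) - j k) * \<psi> (u k) / 2 ^ n))"
      unfolding F_def .
  qed
qed

section \<open>From dyadic values to Levy processes in continuous time\<close>

lemma (in prob_space) iexp_dominated_convergence:
  assumes "\<And>n. f n \<in> borel_measurable M" "g \<in> borel_measurable M" "AE x in M. (\<lambda>n. f n x) \<longlonglongrightarrow> g x"
  shows "(\<lambda>n. CLINT x|M. iexp (f n x)) \<longlonglongrightarrow> (CLINT x|M. iexp (g x))"
proof (rule integral_dominated_convergence[where w="\<lambda>_. 1"])
  show "AE x in M. (\<lambda>n. iexp (f n x)) \<longlonglongrightarrow> iexp (g x)"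
    using assms(3) by eventually_elim (intro tendsto_intros)
qed (use assms in auto)

lemma distr_eqI_char:
  fixes X :: "'w \<Rightarrow> 'h::{real_inner, second_countable_topology}"
  assumes "prob_space M" and X: "X \<in> borel_measurable M" and "prob_space K" "sets K = sets borel"
    and cf: "\<And>u. (CLINT \<omega>|M. iexp (u \<bullet> X \<omega>)) = (CLINT x|K. iexp (u \<bullet> x))"
  shows "distr M borel X = K"
proof (rule measure_eqI_char)
  show "finite_measure (distr M borel X)"
    using prob_space.prob_space_distr[OF assms(1) X] by (rule prob_space.finite_measure)
  show "finite_measure K" using assms(3) by (rule prob_space.finite_measure)
  show "(CLINT x|distr M borel X. iexp (u \<bullet> x)) = (CLINT x|K. iexp (u \<bullet> x))" for u
    unfolding cf[symmetric] using X by (intro integral_distr) auto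
qed (use assms in auto)

lemma distr_eqI_char2:
  fixes X :: "'w \<Rightarrow> 'h::{real_inner, second_countable_topology}" and Y :: "'v \<Rightarrow> 'h"
  assumes "prob_space M" and X: "X \<in> borel_measurable M" and N: "prob_space N" and Y: "Y \<in> borel_measurable N"
    and cf: "\<And>u. (CLINT \<omega>|M. iexp (u \<bullet> X \<omega>)) = (CLINT \<omega>|N. iexp (u \<bullet> Y \<omega>))"
  shows "distr M borel X = distr N borel Y"
proof (rule distr_eqI_char)
  show "prob_space (distr N borel Y)" using N Y by (rule prob_space.prob_space_distr)
  show "(CLINT \<omega>|M. iexp (u \<bullet> X \<omega>)) = (CLINT x|distr N borel Y. iexp (u \<bullet> x))" for u
    unfolding cf using Y by (intro integral_distr[symmetric]) auto
qed (use assms in auto)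

text \<open>The joint formula contains everything: for \<open>m = 1\<close> it gives the law of one
  increment, hence stationarity, and its product form is independence. At time 0 the characteristic
  function is constantly 1, so the law there is the point mass at 0.\<close>

lemma levy_process_charI:
  fixes X :: "real \<Rightarrow> 'w \<Rightarrow> 'h::{real_inner, second_countable_topology}"
  assumes p: "prob_space M" and m: "\<And>t. 0 \<le> t \<Longrightarrow> X t \<in> borel_measurable M"
    and cf: "\<And>m t u. 0 \<le> t 0 \<Longrightarrow> mono_on {..m} t \<Longrightarrow>
      (CLINT \<omega>|M. iexp (\<Sum>k<m. u k \<bullet> (X (t (Suc k)) \<omega> - X (t k) \<omega>))) =
      (\<Prod>k<m. exp (complex_of_real (t (Suc k) - t k) * \<psi> (u k)))"
    and cf1: "\<And>t u. 0 \<le> t \<Longrightarrow> (CLINT \<omega>|M. iexp (u \<bullet> X t \<omega>)) = exp (complex_of_real t * \<psi> u)"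
    and cad: "AE \<omega> in M. cadlag (\<lambda>t. X t \<omega>)"
  shows "levy_process M X" "levy_exponent M X \<psi>"
proof -
  interpret prob_space M by (rule p)
  show "levy_exponent M X \<psi>" unfolding levy_exponent_def using cf1 by blast
  have inc: "(CLINT \<omega>|M. iexp (u \<bullet> (X t \<omega> - X s \<omega>))) = exp (complex_of_real (t - s) * \<psi> u)"
    if "0 \<le> s" "s \<le> t" for s t u
    using cf[of "\<lambda>k. if k = 0 then s else t" 1 "\<lambda>_. u"] that by (auto simp: mono_on_def)
  show "levy_process M X"
    unfolding levy_process_def
  proof (intro conjI allI impI)
    show "AE \<omega> in M. X 0 \<omega> = 0"
    proof -
      have "distr M borel (X 0) = return borel 0"
        by (rule distr_eqI_char) (use m p cf1[of 0] in \<open>auto intro: prob_space_return simp: integral_return\<close>)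
      then have "AE x in distr M borel (X 0). x = 0"
        by (simp only:) (simp add: AE_return)
      then show ?thesis using m[of 0] by (intro AE_distrD[of "X 0" M borel]) auto
    qed
    show "indep_vars (\<lambda>_. borel) (\<lambda>k \<omega>. X (t (Suc k)) \<omega> - X (t k) \<omega>) {..<n}"
      if t: "0 \<le> t 0 \<and> mono_on {..n} t" for n :: nat and t :: "nat \<Rightarrow> real"
    proof (rule indep_vars_char)
      have le: "0 \<le> t k" "t k \<le> t (Suc k)" if "k < n" for k
        using t that mono_onD[of "{..n}" t 0 k] mono_onD[of "{..n}" t k "Suc k"] by auto
      show "(\<lambda>\<omega>. X (t (Suc k)) \<omega> - X (t k) \<omega>) \<in> borel_measurable M" if "k \<in> {..<n}" for k
        using le[of k] that by (intro borel_measurable_diff m) auto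
      show "(CLINT \<omega>|M. iexp (\<Sum>k<n. u k \<bullet> (X (t (Suc k)) \<omega> - X (t k) \<omega>))) =
        (\<Prod>k<n. CLINT \<omega>|M. iexp (u k \<bullet> (X (t (Suc k)) \<omega> - X (t k) \<omega>)))" for u
        using t le by (subst cf) (auto intro!: prod.cong simp only: inc lessThan_iff)
    qed simp
    show "distr M borel (\<lambda>\<omega>. X t \<omega> - X s \<omega>) = distr M borel (X (t - s))" if "0 \<le> s \<and> s \<le> t" for s t
      using that by (intro distr_eqI_char2 p borel_measurable_diff m) (auto simp only: inc cf1)
  qed (use p m cad in auto)
qed

text \<open>The successor selects the grid point to the right of \<open>t\<close>, at distance at
  most \<open>1 / 2 ^ n\<close>. Approximation from the right is what makes the limit of monotone
  step functions right-continuous.\<close>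

lemma dyadic_upper_tendsto:
  assumes "0 \<le> (t::real)"
  shows "(\<lambda>n. real (Suc (nat \<lfloor>2 ^ n * t\<rfloor>)) / 2 ^ n) \<longlonglongrightarrow> t"
proof (rule tendsto_sandwich)
  have nn: "real (Suc (nat \<lfloor>2 ^ n * t\<rfloor>)) = real_of_int \<lfloor>2 ^ n * t\<rfloor> + 1" for n
    using assms by (simp add: )
  show "\<forall>\<^sub>F n in sequentially. t \<le> real (Suc (nat \<lfloor>2 ^ n * t\<rfloor>)) / 2 ^ n"
  proof (rule always_eventually, rule allI)
    fix n
    have "2 ^ n * t \<le> real_of_int \<lfloor>2 ^ n * t\<rfloor> + 1" by linarith
    then show "t \<le> real (Suc (nat \<lfloor>2 ^ n * t\<rfloor>)) / 2 ^ n" unfolding nn by (simp add: field_simps)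
  qed
  show "\<forall>\<^sub>F n in sequentially. real (Suc (nat \<lfloor>2 ^ n * t\<rfloor>)) / 2 ^ n \<le> t + (1/2) ^ n"
  proof (rule always_eventually, rule allI)
    fix n
    have "real_of_int \<lfloor>2 ^ n * t\<rfloor> + 1 \<le> 2 ^ n * t + 1" by linarith
    then have "(real_of_int \<lfloor>2 ^ n * t\<rfloor> + 1) / 2 ^ n \<le> (2 ^ n * t + 1) / 2 ^ n"
      by (rule divide_right_mono) simp
    also have "\<dots> = t + (1/2) ^ n" by (simp add: field_simps)
    finally show "real (Suc (nat \<lfloor>2 ^ n * t\<rfloor>)) / 2 ^ n \<le> t + (1/2) ^ n" unfolding nn .
  qed
  have "(\<lambda>n. t + (1/2) ^ n) \<longlonglongrightarrow> t + 0" by (intro tendsto_intros LIMSEQ_power_zero) simp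
  then show "(\<lambda>n. t + (1/2) ^ n) \<longlonglongrightarrow> t" by simp
qed simp

text \<open>Common ground of the Brownian motion and the gamma process, which differ only in the
  reason why the values at the right grid points converge.\<close>

locale dyadic_process = prob_space N
  for N :: "(nat \<times> nat \<Rightarrow> 'h::{real_inner, second_countable_topology}) measure" and \<psi> :: "'h \<Rightarrow> complex" +
  assumes sets_N: "sets N = sets (Pi\<^sub>M UNIV (\<lambda>_. borel))"
    and refine: "AE \<omega> in N. \<forall>n j. \<omega> (n, j) = \<omega> (Suc n, 2 * j)"
    and start: "AE \<omega> in N. \<forall>n. \<omega> (n, 0) = 0"
    and char_increments: "\<And>n m j u. mono_on {..m} j \<Longrightarrow>
      (CLINT \<omega>|N. iexp (\<Sum>k<m. u k \<bullet> (\<omega> (n, j (Suc k)) - \<omega> (n, j k)))) =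
      (\<Prod>k<m. exp (of_nat (j (Suc k) - j k) * \<psi> (u k) / 2 ^ n))"
begin

lemma coord_measurable [measurable]: "(\<lambda>\<omega>. \<omega> q) \<in> borel_measurable N"
  using measurable_component_singleton[of q UNIV "\<lambda>_. borel :: 'h measure"] measurable_cong_sets[OF sets_N refl] by blast

lemma increment_char:
  "(CLINT \<omega>|N. iexp (u \<bullet> (\<omega> (n, Suc j) - \<omega> (n, j)))) = exp (\<psi> u / 2 ^ n)"
  using char_increments[of 1 "\<lambda>k. j + k" "\<lambda>_. u" n] by (simp add: mono_on_def)

text \<open>Almost sure convergence at each fixed time is enough, since only finitely many times
  occur at once. The exponentials are bounded by 1, and the lengths of the grid intervals converge
  to those of the given ones.\<close>

lemma limit_char:
  assumes m: "\<And>t. 0 \<le> t \<Longrightarrow> X t \<in> borel_measurable N"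
    and lim: "\<And>t. 0 \<le> t \<Longrightarrow> AE \<omega> in N. (\<lambda>n. \<omega> (n, Suc (nat \<lfloor>2 ^ n * t\<rfloor>))) \<longlonglongrightarrow> X t \<omega>"
  shows "0 \<le> t 0 \<Longrightarrow> mono_on {..m} t \<Longrightarrow>
      (CLINT \<omega>|N. iexp (\<Sum>k<m. u k \<bullet> (X (t (Suc k)) \<omega> - X (t k) \<omega>))) =
      (\<Prod>k<m. exp (complex_of_real (t (Suc k) - t k) * \<psi> (u k)))"
    and "0 \<le> s \<Longrightarrow> (CLINT \<omega>|N. iexp (v \<bullet> X s \<omega>)) = exp (complex_of_real s * \<psi> v)"
proof -
  define d where "d n t = Suc (nat \<lfloor>2 ^ n * t\<rfloor>)" for n and t :: real
  have d_mono: "d n s \<le> d n t" if "s \<le> t" for n s t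
    unfolding d_def using that by (intro Suc_leI le_imp_less_Suc nat_mono floor_mono mult_left_mono) auto
  have d_lim: "(\<lambda>n. real (d n t) / 2 ^ n) \<longlonglongrightarrow> t" if "0 \<le> t" for t
    unfolding d_def using that by (rule dyadic_upper_tendsto)
  show "(CLINT \<omega>|N. iexp (\<Sum>k<m. u k \<bullet> (X (t (Suc k)) \<omega> - X (t k) \<omega>))) =
      (\<Prod>k<m. exp (complex_of_real (t (Suc k) - t k) * \<psi> (u k)))" if t: "0 \<le> t 0" "mono_on {..m} t"
  proof (rule LIMSEQ_unique)
    have t0: "0 \<le> t k" if "k \<le> m" for k using t mono_onD[OF t(2), of 0 k] that by auto
    show "(\<lambda>n. CLINT \<omega>|N. iexp (\<Sum>k<m. u k \<bullet> (\<omega> (n, d n (t (Suc k))) - \<omega> (n, d n (t k))))) \<longlonglongrightarrow>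
      (CLINT \<omega>|N. iexp (\<Sum>k<m. u k \<bullet> (X (t (Suc k)) \<omega> - X (t k) \<omega>)))"
    proof (rule iexp_dominated_convergence)
      show "(\<lambda>\<omega>. \<Sum>k<m. u k \<bullet> (X (t (Suc k)) \<omega> - X (t k) \<omega>)) \<in> borel_measurable N"
        using t0 by (intro borel_measurable_sum borel_measurable_inner borel_measurable_const borel_measurable_diff m) auto
      have "AE \<omega> in N. \<forall>k\<in>{..m}. (\<lambda>n. \<omega> (n, d n (t k))) \<longlonglongrightarrow> X (t k) \<omega>"
        unfolding d_def using t0 by (intro AE_finite_allI lim) auto
      then show "AE \<omega> in N. (\<lambda>n. \<Sum>k<m. u k \<bullet> (\<omega> (n, d n (t (Suc k))) - \<omega> (n, d n (t k)))) \<longlonglongrightarrow>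
        (\<Sum>k<m. u k \<bullet> (X (t (Suc k)) \<omega> - X (t k) \<omega>))"
        by eventually_elim (intro tendsto_intros, auto)
    qed measurable
    have "(CLINT \<omega>|N. iexp (\<Sum>k<m. u k \<bullet> (\<omega> (n, d n (t (Suc k))) - \<omega> (n, d n (t k))))) =
      (\<Prod>k<m. exp (complex_of_real (real (d n (t (Suc k))) / 2 ^ n - real (d n (t k)) / 2 ^ n) * \<psi> (u k)))" for n
    proof -
      have "mono_on {..m} (\<lambda>k. d n (t k))"
        using t(2) by (auto intro!: mono_onI d_mono dest: mono_onD)
      then have "(CLINT \<omega>|N. iexp (\<Sum>k<m. u k \<bullet> (\<omega> (n, d n (t (Suc k))) - \<omega> (n, d n (t k))))) =
        (\<Prod>k<m. exp (of_nat (d n (t (Suc k)) - d n (t k)) * \<psi> (u k) / 2 ^ n))"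
        by (rule char_increments)
      also have "\<dots> = (\<Prod>k<m. exp (complex_of_real (real (d n (t (Suc k))) / 2 ^ n - real (d n (t k)) / 2 ^ n) * \<psi> (u k)))"
      proof (intro prod.cong refl)
        fix k assume "k \<in> {..<m}"
        then have "d n (t k) \<le> d n (t (Suc k))" using mono_onD[OF t(2), of k "Suc k"] by (auto intro: d_mono)
        then show "exp (of_nat (d n (t (Suc k)) - d n (t k)) * \<psi> (u k) / 2 ^ n) =
          exp (complex_of_real (real (d n (t (Suc k))) / 2 ^ n - real (d n (t k)) / 2 ^ n) * \<psi> (u k))"
          by (intro arg_cong[where f=exp]) (simp add: of_nat_diff field_simps)
      qed
      finally show ?thesis .
    qed
    then show "(\<lambda>n. CLINT \<omega>|N. iexp (\<Sum>k<m. u k \<bullet> (\<omega> (n, d n (t (Suc k))) - \<omega> (n, d n (t k))))) \<longlonglongrightarrow>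
       (\<Prod>k<m. exp (complex_of_real (t (Suc k) - t k) * \<psi> (u k)))"
      using t0 by (simp only:) (intro tendsto_intros d_lim, auto)
  qed
  show "(CLINT \<omega>|N. iexp (v \<bullet> X s \<omega>)) = exp (complex_of_real s * \<psi> v)" if s: "0 \<le> s"
  proof (rule LIMSEQ_unique)
    show "(\<lambda>n. CLINT \<omega>|N. iexp (v \<bullet> \<omega> (n, d n s))) \<longlonglongrightarrow> (CLINT \<omega>|N. iexp (v \<bullet> X s \<omega>))"
    proof (rule iexp_dominated_convergence)
      show "(\<lambda>\<omega>. v \<bullet> X s \<omega>) \<in> borel_measurable N" using m[OF s] by simp
      show "AE \<omega> in N. (\<lambda>n. v \<bullet> \<omega> (n, d n s)) \<longlonglongrightarrow> v \<bullet> X s \<omega>"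
        using lim[OF s] by eventually_elim (auto intro!: tendsto_intros simp: d_def)
    qed measurable
    have "(CLINT \<omega>|N. iexp (v \<bullet> \<omega> (n, d n s))) = exp (complex_of_real (real (d n s) / 2 ^ n) * \<psi> v)" for n
    proof -
      have "(CLINT \<omega>|N. iexp (v \<bullet> \<omega> (n, d n s))) = (CLINT \<omega>|N. iexp (v \<bullet> (\<omega> (n, d n s) - \<omega> (n, 0))))"
      proof (rule integral_cong_AE)
        show "AE \<omega> in N. iexp (v \<bullet> \<omega> (n, d n s)) = iexp (v \<bullet> (\<omega> (n, d n s) - \<omega> (n, 0)))"
          using start by eventually_elim simp
      qed measurable
      also have "\<dots> = exp (of_nat (d n s) * \<psi> v / 2 ^ n)"
        using char_increments[of 1 "\<lambda>k. if k = 0 then 0 else d n s" "\<lambda>_. v" n] by (simp add: mono_on_def)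
      finally show ?thesis by (simp add: field_simps)
    qed
    then show "(\<lambda>n. CLINT \<omega>|N. iexp (v \<bullet> \<omega> (n, d n s))) \<longlonglongrightarrow> exp (complex_of_real s * \<psi> v)"
      using s by (simp only:) (intro tendsto_intros d_lim)
  qed
qed

end

section \<open>The gamma process\<close>

lemma mono_left_limit:
  fixes g :: "real \<Rightarrow> real"
  assumes mono: "\<And>s t. 0 \<le> s \<Longrightarrow> s \<le> t \<Longrightarrow> g s \<le> g t" and t: "0 < t"
  shows "(g \<longlongrightarrow> (SUP s\<in>{0..<t}. g s)) (at_left t)"
proof (rule order_tendstoI)
  have bdd: "bdd_above (g ` {0..<t})" using mono by (auto intro!: bdd_aboveI2[where M="g t"])
  have ne: "{0..<t} \<noteq> {}" using t by auto
  fix a assume "a < (SUP s\<in>{0..<t}. g s)"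
  then obtain s0 where s0: "s0 \<in> {0..<t}" "a < g s0" using less_cSUP_iff[OF ne bdd] by auto
  have "a < g s" if "s0 < s" "s < t" for s using mono[of s0 s] s0 that by auto
  then show "\<forall>\<^sub>F s in at_left t. a < g s"
    using eventually_at_left_real[of s0 t] s0 by (auto elim: eventually_mono)
next
  have bdd: "bdd_above (g ` {0..<t})" using mono by (auto intro!: bdd_aboveI2[where M="g t"])
  fix b assume b: "(SUP s\<in>{0..<t}. g s) < b"
  have "g s < b" if "0 < s" "s < t" for s
    using cSUP_upper[OF _ bdd, of s] that b by auto
  then show "\<forall>\<^sub>F s in at_left t. g s < b"
    using eventually_at_left_real[OF t] by (auto elim: eventually_mono)
qed

theorem gamma_process_exists:
  assumes \<alpha>: "0 < \<alpha>"
  obtains N :: "(nat \<times> nat \<Rightarrow> real) measure" and G where "gamma_process \<alpha> 1 N G"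
    "sets N = sets (Pi\<^sub>M UNIV (\<lambda>_. borel))"
    "\<And>\<omega> s t. 0 \<le> s \<Longrightarrow> s \<le> t \<Longrightarrow> G s \<omega> \<le> G t \<omega>" "\<And>\<omega> t. 0 \<le> t \<Longrightarrow> 0 \<le> G t \<omega>"
    "\<And>\<omega>. cadlag (\<lambda>t. G t \<omega>)"
proof -
  define \<psi> where "\<psi> u = - complex_of_real \<alpha> * Ln (1 - \<i> * complex_of_real u)" for u
  have cfg: "(CLINT x|gamma_law s. iexp (u * x)) = exp (- complex_of_real s * Ln (1 - \<i> * complex_of_real u))" if "0 < s" for s u
    using gamma_law_laplace[OF that, of "- \<i> * complex_of_real u"] by (simp add: mult.assoc)
  have pos: "0 < \<alpha> / 2 ^ n" for n :: nat using \<alpha> by simp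
  have cf: "(CLINT x|gamma_law (\<alpha> / 2 ^ n). iexp (u \<bullet> x)) = exp (\<psi> u / 2 ^ n)" for n u
    using cfg[OF pos, of n u] by (simp add: \<psi>_def)
  obtain N :: "(nat \<times> nat \<Rightarrow> real) measure" where N: "prob_space N" "sets N = sets (Pi\<^sub>M UNIV (\<lambda>_. borel))"
    "AE \<omega> in N. \<forall>n j. \<omega> (n, j) = \<omega> (Suc n, 2 * j)" "AE \<omega> in N. \<forall>n. \<omega> (n, 0) = 0"
    "\<And>n m j u. mono_on {..m} j \<Longrightarrow>
      (CLINT \<omega>|N. iexp (\<Sum>k<m. u k \<bullet> (\<omega> (n, j (Suc k)) - \<omega> (n, j k)))) =
      (\<Prod>k<m. exp (of_nat (j (Suc k) - j k) * \<psi> (u k) / 2 ^ n))"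
    using dyadic_process_exists[of "\<lambda>n. gamma_law (\<alpha> / 2 ^ n)" \<psi>, OF prob_space_gamma_law[OF pos] sets_gamma_law cf] by blast
  interpret dyadic_process N \<psi>
    using N by (intro dyadic_process.intro dyadic_process_axioms.intro) auto
  have inc_pos: "AE \<omega> in N. \<omega> (n, j) \<le> \<omega> (n, Suc j)" for n j
  proof -
    have "distr N borel (\<lambda>\<omega>. \<omega> (n, Suc j) - \<omega> (n, j)) = gamma_law (\<alpha> / 2 ^ n)"
      by (rule distr_eqI_char[OF N(1) _ prob_space_gamma_law[OF pos]]) (auto simp only: increment_char cf sets_gamma_law intro!: borel_measurable_diff coord_measurable)
    then have "AE x in distr N borel (\<lambda>\<omega>. \<omega> (n, Suc j) - \<omega> (n, j)). 0 < x"
      by (simp only:) (rule gamma_law_pos)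
    then have "AE \<omega> in N. 0 < \<omega> (n, Suc j) - \<omega> (n, j)"
      by (rule AE_distrD[rotated]) simp
    then show ?thesis by eventually_elim simp
  qed
  \<comment> \<open>Off this event of full measure the approximations are set to 0. Monotonicity and
    path regularity then hold for every \<open>\<omega>\<close>, as subordination will
    require.\<close>
  define A where "A \<omega> \<longleftrightarrow> (\<forall>n j. \<omega> (n, j) \<le> \<omega> (n, Suc j)) \<and> (\<forall>n j. \<omega> (n, j) = \<omega> (Suc n, 2 * j)) \<and> (\<forall>n. \<omega> (n, 0) = 0)"
    for \<omega> :: "nat \<times> nat \<Rightarrow> real"
  have AE_A: "AE \<omega> in N. A \<omega>"
    unfolding A_def using refine start inc_pos by (simp add: AE_all_countable)
  have Am [measurable]: "Measurable.pred N A"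
  proof -
    have [measurable]: "Measurable.pred N (\<lambda>\<omega>. \<omega> q \<le> \<omega> r)" "Measurable.pred N (\<lambda>\<omega>. \<omega> q = \<omega> r)"
      "Measurable.pred N (\<lambda>\<omega>. \<omega> q = 0)" for q r
      unfolding pred_def by (intro borel_measurable_le borel_measurable_eq coord_measurable borel_measurable_const)+
    show ?thesis unfolding A_def[abs_def] by measurable
  qed
  define d where "d n t \<omega> = (if A \<omega> then \<omega> (n, Suc (nat \<lfloor>2 ^ n * t\<rfloor>)) else 0)" for n and t :: real and \<omega> :: "nat \<times> nat \<Rightarrow> real"
  have [measurable]: "d n t \<in> borel_measurable N" for n t unfolding d_def[abs_def] by measurable
  have A_mono: "\<omega> (n, i) \<le> \<omega> (n, j)" if "A \<omega>" "i \<le> j" for \<omega> n i j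
    using that(2) by (induction j rule: dec_induct) (use that(1) in \<open>auto simp: A_def intro: order_trans\<close>)
  have d0: "0 \<le> d n t \<omega>" for n t \<omega>
  proof (cases "A \<omega>")
    case True
    then have "\<omega> (n, 0) = 0" by (simp add: A_def)
    then show ?thesis using A_mono[OF True, of 0 "Suc (nat \<lfloor>2 ^ n * t\<rfloor>)" n] True by (simp add: d_def)
  qed (simp add: d_def)
  have d_mono: "d n s \<omega> \<le> d n t \<omega>" if "s \<le> t" for n s t \<omega>
    unfolding d_def using that A_mono by (auto intro!: A_mono nat_mono floor_mono mult_left_mono)
  \<comment> \<open>Refinement moves the right grid point to the left or leaves it in place. For
    monotone grid values the approximations therefore decrease, and their limit exists without any
    moment estimate.\<close>
  have d_dec: "decseq (\<lambda>n. d n t \<omega>)" if "0 \<le> t" for t \<omega>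
  proof (rule decseq_SucI)
    fix n
    show "d (Suc n) t \<omega> \<le> d n t \<omega>"
    proof (cases "A \<omega>")
      case True
      define x where "x = 2 ^ n * t"
      have "0 \<le> x" using that by (simp add: x_def)
      then have "nat \<lfloor>2 * x\<rfloor> \<le> Suc (2 * nat \<lfloor>x\<rfloor>)" by linarith
      then have "\<omega> (Suc n, Suc (nat \<lfloor>2 * x\<rfloor>)) \<le> \<omega> (Suc n, 2 * Suc (nat \<lfloor>x\<rfloor>))" by (intro A_mono[OF True]) simp
      also have "\<dots> = \<omega> (n, Suc (nat \<lfloor>x\<rfloor>))" using True unfolding A_def by metis
      finally show ?thesis using True by (simp add: d_def x_def mult.assoc)
    qed (simp add: d_def)
  qed
  define G where "G t \<omega> = lim (\<lambda>n. d n t \<omega>)" for t \<omega>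
  have lim: "(\<lambda>n. d n t \<omega>) \<longlonglongrightarrow> G t \<omega>" if "0 \<le> t" for t \<omega>
  proof -
    have "\<forall>n. 0 \<le> d n t \<omega>" using d0 by blast
    from decseq_convergent[OF d_dec[OF that] this] have "convergent (\<lambda>n. d n t \<omega>)"
      unfolding convergent_def by blast
    then show ?thesis by (simp add: G_def convergent_LIMSEQ_iff)
  qed
  have [measurable]: "G t \<in> borel_measurable N" for t
    unfolding G_def[abs_def] by (rule borel_measurable_lim_metric) simp
  have G_le: "G t \<omega> \<le> d n t \<omega>" if "0 \<le> t" for n t \<omega>
    using decseq_ge[OF d_dec[OF that] lim[OF that]] .
  have G_mono: "G s \<omega> \<le> G t \<omega>" if "0 \<le> s" "s \<le> t" for s t \<omega>
    using that d_mono by (intro LIMSEQ_le[OF lim lim]) auto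
  have G_pos: "0 \<le> G t \<omega>" if "0 \<le> t" for t \<omega>
    using d0 by (intro LIMSEQ_le_const[OF lim[OF that]]) auto
  have G_cad: "cadlag (\<lambda>t. G t \<omega>)" for \<omega>
    unfolding cadlag_def
  proof (intro conjI allI impI)
    fix t :: real assume t: "0 \<le> t"
    show "((\<lambda>s. G s \<omega>) \<longlongrightarrow> G t \<omega>) (at_right t)"
    proof (rule order_tendstoI)
      fix a assume a: "a < G t \<omega>"
      have "a < G s \<omega>" if "t < s" for s using a G_mono[OF t, of s \<omega>] that by simp
      then show "\<forall>\<^sub>F s in at_right t. a < G s \<omega>"
        using eventually_at_right_less[of t] by (rule eventually_mono[rotated])
    next
      fix b assume b: "G t \<omega> < b"
      obtain n where n: "d n t \<omega> < b" using order_tendstoD(2)[OF lim[OF t] b] by (auto simp: eventually_sequentially)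
      \<comment> \<open>The right grid point of \<open>t\<close> at level \<open>n\<close>. The step
        function \<open>d n\<close> is constant from \<open>t\<close> up to \<open>T\<close>, so its
        bound at \<open>t\<close> persists there and bounds \<open>G\<close> from above.\<close>
      define T where "T = (real_of_int \<lfloor>2 ^ n * t\<rfloor> + 1) / 2 ^ n"
      have "2 ^ n * t < real_of_int \<lfloor>2 ^ n * t\<rfloor> + 1" by linarith
      then have T: "t < T" unfolding T_def by (simp add: pos_less_divide_eq mult.commute)
      have "G s \<omega> < b" if s: "t < s" "s < T" for s
      proof -
        have "2 ^ n * s < real_of_int \<lfloor>2 ^ n * t\<rfloor> + 1" using s(2) by (simp add: T_def field_simps)
        moreover have "2 ^ n * t \<le> 2 ^ n * s" using s(1) by simp
        ultimately have "\<lfloor>2 ^ n * s\<rfloor> = \<lfloor>2 ^ n * t\<rfloor>" by linarith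
        then have "d n s \<omega> = d n t \<omega>" by (simp add: d_def)
        then show ?thesis using G_le[of s \<omega> n] n s t by simp
      qed
      then show "\<forall>\<^sub>F s in at_right t. G s \<omega> < b"
        using eventually_at_right_real[OF T] by (rule eventually_mono[rotated]) auto
    qed
  next
    fix t :: real assume t: "0 < t"
    show "\<exists>l. ((\<lambda>s. G s \<omega>) \<longlongrightarrow> l) (at_left t)"
      using mono_left_limit[of "\<lambda>s. G s \<omega>", OF G_mono t] by blast
  qed
  have AElim: "AE \<omega> in N. (\<lambda>n. \<omega> (n, Suc (nat \<lfloor>2 ^ n * t\<rfloor>))) \<longlonglongrightarrow> G t \<omega>" if "0 \<le> t" for t
    using AE_A
  proof eventually_elim
    case (elim \<omega>)
    then show ?case using lim[OF that, of \<omega>] by (simp add: d_def)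
  qed
  note lc = limit_char[of G, OF _ AElim]
  have levy: "levy_process N G" "levy_exponent N G \<psi>"
    by (rule levy_process_charI[where \<psi>=\<psi>]; (intro N lc AE_I2 G_cad)?; simp)+
  have "distributed N lborel (G t) (\<lambda>x. ennreal (gamma_density (\<alpha> * t) 1 x))" if t: "0 < t" for t
  proof -
    have at: "0 < \<alpha> * t" using \<alpha> t by simp
    have "distr N borel (G t) = gamma_law (\<alpha> * t)"
    proof (rule distr_eqI_char)
      show "(CLINT \<omega>|N. iexp (u \<bullet> G t \<omega>)) = (CLINT x|gamma_law (\<alpha> * t). iexp (u \<bullet> x))" for u
        using lc(2)[of t u] t cfg[OF at, of u] by (simp add: \<psi>_def mult_ac)
    qed (use N at prob_space_gamma_law in auto)
    moreover have "distr N lborel (G t) = distr N borel (G t)" by (rule distr_cong) auto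
    ultimately show ?thesis by (simp add: distributed_def gamma_law_def)
  qed
  then have gp: "gamma_process \<alpha> 1 N G" unfolding gamma_process_def using \<alpha> levy by simp
  show thesis by (rule that[OF gp N(2) G_mono G_pos G_cad])
qed

section \<open>Brownian motion in a Hilbert space\<close>

lemma suminf_tail_tendsto_0:
  fixes f :: "nat \<Rightarrow> real"
  assumes "summable f"
  shows "(\<lambda>n. \<Sum>i. f (i + n)) \<longlonglongrightarrow> 0"
proof (rule metric_LIMSEQ_I)
  fix r :: real assume "0 < r"
  from suminf_exist_split[OF this assms] show "\<exists>N. \<forall>n\<ge>N. dist (\<Sum>i. f (i + n)) 0 < r"
    by (simp add: dist_norm)
qed

lemma continuous_on_cadlag:
  fixes f :: "real \<Rightarrow> 'b::topological_space"
  assumes f: "continuous_on {0..} f"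
  shows "cadlag f"
  unfolding cadlag_def
proof (intro conjI allI impI)
  have lim: "(f \<longlongrightarrow> f t) (at t within {0..})" if "0 \<le> t" for t
    using f that by (auto simp: continuous_on_def)
  show "(f \<longlongrightarrow> f t) (at_right t)" if "0 \<le> t" for t
    using lim[OF that] by (rule tendsto_within_subset) (use that in auto)
  show "\<exists>l. (f \<longlongrightarrow> l) (at_left t)" if t: "0 < t" for t
  proof -
    have "at t within {0..} = at t"
      using t by (intro at_within_interior) (auto simp: interior_real_atLeast)
    then have "(f \<longlongrightarrow> f t) (at t)" using lim[of t] t by simp
    then have "(f \<longlongrightarrow> f t) (at_left t)" by (rule tendsto_within_subset) auto
    then show ?thesis by blast
  qed
qed

text \<open>One centred Gaussian law in place of a family: all the measures \<open>gauss t\<close>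
  are images of it under \<open>affine t\<close>, which makes the scaling in \<open>t\<close>
  explicit.\<close>

locale gaussian_base = prob_space \<gamma>
  for \<gamma> :: "'h::{real_inner, banach, polish_space} measure" and b :: 'h and Q :: "'h \<Rightarrow> 'h" +
  assumes sets_gamma [measurable_cong]: "sets \<gamma> = sets borel"
    and Q: "psd_operator Q"
    and char_gamma: "\<And>u. (CLINT x|\<gamma>. iexp (u \<bullet> x)) = exp (- complex_of_real (Q u \<bullet> u / 2))"
    and fourth_moment: "(\<integral>\<^sup>+x. ennreal (norm x ^ 4) \<partial>\<gamma>) < \<infinity>"
begin

definition affine :: "real \<Rightarrow> 'h \<Rightarrow> 'h" where
  "affine t x = t *\<^sub>R b + sqrt t *\<^sub>R x"

definition gauss :: "real \<Rightarrow> 'h measure" where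
  "gauss t = distr \<gamma> borel (affine t)"

text \<open>The exponent of Brownian motion with drift \<open>b\<close> and covariance
  \<open>Q\<close>; the HVG exponent is \<open>- a * Ln (1 - expo u)\<close>.\<close>

definition expo :: "'h \<Rightarrow> complex" where
  "expo u = \<i> * complex_of_real (u \<bullet> b) - complex_of_real (Q u \<bullet> u / 2)"

lemma affine_measurable [measurable]: "affine t \<in> borel_measurable borel"
  unfolding affine_def[abs_def] by measurable

lemma sets_gauss [simp, measurable_cong]: "sets (gauss t) = sets borel"
  by (simp add: gauss_def)

lemma prob_space_gauss: "prob_space (gauss t)"
  unfolding gauss_def by (rule prob_space_distr) measurable

lemma char_gauss:
  assumes "0 \<le> t"
  shows "(CLINT x|gauss t. iexp (u \<bullet> x)) = exp (complex_of_real t * expo u)"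
proof -
  have "(CLINT x|gauss t. iexp (u \<bullet> x)) = (CLINT x|\<gamma>. iexp (t * (u \<bullet> b)) * iexp ((sqrt t *\<^sub>R u) \<bullet> x))"
    unfolding gauss_def by (subst integral_distr)
      (auto intro!: Bochner_Integration.integral_cong simp: affine_def inner_add_right exp_add distrib_left)
  also have "\<dots> = iexp (t * (u \<bullet> b)) * (CLINT x|\<gamma>. iexp ((sqrt t *\<^sub>R u) \<bullet> x))"
    by (rule integral_mult_right_zero)
  also have "\<dots> = iexp (t * (u \<bullet> b)) * exp (- complex_of_real (t * (Q u \<bullet> u) / 2))"
  proof -
    have "Q (sqrt t *\<^sub>R u) \<bullet> (sqrt t *\<^sub>R u) = (sqrt t * sqrt t) * (Q u \<bullet> u)"
      by (simp add: linear_cmul[OF bounded_linear.linear[OF psd_operatorD(1)[OF Q]]])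
    also have "sqrt t * sqrt t = t" using assms by simp
    finally show ?thesis unfolding char_gamma by simp
  qed
  also have "\<dots> = exp (complex_of_real t * expo u)"
    unfolding exp_add[symmetric] by (intro arg_cong[where f=exp]) (simp add: expo_def algebra_simps)
  finally show ?thesis .
qed

definition moment_const :: real where
  "moment_const = 8 * (norm b ^ 4 + (LINT x|\<gamma>. norm x ^ 4))"

lemma fourth_moment_integrable: "integrable \<gamma> (\<lambda>x. norm x ^ 4)"
  using fourth_moment by (intro integrableI_bounded) auto

lemma moment_const_nonneg: "0 \<le> moment_const"
  by (simp add: moment_const_def)

text \<open>The Gaussian part scales like the fourth power of \<open>sqrt t\<close>, and the drift
  contributes \<open>t ^ 4\<close>, which is at most \<open>t\<^sup>2\<close> for
  \<open>t \<le> 1\<close>. The 8 in \<open>moment_const\<close> comes from applying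
  \<open>(x + y)\<^sup>2 \<le> 2 * (x\<^sup>2 + y\<^sup>2)\<close> twice.\<close>

lemma gauss_fourth_moment:
  assumes t: "0 \<le> t" "t \<le> 1"
  shows "(\<integral>\<^sup>+x. ennreal (norm x ^ 4) \<partial>gauss t) \<le> ennreal (moment_const * t\<^sup>2)"
proof -
  have four: "(x + y) ^ 4 \<le> 8 * (x ^ 4 + y ^ 4)" if "0 \<le> x" "0 \<le> y" for x y :: real
  proof -
    have "(x + y)\<^sup>2 \<le> 2 * (x\<^sup>2 + y\<^sup>2)" using sum_squares_bound[of x y] by (simp add: power2_sum)
    then have "((x + y)\<^sup>2)\<^sup>2 \<le> (2 * (x\<^sup>2 + y\<^sup>2))\<^sup>2" by (rule power_mono) simp
    also have "\<dots> = 4 * (x\<^sup>2 + y\<^sup>2)\<^sup>2" by (simp only: power_mult_distrib) simp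
    also have "\<dots> \<le> 4 * (2 * ((x\<^sup>2)\<^sup>2 + (y\<^sup>2)\<^sup>2))"
      using sum_squares_bound[of "x\<^sup>2" "y\<^sup>2"] by (simp add: power2_sum)
    finally show ?thesis by (simp flip: power_mult)
  qed
  have bd: "norm (affine t x) ^ 4 \<le> t\<^sup>2 * (8 * (norm b ^ 4 + norm x ^ 4))" for x
  proof -
    have "norm (affine t x) \<le> t * norm b + sqrt t * norm x"
      using norm_triangle_ineq[of "t *\<^sub>R b" "sqrt t *\<^sub>R x"] t by (simp add: affine_def)
    then have "norm (affine t x) ^ 4 \<le> (t * norm b + sqrt t * norm x) ^ 4"
      by (rule power_mono) simp
    also have "\<dots> \<le> 8 * ((t * norm b) ^ 4 + (sqrt t * norm x) ^ 4)"
      using t by (intro four) auto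
    also have "(sqrt t * norm x) ^ 4 = t\<^sup>2 * norm x ^ 4"
    proof -
      have "sqrt t ^ 4 = (sqrt t ^ 2) ^ 2" by (simp flip: power_mult)
      then show ?thesis using t by (simp add: power_mult_distrib)
    qed
    also have "(t * norm b) ^ 4 \<le> t\<^sup>2 * norm b ^ 4"
      using t by (auto simp: power_mult_distrib intro!: mult_right_mono power_decreasing)
    finally show ?thesis by (simp add: algebra_simps)
  qed
  have "(\<integral>\<^sup>+x. ennreal (norm x ^ 4) \<partial>gauss t) = (\<integral>\<^sup>+x. ennreal (norm (affine t x) ^ 4) \<partial>\<gamma>)"
    unfolding gauss_def by (subst nn_integral_distr) auto
  also have "\<dots> \<le> (\<integral>\<^sup>+x. ennreal (t\<^sup>2 * (8 * (norm b ^ 4 + norm x ^ 4))) \<partial>\<gamma>)"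
    using bd by (intro nn_integral_mono ennreal_leI)
  also have "\<dots> = ennreal (LINT x|\<gamma>. t\<^sup>2 * (8 * (norm b ^ 4 + norm x ^ 4)))"
    using fourth_moment_integrable by (intro nn_integral_eq_integral) auto
  also have "(LINT x|\<gamma>. t\<^sup>2 * (8 * (norm b ^ 4 + norm x ^ 4))) = moment_const * t\<^sup>2"
    using fourth_moment_integrable by (simp add: moment_const_def prob_space)
  finally show ?thesis .
qed

text \<open>
  Each dyadic increment is bounded by \<open>\<epsilon> + \<epsilon>\<^sup>-\<^sup>3 \<Sum> \<bar>increment\<bar>\<^sup>4\<close> with \<open>\<epsilon> = (9/10)\<^sup>n\<close>.  As the
  fourth moments at level \<open>n\<close> are of order \<open>4\<^sup>-\<^sup>n\<close> and \<open>(10/9)\<^sup>3 / 2 < 1\<close>, these bounds are almost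
  surely summable, so the dyadic step functions converge uniformly.
\<close>

theorem brownian_exists:
  obtains N :: "(nat \<times> nat \<Rightarrow> 'h) measure" and B where "levy_process N B" "levy_exponent N B expo"
    "sets N = sets (Pi\<^sub>M UNIV (\<lambda>_. borel))" "\<And>\<omega>. continuous_on {0..} (\<lambda>t. B t \<omega>)"
proof -
  have cf: "(CLINT x|gauss (1 / 2 ^ n). iexp (u \<bullet> x)) = exp (expo u / 2 ^ n)" for n u
    using char_gauss[of "1 / 2 ^ n" u] by simp
  obtain N :: "(nat \<times> nat \<Rightarrow> 'h) measure" where N: "prob_space N" "sets N = sets (Pi\<^sub>M UNIV (\<lambda>_. borel))"
    "AE \<omega> in N. \<forall>n j. \<omega> (n, j) = \<omega> (Suc n, 2 * j)" "AE \<omega> in N. \<forall>n. \<omega> (n, 0) = 0"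
    "\<And>n m j u. mono_on {..m} j \<Longrightarrow>
      (CLINT \<omega>|N. iexp (\<Sum>k<m. u k \<bullet> (\<omega> (n, j (Suc k)) - \<omega> (n, j k)))) =
      (\<Prod>k<m. exp (of_nat (j (Suc k) - j k) * expo (u k) / 2 ^ n))"
    using dyadic_process_exists[of "\<lambda>n. gauss (1 / 2 ^ n)" expo, OF prob_space_gauss sets_gauss cf] by blast
  interpret N: dyadic_process N expo
    using N by (intro dyadic_process.intro dyadic_process_axioms.intro) auto
  define I where "I n j \<omega> = norm (\<omega> (n, Suc j) - \<omega> (n, j))" for n j and \<omega> :: "nat \<times> nat \<Rightarrow> 'h"
  have [measurable]: "I n j \<in> borel_measurable N" for n j
    unfolding I_def[abs_def]
    by (rule measurable_compose[OF borel_measurable_diff[OF N.coord_measurable N.coord_measurable] borel_measurable_norm])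
  have I4: "(\<integral>\<^sup>+\<omega>. ennreal (I n j \<omega> ^ 4) \<partial>N) \<le> ennreal (moment_const * (1/4) ^ n)" for n j
  proof -
    have "distr N borel (\<lambda>\<omega>. \<omega> (n, Suc j) - \<omega> (n, j)) = gauss (1 / 2 ^ n)"
      by (rule distr_eqI_char[OF N(1) _ prob_space_gauss])
        (auto simp only: N.increment_char cf sets_gauss intro!: borel_measurable_diff N.coord_measurable)
    moreover have "(\<integral>\<^sup>+\<omega>. ennreal (I n j \<omega> ^ 4) \<partial>N) = (\<integral>\<^sup>+x. ennreal (norm x ^ 4) \<partial>distr N borel (\<lambda>\<omega>. \<omega> (n, Suc j) - \<omega> (n, j)))"
      unfolding I_def by (subst nn_integral_distr) (auto intro!: borel_measurable_diff N.coord_measurable)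
    ultimately have "(\<integral>\<^sup>+\<omega>. ennreal (I n j \<omega> ^ 4) \<partial>N) = (\<integral>\<^sup>+x. ennreal (norm x ^ 4) \<partial>gauss (1 / 2 ^ n))"
      by (simp only:)
    also have "\<dots> \<le> ennreal (moment_const * (1 / 2 ^ n)\<^sup>2)" by (rule gauss_fourth_moment) auto
    also have "(1 / 2 ^ n)\<^sup>2 = (1/4 :: real) ^ n"
    proof -
      have "(2 :: real) ^ n * 2 ^ n = 4 ^ n" by (simp flip: power_mult_distrib)
      then show ?thesis by (simp add: power2_eq_square power_divide)
    qed
    finally show ?thesis .
  qed
  \<comment> \<open>The factor 1000/729 is the cube of 10/9, and \<open>K * 2 ^ n\<close> counts the
    increments of level \<open>n\<close> up to the time horizon \<open>K\<close>. The expectation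
    decays like \<open>(500/729) ^ n\<close>, from 1000/729 times 2 for the number of cells times
    1/4 for the moments.\<close>
  define V where "V K n \<omega> = (1000/729) ^ n * (\<Sum>j<K * 2 ^ n. I n j \<omega> ^ 4)" for K n and \<omega> :: "nat \<times> nat \<Rightarrow> 'h"
  have V0: "0 \<le> V K n \<omega>" for K n \<omega> by (auto simp: V_def I_def intro!: mult_nonneg_nonneg sum_nonneg)
  have [measurable]: "V K n \<in> borel_measurable N" for K n unfolding V_def[abs_def] by measurable
  have V_int: "(\<integral>\<^sup>+\<omega>. ennreal (V K n \<omega>) \<partial>N) \<le> ennreal (moment_const * real K * (500/729) ^ n)" for K n
  proof -
    have "ennreal (V K n \<omega>) = ennreal ((1000/729) ^ n) * (\<Sum>j<K * 2 ^ n. ennreal (I n j \<omega> ^ 4))" for \<omega>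
      unfolding V_def by (subst sum_ennreal) (auto simp: ennreal_mult sum_nonneg I_def)
    then have "(\<integral>\<^sup>+\<omega>. ennreal (V K n \<omega>) \<partial>N) = ennreal ((1000/729) ^ n) * (\<Sum>j<K * 2 ^ n. \<integral>\<^sup>+\<omega>. ennreal (I n j \<omega> ^ 4) \<partial>N)"
      by (simp only:) (simp add: nn_integral_cmult nn_integral_sum del: sum_ennreal)
    also have "\<dots> \<le> ennreal ((1000/729) ^ n) * (\<Sum>j<K * 2 ^ n. ennreal (moment_const * (1/4) ^ n))"
      by (intro mult_left_mono sum_mono I4) auto
    also have "\<dots> = ennreal ((1000/729) ^ n * (real (K * 2 ^ n) * (moment_const * (1/4) ^ n)))"
      using moment_const_nonneg by (subst sum_ennreal) (simp_all flip: ennreal_mult)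
    also have "(1000/729) ^ n * (real (K * 2 ^ n) * (moment_const * (1/4) ^ n)) = moment_const * real K * (500/729) ^ n"
    proof -
      have "(1000/729) ^ n * 2 ^ n * (1/4) ^ n = ((1000/729) * 2 * (1/4) :: real) ^ n"
        by (simp only: power_mult_distrib)
      then have "(1000/729) ^ n * 2 ^ n * (1/4) ^ n = (500/729 :: real) ^ n" by simp
      then show ?thesis by (simp add: mult_ac)
    qed
    finally show ?thesis .
  qed
  have AE_V: "AE \<omega> in N. summable (\<lambda>n. V K n \<omega>)" for K
  proof -
    have "(\<integral>\<^sup>+\<omega>. (\<Sum>n. ennreal (V K n \<omega>)) \<partial>N) = (\<Sum>n. \<integral>\<^sup>+\<omega>. ennreal (V K n \<omega>) \<partial>N)"
      by (rule nn_integral_suminf) measurable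
    also have "\<dots> \<le> (\<Sum>n. ennreal (moment_const * real K * (500/729) ^ n))"
      by (intro suminf_le V_int) auto
    also have "\<dots> = ennreal (\<Sum>n. moment_const * real K * (500/729) ^ n)"
      using moment_const_nonneg by (intro suminf_ennreal2 summable_mult summable_geometric) auto
    also have "\<dots> < \<infinity>" by simp
    finally have "AE \<omega> in N. (\<Sum>n. ennreal (V K n \<omega>)) \<noteq> \<infinity>"
      by (intro nn_integral_PInf_AE) auto
    then show ?thesis by eventually_elim (auto intro!: summable_suminf_not_top V0)
  qed
  \<comment> \<open>Summability is demanded for every horizon \<open>K\<close>, and off
    \<open>A\<close> the path is set to 0. Continuity then holds for every \<open>\<omega>\<close>
    and not only almost surely.\<close>
  define A where "A \<omega> \<longleftrightarrow> (\<forall>n j. \<omega> (n, j) = \<omega> (Suc n, 2 * j)) \<and> (\<forall>K. summable (\<lambda>n. V K n \<omega>))"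
    for \<omega> :: "nat \<times> nat \<Rightarrow> 'h"
  have AE_A: "AE \<omega> in N. A \<omega>"
    unfolding A_def using N.refine AE_V by (simp add: AE_all_countable)
  have Am [measurable]: "Measurable.pred N A"
  proof -
    have [measurable]: "Measurable.pred N (\<lambda>\<omega>. \<omega> q = \<omega> r)" for q r
    proof -
      have [measurable]: "(\<lambda>\<omega>. norm (\<omega> q - \<omega> r)) \<in> borel_measurable N"
        by (rule measurable_compose[OF borel_measurable_diff[OF N.coord_measurable N.coord_measurable] borel_measurable_norm])
      have "Measurable.pred N (\<lambda>\<omega>. norm (\<omega> q - \<omega> r) = 0)" by measurable
      then show ?thesis by simp
    qed
    have sm: "summable (\<lambda>n. V K n \<omega>) \<longleftrightarrow> convergent (\<lambda>n. \<Sum>i<n. V K i \<omega>)" for K \<omega>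
      by (rule summable_iff_convergent)
    have [measurable]: "Measurable.pred N (\<lambda>\<omega>. summable (\<lambda>n. V K n \<omega>))" for K
      unfolding sm Cauchy_convergent_iff[symmetric] pred_def by (rule sets_Collect_Cauchy) measurable
    show ?thesis unfolding A_def[abs_def] by measurable
  qed
  define d where "d n t \<omega> = (if A \<omega> then \<omega> (n, Suc (nat \<lfloor>2 ^ n * t\<rfloor>)) else 0)" for n and t :: real and \<omega> :: "nat \<times> nat \<Rightarrow> 'h"
  have [measurable]: "d n t \<in> borel_measurable N" for n t
    unfolding d_def[abs_def] using N.coord_measurable by measurable
  define R where "R K n \<omega> = (9/10) ^ n + V K n \<omega>" for K n and \<omega> :: "nat \<times> nat \<Rightarrow> 'h"
  have R0: "0 \<le> R K n \<omega>" for K n \<omega> unfolding R_def using V0 by (intro add_nonneg_nonneg) auto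
  have R_sum: "summable (\<lambda>n. R K n \<omega>)" if "A \<omega>" for K \<omega>
    unfolding R_def using that by (intro summable_add summable_geometric) (auto simp: A_def)
  have I_le: "I n j \<omega> \<le> R K n \<omega>" if "j < K * 2 ^ n" for n j K \<omega>
  proof (cases "I n j \<omega> \<le> (9/10) ^ n")
    case True
    then show ?thesis unfolding R_def using V0[of K n \<omega>] by simp
  next
    case False
    let ?x = "I n j \<omega>"
    have x0: "0 \<le> ?x" by (simp add: I_def)
    have "((9/10) ^ n) ^ 3 \<le> ?x ^ 3" using False by (intro power_mono) auto
    then have "((9/10) ^ n) ^ 3 * ?x \<le> ?x ^ 3 * ?x" using x0 by (rule mult_right_mono)
    then have "(1000/729) ^ n * (((9/10) ^ n) ^ 3 * ?x) \<le> (1000/729) ^ n * ?x ^ 4"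
      by (intro mult_left_mono) (auto simp: power3_eq_cube power4_eq_xxxx mult.assoc)
    moreover have "(1000/729) ^ n * ((9/10) ^ n) ^ 3 = (1 :: real)"
    proof -
      have "((9/10) ^ n) ^ 3 = ((9/10) ^ 3 :: real) ^ n" by (simp only: power_mult[symmetric] mult.commute)
      then have "(1000/729) ^ n * ((9/10) ^ n) ^ 3 = (1000/729 * (9/10) ^ 3 :: real) ^ n" by (simp only: power_mult_distrib)
      also have "1000/729 * (9/10) ^ 3 = (1 :: real)" by (simp add: power3_eq_cube)
      finally show ?thesis by simp
    qed
    ultimately have "?x \<le> (1000/729) ^ n * ?x ^ 4" by (simp only: mult.assoc[symmetric] mult_1_left)
    also have "\<dots> \<le> V K n \<omega>"
      unfolding V_def using that by (intro mult_left_mono member_le_sum) (auto simp: I_def)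
    also have "\<dots> \<le> R K n \<omega>" by (simp add: R_def)
    finally show ?thesis .
  qed
  \<comment> \<open>With \<open>q\<close> the cell of \<open>t\<close> at level \<open>n\<close>,
    the right grid point has index \<open>2 * q + 2\<close> at the next level, while the new one has
    index \<open>2 * q + 1\<close> or \<open>2 * q + 2\<close>. The approximation thus changes by at
    most one increment, that of index \<open>2 * q + 1\<close>.\<close>
  have step: "norm (d (Suc n) t \<omega> - d n t \<omega>) \<le> R K (Suc n) \<omega>" if t: "0 \<le> t" "t < real K" for n t K \<omega>
  proof (cases "A \<omega>")
    case True
    define x where "x = 2 ^ n * t"
    define q where "q = nat \<lfloor>x\<rfloor>"
    have x0: "0 \<le> x" using t by (simp add: x_def)
    have "x < 2 ^ n * real K" unfolding x_def using t by (intro mult_strict_left_mono) auto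
    then have "q < K * 2 ^ n" unfolding q_def using x0 by (auto simp: nat_less_iff floor_less_iff mult.commute)
    then have idx: "Suc (2 * q) < K * 2 ^ Suc n" by simp
    have "nat \<lfloor>2 * x\<rfloor> = 2 * q \<or> nat \<lfloor>2 * x\<rfloor> = Suc (2 * q)" unfolding q_def using x0 by linarith
    moreover have "\<omega> (n, Suc q) = \<omega> (Suc n, Suc (Suc (2 * q)))"
      using True unfolding A_def by (metis mult_Suc_right add_2_eq_Suc)
    ultimately show ?thesis
      using True I_le[OF idx, of \<omega>] R0[of K "Suc n" \<omega>]
      by (auto simp: d_def x_def[symmetric] q_def[symmetric] I_def norm_minus_commute mult.assoc)
  qed (simp add: d_def R0)
  have tail: "norm (d m t \<omega> - d n t \<omega>) \<le> (\<Sum>i. R K (i + Suc n) \<omega>)"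
    if \<omega>: "A \<omega>" and t: "0 \<le> t" "t < real K" and nm: "n \<le> m" for n m t K \<omega>
  proof -
    have "d m t \<omega> - d n t \<omega> = (\<Sum>i=n..<m. d (Suc i) t \<omega> - d i t \<omega>)"
      using nm by (rule sum_Suc_diff'[symmetric])
    then have "norm (d m t \<omega> - d n t \<omega>) \<le> (\<Sum>i=n..<m. R K (Suc i) \<omega>)"
      by (simp only:) (intro order_trans[OF norm_sum] sum_mono step t)
    also have "\<dots> = (\<Sum>i<m - n. R K (i + Suc n) \<omega>)"
      using nm sum.shift_bounds_nat_ivl[of "\<lambda>i. R K (Suc i) \<omega>" 0 n "m - n"] by (simp add: lessThan_atLeast0)
    also have "\<dots> \<le> (\<Sum>i. R K (i + Suc n) \<omega>)"
      using summable_ignore_initial_segment[OF R_sum[OF \<omega>], of K "Suc n"] R0 by (intro sum_le_suminf) auto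
    finally show ?thesis .
  qed
  have tail0: "(\<lambda>n. \<Sum>i. R K (i + Suc n) \<omega>) \<longlonglongrightarrow> 0" if "A \<omega>" for K \<omega>
    by (rule LIMSEQ_Suc[OF suminf_tail_tendsto_0[OF R_sum[OF that]]])
  define B where "B t \<omega> = lim (\<lambda>n. d n t \<omega>)" for t \<omega>
  have [measurable]: "B t \<in> borel_measurable N" for t
    unfolding B_def[abs_def] by (rule borel_measurable_lim_metric) simp
  have lim: "(\<lambda>n. d n t \<omega>) \<longlonglongrightarrow> B t \<omega>" if t: "0 \<le> t" for t \<omega>
  proof (cases "A \<omega>")
    case True
    obtain K where K: "t < real K" using reals_Archimedean2 by blast
    have "Cauchy (\<lambda>n. d n t \<omega>)"
    proof (rule metric_CauchyI)
      fix r :: real assume "0 < r"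
      then have "0 < r / 2" by simp
      from order_tendstoD(2)[OF tail0[OF True, of K] this] obtain n where n: "(\<Sum>i. R K (i + Suc n) \<omega>) < r / 2"
        by (auto simp: eventually_sequentially)
      have "dist (d m t \<omega>) (d m' t \<omega>) < r" if "n \<le> m" "n \<le> m'" for m m'
        using tail[OF True t K that(1)] tail[OF True t K that(2)] n dist_triangle2[of "d m t \<omega>" "d m' t \<omega>" "d n t \<omega>"]
        by (simp add: dist_norm)
      then show "\<exists>M. \<forall>m\<ge>M. \<forall>n\<ge>M. dist (d m t \<omega>) (d n t \<omega>) < r" by blast
    qed
    then show ?thesis by (simp add: B_def Cauchy_convergent_iff convergent_LIMSEQ_iff)
  next
    case False
    then have "(\<lambda>n. d n t \<omega>) = (\<lambda>n. 0)" by (simp add: d_def)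
    then show ?thesis by (simp add: B_def)
  qed
  have B_d: "norm (B t \<omega> - d n t \<omega>) \<le> (\<Sum>i. R K (i + Suc n) \<omega>)"
    if \<omega>: "A \<omega>" and t: "0 \<le> t" "t < real K" for n t K \<omega>
  proof (rule LIMSEQ_le_const2)
    show "(\<lambda>m. norm (d m t \<omega> - d n t \<omega>)) \<longlonglongrightarrow> norm (B t \<omega> - d n t \<omega>)"
      by (intro tendsto_intros lim t)
    show "\<exists>N. \<forall>m\<ge>N. norm (d m t \<omega> - d n t \<omega>) \<le> (\<Sum>i. R K (i + Suc n) \<omega>)"
      using tail[OF \<omega> t] by blast
  qed
  \<comment> \<open>Times less than one mesh width apart lie in the same or in adjacent cells, so
    the two values differ by at most one increment.\<close>
  have d_close: "norm (d n t \<omega> - d n s \<omega>) \<le> R K n \<omega>"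
    if st: "0 \<le> s" "s \<le> t" "t < real K" "2 ^ n * (t - s) < 1" for n s t K \<omega>
  proof (cases "A \<omega>")
    case True
    define p q where "p = nat \<lfloor>2 ^ n * s\<rfloor>" and "q = nat \<lfloor>2 ^ n * t\<rfloor>"
    have x: "0 \<le> 2 ^ n * s" "2 ^ n * s \<le> 2 ^ n * t" "2 ^ n * t < 2 ^ n * s + 1"
      using st by (auto simp: algebra_simps)
    then have pq: "q = p \<or> q = Suc p" unfolding p_def q_def by linarith
    define y where "y = 2 ^ n * t"
    have "y < 2 ^ n * real K" unfolding y_def using st by (intro mult_strict_left_mono) auto
    moreover have "0 \<le> y" using st by (simp add: y_def)
    ultimately have "q < K * 2 ^ n"
      unfolding q_def y_def[symmetric] by (auto simp: nat_less_iff floor_less_iff mult.commute)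
    then have "I n q \<omega> \<le> R K n \<omega>" by (rule I_le)
    then show ?thesis using pq True R0[of K n \<omega>]
      by (auto simp: d_def p_def[symmetric] q_def[symmetric] I_def)
  qed (simp add: d_def R0)
  have cont: "continuous_on {0..} (\<lambda>t. B t \<omega>)" for \<omega>
  proof (cases "A \<omega>")
    case False
    then have "B t \<omega> = 0" for t by (simp add: B_def d_def)
    then show ?thesis by simp
  next
    case True
    show ?thesis
      unfolding continuous_on_iff
    proof (intro ballI allI impI)
      fix t e :: real assume t: "t \<in> {0..}" and e: "0 < e"
      obtain K where K: "t + 1 < real K" using reals_Archimedean2 by blast
      have "(\<lambda>n. 2 * (\<Sum>i. R K (i + Suc n) \<omega>) + R K n \<omega>) \<longlonglongrightarrow> 2 * 0 + 0"
        by (intro tendsto_intros tail0 True summable_LIMSEQ_zero[OF R_sum])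
      then have "\<forall>\<^sub>F n in sequentially. 2 * (\<Sum>i. R K (i + Suc n) \<omega>) + R K n \<omega> < e"
        using e by (intro order_tendstoD(2)) auto
      then obtain n where n: "2 * (\<Sum>i. R K (i + Suc n) \<omega>) + R K n \<omega> < e"
        by (auto simp: eventually_sequentially)
      have close: "norm (B v \<omega> - B u \<omega>) < e" if uv: "0 \<le> u" "u \<le> v" "v < real K" "2 ^ n * (v - u) < 1" for u v
      proof -
        have "norm (B v \<omega> - B u \<omega>) \<le> norm (B v \<omega> - d n v \<omega>) + norm (d n v \<omega> - d n u \<omega>) + norm (B u \<omega> - d n u \<omega>)"
          using norm_triangle_ineq[of "B v \<omega> - d n v \<omega>" "d n v \<omega> - B u \<omega>"]
            norm_triangle_ineq[of "d n v \<omega> - d n u \<omega>" "d n u \<omega> - B u \<omega>"]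
          by (simp add: norm_minus_commute)
        also have "\<dots> \<le> (\<Sum>i. R K (i + Suc n) \<omega>) + R K n \<omega> + (\<Sum>i. R K (i + Suc n) \<omega>)"
          using uv by (intro add_mono B_d[OF True] d_close) auto
        finally show ?thesis using n by simp
      qed
      \<comment> \<open>The level \<open>n\<close> is fixed first, through the uniform tails; the
        mesh width then serves as the modulus. The bound 1 keeps \<open>t'\<close> below the horizon
        \<open>K\<close>, which was chosen beyond \<open>t + 1\<close>.\<close>
      let ?\<delta> = "min 1 (1 / 2 ^ n) :: real"
      have "dist (B t' \<omega>) (B t \<omega>) < e" if t': "t' \<in> {0..}" "dist t' t < ?\<delta>" for t'
      proof -
        have a: "\<bar>t' - t\<bar> < 1" "\<bar>t' - t\<bar> < 1 / 2 ^ n" using t'(2) unfolding dist_real_def min_less_iff_conj by blast+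
        have "2 ^ n * \<bar>t' - t\<bar> < 2 ^ n * (1 / 2 ^ n)" by (intro mult_strict_left_mono a) simp
        then have b: "2 ^ n * \<bar>t' - t\<bar> < 1" by simp
        show ?thesis
        proof (cases "t \<le> t'")
          case True
          then show ?thesis using close[of t t'] t t' a b K by (simp add: dist_norm)
        next
          case False
          then show ?thesis using close[of t' t] t t' a b K by (simp add: dist_norm norm_minus_commute)
        qed
      qed
      then show "\<exists>\<delta>>0. \<forall>t'\<in>{0..}. dist t' t < \<delta> \<longrightarrow> dist (B t' \<omega>) (B t \<omega>) < e"
        by (intro exI[of _ ?\<delta>]) auto
    qed
  qed
  have AElim: "AE \<omega> in N. (\<lambda>n. \<omega> (n, Suc (nat \<lfloor>2 ^ n * t\<rfloor>))) \<longlonglongrightarrow> B t \<omega>" if "0 \<le> t" for t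
    using AE_A
  proof eventually_elim
    case (elim \<omega>)
    then show ?case using lim[OF that, of \<omega>] by (simp add: d_def)
  qed
  have cad: "cadlag (\<lambda>t. B t \<omega>)" for \<omega>
    by (rule continuous_on_cadlag[OF cont])
  note lc = N.limit_char[of B, OF _ AElim]
  have "levy_process N B" "levy_exponent N B expo"
    by (rule levy_process_charI[where \<psi>=expo]; (intro N lc AE_I2 cad)?; simp)+
  then show thesis using N(2) cont by (rule that)
qed

end

section \<open>Subordination\<close>

text \<open>Joint measurability in time and \<open>\<omega>\<close>: with the time rounded to the
  grid only countably many random variables occur, and continuity gives the limit. The
  \<open>max 0\<close> extends the map to all real times, so that it can be composed with a
  real-valued clock.\<close>

lemma continuous_process_measurable:
  fixes W :: "real \<Rightarrow> 'w \<Rightarrow> 'b::metric_space"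
  assumes m: "\<And>t. 0 \<le> t \<Longrightarrow> W t \<in> borel_measurable M"
    and c: "\<And>\<omega>. \<omega> \<in> space M \<Longrightarrow> continuous_on {0..} (\<lambda>t. W t \<omega>)"
  shows "(\<lambda>p. W (max 0 (fst p)) (snd p)) \<in> borel_measurable ((borel :: real measure) \<Otimes>\<^sub>M M)"
proof (rule borel_measurable_LIMSEQ_metric)
  fix n :: nat
  show "(\<lambda>p. W (real (Suc (nat \<lfloor>2 ^ n * max 0 (fst p :: real)\<rfloor>)) / 2 ^ n) (snd p)) \<in> borel_measurable ((borel :: real measure) \<Otimes>\<^sub>M M)"
  proof (rule measurable_compose_countable[where f="\<lambda>j p. W (real (Suc j) / 2 ^ n) (snd p)" and g="\<lambda>p. nat \<lfloor>2 ^ n * max 0 (fst p :: real)\<rfloor>"])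
    show "(\<lambda>p. W (real (Suc j) / 2 ^ n) (snd p)) \<in> borel_measurable ((borel :: real measure) \<Otimes>\<^sub>M M)" for j
      by (rule measurable_compose[OF measurable_snd m]) simp
    show "(\<lambda>p. nat \<lfloor>2 ^ n * max 0 (fst p :: real)\<rfloor>) \<in> measurable ((borel :: real measure) \<Otimes>\<^sub>M M) (count_space UNIV)"
      by measurable
  qed
next
  fix p assume p: "p \<in> space ((borel :: real measure) \<Otimes>\<^sub>M M)"
  then have "snd p \<in> space M" by (auto simp: space_pair_measure)
  then show "(\<lambda>n. W (real (Suc (nat \<lfloor>2 ^ n * max 0 (fst p)\<rfloor>)) / 2 ^ n) (snd p)) \<longlonglongrightarrow> W (max 0 (fst p)) (snd p)"
    by (intro continuous_on_tendsto_compose[OF c dyadic_upper_tendsto]) auto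
qed

lemma gamma_process_laplace:
  assumes G: "gamma_process \<alpha> 1 N G" and t: "0 \<le> t" and z: "0 \<le> Re z"
  shows "(CLINT \<omega>|N. exp (- (z * complex_of_real (G t \<omega>)))) = exp (- (complex_of_real (\<alpha> * t) * Ln (1 + z)))"
proof -
  have a: "0 < \<alpha>" and levy: "levy_process N G" using G by (auto simp: gamma_process_def)
  interpret prob_space N using levy by (rule levy_processD)
  have m: "G t \<in> borel_measurable N" using levy_processD(2)[OF levy t] .
  show ?thesis
  \<comment> \<open>The density in \<open>gamma_process\<close> is prescribed for positive times; at
    time 0 the process vanishes almost surely.\<close>
  proof (cases "t = 0")
    case True
    have "(CLINT \<omega>|N. exp (- (z * complex_of_real (G t \<omega>)))) = (CLINT \<omega>|N. 1)"
    proof (rule integral_cong_AE)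
      show "AE \<omega> in N. exp (- (z * complex_of_real (G t \<omega>))) = 1"
        using levy_processD(3)[OF levy] unfolding True by eventually_elim simp
    qed (use m in auto)
    then show ?thesis using True by (simp add: prob_space)
  next
    case False
    with t have "0 < t" by simp
    then have "distributed N lborel (G t) (\<lambda>x. ennreal (gamma_density (\<alpha> * t) 1 x))"
      using G by (auto simp: gamma_process_def)
    then have d: "distr N lborel (G t) = gamma_law (\<alpha> * t)" by (simp add: distributed_def gamma_law_def)
    have "(CLINT \<omega>|N. exp (- (z * complex_of_real (G t \<omega>)))) = (CLINT x|distr N lborel (G t). exp (- (z * complex_of_real x)))"
      using m by (subst integral_distr) auto
    then show ?thesis unfolding d using gamma_law_laplace[of "\<alpha> * t" z] a \<open>0 < t\<close> z by simp
  qed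
qed

text \<open>For a fixed clock path the times \<open>G (t k)\<close> form an increasing grid, so
  integrating over \<open>W\<close> leaves exponentials of clock increments times
  \<open>\<psi>\<close>. These factorise by independence, and each is the gamma Laplace transform at
  \<open>- \<psi> u\<close>. The condition \<open>Re (\<psi> u) \<le> 0\<close> and the monotone
  clock keep them bounded by 1.\<close>

theorem subordinate_levy:
  fixes W :: "real \<Rightarrow> 'w \<Rightarrow> 'h::{real_inner, banach, second_countable_topology}" and G :: "real \<Rightarrow> 'v \<Rightarrow> real"
  assumes W: "levy_process N1 W" "levy_exponent N1 W \<psi>" and re: "\<And>u. Re (\<psi> u) \<le> 0"
    and cont: "\<And>\<omega>. continuous_on {0..} (\<lambda>t. W t \<omega>)"
    and G: "gamma_process \<alpha> 1 N2 G"
    and G_mono: "\<And>\<omega> s t. 0 \<le> s \<Longrightarrow> s \<le> t \<Longrightarrow> G s \<omega> \<le> G t \<omega>" and G_pos: "\<And>\<omega> t. 0 \<le> t \<Longrightarrow> 0 \<le> G t \<omega>"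
    and G_cad: "\<And>\<omega>. cadlag (\<lambda>t. G t \<omega>)"
  shows "levy_process (N1 \<Otimes>\<^sub>M N2) (\<lambda>t p. W (G t (snd p)) (fst p))"
    "levy_exponent (N1 \<Otimes>\<^sub>M N2) (\<lambda>t p. W (G t (snd p)) (fst p)) (\<lambda>u. - complex_of_real \<alpha> * Ln (1 - \<psi> u))"
proof -
  have levyG: "levy_process N2 G" using G by (simp add: gamma_process_def)
  interpret N1: prob_space N1 using W(1) by (rule levy_processD)
  interpret N2: prob_space N2 using levyG by (rule levy_processD)
  interpret P: pair_prob_space N1 N2 ..
  note Gm = levy_processD(2)[OF levyG] and Wm = levy_processD(2)[OF W(1)]
  define Y where "Y t p = W (G t (snd p)) (fst p)" for t p
  have Ym [measurable]: "Y t \<in> borel_measurable (N1 \<Otimes>\<^sub>M N2)" if "0 \<le> t" for t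
  proof -
    have [measurable]: "G t \<in> borel_measurable N2" using Gm[OF that] .
    have "(\<lambda>p. (G t (snd p), fst p)) \<in> measurable (N1 \<Otimes>\<^sub>M N2) (borel \<Otimes>\<^sub>M N1)" by measurable
    from measurable_compose[OF this continuous_process_measurable[OF Wm cont]]
    show ?thesis unfolding Y_def[abs_def] using G_pos[OF that] by (simp add: max_absorb2)
  qed
  have Wexp: "(CLINT \<omega>|N1. iexp (u \<bullet> W s \<omega>)) = exp (complex_of_real s * \<psi> u)" if "0 \<le> s" for s u
    using W(2) that by (auto simp: levy_exponent_def)
  have Glap: "(CLINT \<omega>|N2. exp (complex_of_real (G s \<omega>) * \<psi> u)) = exp (complex_of_real s * (- complex_of_real \<alpha> * Ln (1 - \<psi> u)))"
    if "0 \<le> s" for s u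
    using gamma_process_laplace[OF G that, of "- \<psi> u"] re[of u] by (simp add: mult_ac)
  have cadY: "cadlag (\<lambda>t. Y t p)" for p
    unfolding cadlag_def
  proof (intro conjI allI impI)
    let ?g = "\<lambda>t. G t (snd p)"
    fix t :: real assume t: "0 \<le> t"
    have "((\<lambda>s. ?g s) \<longlongrightarrow> ?g t) (at_right t)" using G_cad[of "snd p"] t by (auto simp: cadlag_def)
    moreover have "\<forall>\<^sub>F s in at_right t. ?g s \<in> {0..}"
      using eventually_at_right_less[of t] by (rule eventually_mono) (use t G_pos in auto)
    ultimately show "((\<lambda>s. Y s p) \<longlongrightarrow> Y t p) (at_right t)"
      unfolding Y_def using G_pos[OF t] by (intro continuous_on_tendsto_compose[OF cont]) auto
  next
    let ?g = "\<lambda>t. G t (snd p)"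
    fix t :: real assume t: "0 < t"
    then obtain l where l: "(?g \<longlongrightarrow> l) (at_left t)" using G_cad[of "snd p"] by (auto simp: cadlag_def)
    have ev: "\<forall>\<^sub>F s in at_left t. ?g s \<in> {0..}"
      using eventually_at_left_real[OF t] by (rule eventually_mono) (use G_pos in auto)
    have "0 \<le> l" using l ev by (intro tendsto_lowerbound[OF l]) (auto elim: eventually_mono)
    then have "((\<lambda>s. Y s p) \<longlongrightarrow> W l (fst p)) (at_left t)"
      unfolding Y_def using l ev by (intro continuous_on_tendsto_compose[OF cont]) auto
    then show "\<exists>l. ((\<lambda>s. Y s p) \<longlongrightarrow> l) (at_left t)" by blast
  qed
  have fubini: "(CLINT p|(N1 \<Otimes>\<^sub>M N2). iexp (f p)) = (CLINT y|N2. CLINT x|N1. iexp (f (x, y)))"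
    if f: "f \<in> borel_measurable (N1 \<Otimes>\<^sub>M N2)" for f :: "'w \<times> 'v \<Rightarrow> real"
  proof -
    have "integrable (N1 \<Otimes>\<^sub>M N2) (\<lambda>(x, y). iexp (f (x, y)))"
      using P.integrable_iexp_comp[OF f] by (simp add: split_beta')
    from P.integral_snd[OF this] show ?thesis by (simp add: split_beta')
  qed
  have main: "levy_process (N1 \<Otimes>\<^sub>M N2) Y \<and> levy_exponent (N1 \<Otimes>\<^sub>M N2) Y (\<lambda>u. - complex_of_real \<alpha> * Ln (1 - \<psi> u))"
  proof (intro conjI levy_process_charI[where \<psi>="\<lambda>u. - complex_of_real \<alpha> * Ln (1 - \<psi> u)"])
    fix m :: nat and t :: "nat \<Rightarrow> real" and u :: "nat \<Rightarrow> 'h" assume t: "0 \<le> t 0" "mono_on {..m} t"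
    have le: "0 \<le> t k" if "k \<le> m" for k using t mono_onD[OF t(2), of 0 k] that by auto
    have leS: "t k \<le> t (Suc k)" if "k < m" for k using mono_onD[OF t(2), of k "Suc k"] that by auto
    have "(CLINT p|(N1 \<Otimes>\<^sub>M N2). iexp (\<Sum>k<m. u k \<bullet> (Y (t (Suc k)) p - Y (t k) p))) =
      (CLINT y|N2. CLINT x|N1. iexp (\<Sum>k<m. u k \<bullet> (Y (t (Suc k)) (x, y) - Y (t k) (x, y))))"
      using le by (intro fubini borel_measurable_sum borel_measurable_inner borel_measurable_const borel_measurable_diff Ym) auto
    also have "\<dots> = (CLINT y|N2. \<Prod>k<m. exp (complex_of_real (G (t (Suc k)) y - G (t k) y) * \<psi> (u k)))"
    proof (intro Bochner_Integration.integral_cong refl)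
      fix y
      have mG: "mono_on {..m} (\<lambda>k. G (t k) y)"
        using t(2) le by (auto intro!: mono_onI G_mono dest: mono_onD)
      have "(CLINT x|N1. iexp (\<Sum>k<m. u k \<bullet> (Y (t (Suc k)) (x, y) - Y (t k) (x, y)))) =
        (\<Prod>k<m. CLINT x|N1. iexp (u k \<bullet> W (G (t (Suc k)) y - G (t k) y) x))"
        unfolding Y_def fst_conv snd_conv using levy_process_char[OF W(1) _ mG] G_pos[OF t(1)] by simp
      also have "\<dots> = (\<Prod>k<m. exp (complex_of_real (G (t (Suc k)) y - G (t k) y) * \<psi> (u k)))"
        using G_mono le leS by (intro prod.cong refl Wexp) auto
      finally show "(CLINT x|N1. iexp (\<Sum>k<m. u k \<bullet> (Y (t (Suc k)) (x, y) - Y (t k) (x, y)))) =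
        (\<Prod>k<m. exp (complex_of_real (G (t (Suc k)) y - G (t k) y) * \<psi> (u k)))" .
    qed
    also have "\<dots> = (\<Prod>k<m. CLINT y|N2. exp (complex_of_real (G (t (Suc k)) y - G (t k) y) * \<psi> (u k)))"
    proof (rule N2.indep_vars_lebesgue_integral)
      have "N2.indep_vars (\<lambda>_. borel) (\<lambda>k y. (\<lambda>x. exp (complex_of_real x * \<psi> (u k))) (G (t (Suc k)) y - G (t k) y)) {..<m}"
        by (rule N2.indep_vars_compose2[OF levy_processD(4)[OF levyG t]]) measurable
      then show "N2.indep_vars (\<lambda>_. borel) (\<lambda>k y. exp (complex_of_real (G (t (Suc k)) y - G (t k) y) * \<psi> (u k))) {..<m}" .
      fix k assume k: "k \<in> {..<m}"
      have [measurable]: "G (t (Suc k)) \<in> borel_measurable N2" "G (t k) \<in> borel_measurable N2"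
        using k le by (auto intro: Gm)
      have "norm (exp (complex_of_real (G (t (Suc k)) y - G (t k) y) * \<psi> (u k))) \<le> 1" for y
        using G_mono[of "t k" "t (Suc k)" y] k le[of k] leS[of k] re[of "u k"] by (simp add: mult_nonneg_nonpos)
      then show "integrable N2 (\<lambda>y. exp (complex_of_real (G (t (Suc k)) y - G (t k) y) * \<psi> (u k)))"
        by (intro N2.integrable_const_bound[where B=1]) auto
    qed simp
    also have "\<dots> = (\<Prod>k<m. exp (complex_of_real (t (Suc k) - t k) * (- complex_of_real \<alpha> * Ln (1 - \<psi> (u k)))))"
    proof (intro prod.cong refl)
      fix k assume k: "k \<in> {..<m}"
      have [measurable]: "G (t (Suc k)) \<in> borel_measurable N2" "G (t k) \<in> borel_measurable N2" "G (t (Suc k) - t k) \<in> borel_measurable N2"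
        using k le leS by (auto intro: Gm)
      have "(CLINT y|N2. exp (complex_of_real (G (t (Suc k)) y - G (t k) y) * \<psi> (u k))) =
        (CLINT x|distr N2 borel (\<lambda>y. G (t (Suc k)) y - G (t k) y). exp (complex_of_real x * \<psi> (u k)))"
        by (rule integral_distr[symmetric]) auto
      also have "distr N2 borel (\<lambda>y. G (t (Suc k)) y - G (t k) y) = distr N2 borel (G (t (Suc k) - t k))"
        using k le leS by (intro levy_processD(5)[OF levyG]) auto
      also have "(CLINT x|distr N2 borel (G (t (Suc k) - t k)). exp (complex_of_real x * \<psi> (u k))) =
        (CLINT y|N2. exp (complex_of_real (G (t (Suc k) - t k) y) * \<psi> (u k)))"
        by (rule integral_distr) auto
      also have "\<dots> = exp (complex_of_real (t (Suc k) - t k) * (- complex_of_real \<alpha> * Ln (1 - \<psi> (u k))))"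
        using k leS by (intro Glap) auto
      finally show "(CLINT y|N2. exp (complex_of_real (G (t (Suc k)) y - G (t k) y) * \<psi> (u k))) =
        exp (complex_of_real (t (Suc k) - t k) * (- complex_of_real \<alpha> * Ln (1 - \<psi> (u k))))" .
    qed
    finally show "(CLINT p|(N1 \<Otimes>\<^sub>M N2). iexp (\<Sum>k<m. u k \<bullet> (Y (t (Suc k)) p - Y (t k) p))) =
      (\<Prod>k<m. exp (complex_of_real (t (Suc k) - t k) * (- complex_of_real \<alpha> * Ln (1 - \<psi> (u k)))))" .
    then show "(CLINT p|(N1 \<Otimes>\<^sub>M N2). iexp (\<Sum>k<m. u k \<bullet> (Y (t (Suc k)) p - Y (t k) p))) =
      (\<Prod>k<m. exp (complex_of_real (t (Suc k) - t k) * (- complex_of_real \<alpha> * Ln (1 - \<psi> (u k)))))" .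
  next
    fix t :: real and u :: 'h assume t: "0 \<le> t"
    have "(CLINT p|(N1 \<Otimes>\<^sub>M N2). iexp (u \<bullet> Y t p)) = (CLINT y|N2. CLINT x|N1. iexp (u \<bullet> Y t (x, y)))"
      using Ym[OF t] by (intro fubini) auto
    also have "\<dots> = (CLINT y|N2. exp (complex_of_real (G t y) * \<psi> u))"
      unfolding Y_def fst_conv snd_conv using G_pos[OF t] by (intro Bochner_Integration.integral_cong refl Wexp)
    also have "\<dots> = exp (complex_of_real t * (- complex_of_real \<alpha> * Ln (1 - \<psi> u)))" by (rule Glap[OF t])
    finally show "(CLINT p|(N1 \<Otimes>\<^sub>M N2). iexp (u \<bullet> Y t p)) = exp (complex_of_real t * (- complex_of_real \<alpha> * Ln (1 - \<psi> u)))" .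
    then show "(CLINT p|(N1 \<Otimes>\<^sub>M N2). iexp (u \<bullet> Y t p)) = exp (complex_of_real t * (- complex_of_real \<alpha> * Ln (1 - \<psi> u)))" .
  qed (use P.prob_space_axioms Ym cadY in auto)
  then show "levy_process (N1 \<Otimes>\<^sub>M N2) (\<lambda>t p. W (G t (snd p)) (fst p))"
    "levy_exponent (N1 \<Otimes>\<^sub>M N2) (\<lambda>t p. W (G t (snd p)) (fst p)) (\<lambda>u. - complex_of_real \<alpha> * Ln (1 - \<psi> u))"
    unfolding Y_def[abs_def] by auto
qed

section \<open>Transport of processes along measure-preserving maps, and coding of sample
  spaces\<close>

lemma integral_pullback:
  fixes f :: "'a \<Rightarrow> 'b::{banach, second_countable_topology}"
  assumes "h \<in> measurable M' M" "distr M' M h = M" "f \<in> borel_measurable M"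
  shows "(LINT x|M'. f (h x)) = (LINT x|M. f x)"
  using integral_distr[OF assms(1,3)] assms(2) by simp

lemma levy_process_pullback:
  fixes X :: "real \<Rightarrow> 'w \<Rightarrow> 'h::{real_inner, second_countable_topology}" and h :: "'v \<Rightarrow> 'w"
  assumes X: "levy_process M X" and p: "prob_space M'" and h: "h \<in> measurable M' M" "distr M' M h = M"
  shows "levy_process M' (\<lambda>t \<omega>. X t (h \<omega>))"
  unfolding levy_process_def
proof (intro conjI allI impI)
  interpret M: prob_space M using X by (rule levy_processD)
  interpret M': prob_space M' by (rule p)
  note m = levy_processD(2)[OF X]
  show "prob_space M'" by (rule p)
  show mh: "(\<lambda>\<omega>. X t (h \<omega>)) \<in> borel_measurable M'" if "0 \<le> t" for t
    using h(1) m[OF that] by (rule measurable_compose)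
  have AE_h: "AE \<omega> in M'. R (h \<omega>)" if "AE \<omega> in M. R \<omega>" for R
    using that AE_distrD[OF h(1)] by (simp only: h(2))
  show "AE \<omega> in M'. X 0 (h \<omega>) = 0" "AE \<omega> in M'. cadlag (\<lambda>t. X t (h \<omega>))"
    using levy_processD(3,6)[OF X] by (auto intro: AE_h)
  show "distr M' borel (\<lambda>\<omega>. X t (h \<omega>) - X s (h \<omega>)) = distr M' borel (\<lambda>\<omega>. X (t - s) (h \<omega>))"
    if st: "0 \<le> s \<and> s \<le> t" for s t
  proof -
    have "distr M' borel (\<lambda>\<omega>. X t (h \<omega>) - X s (h \<omega>)) = distr (distr M' M h) borel (\<lambda>\<omega>. X t \<omega> - X s \<omega>)"
      using st h m by (subst distr_distr) (auto simp: o_def)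
    also have "\<dots> = distr (distr M' M h) borel (X (t - s))"
      unfolding h(2) using st by (intro levy_processD(5)[OF X]) auto
    also have "\<dots> = distr M' borel (\<lambda>\<omega>. X (t - s) (h \<omega>))"
      using st h m by (subst distr_distr) (auto simp: o_def)
    finally show ?thesis .
  qed
  fix n :: nat and t :: "nat \<Rightarrow> real" assume t: "0 \<le> t 0 \<and> mono_on {..n} t"
  have t0: "0 \<le> t k" if "k \<le> n" for k using t mono_onD[of "{..n}" t 0 k] that by auto
  have dm: "(\<lambda>\<omega>. X (t (Suc k)) \<omega> - X (t k) \<omega>) \<in> borel_measurable M" if "k < n" for k
    using that t0 by (intro borel_measurable_diff m) auto
  show "M'.indep_vars (\<lambda>_. borel) (\<lambda>k \<omega>. X (t (Suc k)) (h \<omega>) - X (t k) (h \<omega>)) {..<n}"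
  proof (rule M'.indep_vars_char)
    show "(\<lambda>\<omega>. X (t (Suc k)) (h \<omega>) - X (t k) (h \<omega>)) \<in> borel_measurable M'" if "k \<in> {..<n}" for k
      using that t0 by (intro borel_measurable_diff mh) auto
    fix u :: "nat \<Rightarrow> 'h"
    have "(CLINT \<omega>|M'. iexp (\<Sum>k<n. u k \<bullet> (X (t (Suc k)) (h \<omega>) - X (t k) (h \<omega>)))) =
      (CLINT \<omega>|M. iexp (\<Sum>k<n. u k \<bullet> (X (t (Suc k)) \<omega> - X (t k) \<omega>)))"
    proof (rule integral_pullback[OF h])
      have [measurable]: "(\<lambda>\<omega>. \<Sum>k<n. u k \<bullet> (X (t (Suc k)) \<omega> - X (t k) \<omega>)) \<in> borel_measurable M"
        using dm by (intro borel_measurable_sum borel_measurable_inner borel_measurable_const) auto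
      show "(\<lambda>\<omega>. iexp (\<Sum>k<n. u k \<bullet> (X (t (Suc k)) \<omega> - X (t k) \<omega>))) \<in> borel_measurable M" by measurable
    qed
    also have "\<dots> = (\<Prod>k<n. CLINT \<omega>|M. iexp (u k \<bullet> (X (t (Suc k)) \<omega> - X (t k) \<omega>)))"
      using t by (intro M.char_indep_sum levy_processD(4)[OF X]) auto
    also have "\<dots> = (\<Prod>k<n. CLINT \<omega>|M'. iexp (u k \<bullet> (X (t (Suc k)) (h \<omega>) - X (t k) (h \<omega>))))"
    proof (intro prod.cong refl integral_pullback[OF h, symmetric])
      fix k assume "k \<in> {..<n}"
      then have [measurable]: "(\<lambda>\<omega>. X (t (Suc k)) \<omega> - X (t k) \<omega>) \<in> borel_measurable M" by (intro dm) simp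
      show "(\<lambda>\<omega>. iexp (u k \<bullet> (X (t (Suc k)) \<omega> - X (t k) \<omega>))) \<in> borel_measurable M" by measurable
    qed
    finally show "(CLINT \<omega>|M'. iexp (\<Sum>k<n. u k \<bullet> (X (t (Suc k)) (h \<omega>) - X (t k) (h \<omega>)))) =
      (\<Prod>k<n. CLINT \<omega>|M'. iexp (u k \<bullet> (X (t (Suc k)) (h \<omega>) - X (t k) (h \<omega>))))" .
  qed simp
qed

lemma levy_exponent_pullback:
  fixes X :: "real \<Rightarrow> 'w \<Rightarrow> 'h::{real_inner, second_countable_topology}"
  assumes X: "levy_process M X" "levy_exponent M X \<psi>" and h: "h \<in> measurable M' M" "distr M' M h = M"
  shows "levy_exponent M' (\<lambda>t \<omega>. X t (h \<omega>)) \<psi>"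
  unfolding levy_exponent_def
proof (intro allI impI)
  fix t :: real and u :: 'h assume t: "0 \<le> t"
  have [measurable]: "X t \<in> borel_measurable M" using levy_processD(2)[OF X(1) t] .
  have "(CLINT \<omega>|M'. iexp (u \<bullet> X t (h \<omega>))) = (CLINT \<omega>|M. iexp (u \<bullet> X t \<omega>))"
    by (rule integral_pullback[OF h]) measurable
  then show "(CLINT \<omega>|M'. iexp (u \<bullet> X t (h \<omega>))) = exp (complex_of_real t * \<psi> u)"
    using X(2) t by (simp add: levy_exponent_def)
qed

lemma gamma_process_pullback:
  assumes G: "gamma_process \<alpha> \<theta> M G" and p: "prob_space M'" and h: "h \<in> measurable M' M" "distr M' M h = M"
  shows "gamma_process \<alpha> \<theta> M' (\<lambda>t \<omega>. G t (h \<omega>))"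
  unfolding gamma_process_def
proof (intro conjI allI impI)
  show "0 < \<alpha>" "0 < \<theta>" using G by (auto simp: gamma_process_def)
  show "levy_process M' (\<lambda>t \<omega>. G t (h \<omega>))"
    using G by (intro levy_process_pullback[OF _ p h]) (simp add: gamma_process_def)
  fix t :: real assume "0 < t"
  then have d: "distributed M lborel (G t) (\<lambda>x. ennreal (gamma_density (\<alpha> * t) \<theta> x))"
    using G by (simp add: gamma_process_def)
  then have m: "G t \<in> measurable M lborel" by (simp add: distributed_def)
  have "distr M' lborel (\<lambda>\<omega>. G t (h \<omega>)) = distr (distr M' M h) lborel (G t)"
    using m h by (subst distr_distr) (auto simp: o_def)
  then show "distributed M' lborel (\<lambda>\<omega>. G t (h \<omega>)) (\<lambda>x. ennreal (gamma_density (\<alpha> * t) \<theta> x))"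
    using d measurable_compose[OF h(1) m] unfolding distributed_def h(2) by simp
qed

text \<open>Processes on codable sample spaces can be transported to \<open>nat \<Rightarrow> real\<close>, the sample space in the definition of variance gamma processes.\<close>

definition real_codable :: "'a measure \<Rightarrow> bool" where
  "real_codable M \<longleftrightarrow> (\<exists>f\<in>measurable M (Pi\<^sub>M (UNIV :: nat set) (\<lambda>_. borel :: real measure)).
     \<exists>g\<in>measurable (Pi\<^sub>M (UNIV :: nat set) (\<lambda>_. borel)) M. \<forall>x\<in>space M. g (f x) = x)"

text \<open>A point is coded by its distances to a dense sequence. It is recovered as the limit of
  the members of least index within \<open>(1/2) ^ m\<close> of it.\<close>

lemma real_codable_borel:
  "real_codable (borel :: 'h::{banach, second_countable_topology} measure)"
proof -
  obtain D :: "'h set" where D: "countable D" "\<And>X. open X \<Longrightarrow> X \<noteq> {} \<Longrightarrow> \<exists>d\<in>D. d \<in> X"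
    using countable_dense_exists by metis
  have ne: "D \<noteq> {}" using D(2)[of UNIV] by auto
  define c where "c = from_nat_into D"
  have c: "\<exists>n. dist x (c n) < e" if "0 < e" for x e
  proof -
    obtain d where "d \<in> D" "d \<in> ball x e" using D(2)[of "ball x e"] \<open>0 < e\<close> by auto
    moreover have "D = range c" unfolding c_def using range_from_nat_into[OF ne D(1)] by simp
    ultimately show ?thesis by auto
  qed
  define f where "f x n = dist x (c n)" for x n
  define k where "k m y = (LEAST n. y n < (1/2) ^ m)" for m and y :: "nat \<Rightarrow> real"
  define g where "g y = lim (\<lambda>m. c (k m y))" for y
  have f: "f \<in> measurable borel (Pi\<^sub>M UNIV (\<lambda>_. borel))"
    unfolding f_def[abs_def] by (rule measurable_PiM_single') auto
  have km: "k m \<in> measurable (Pi\<^sub>M UNIV (\<lambda>_. borel)) (count_space UNIV)" for m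
    unfolding k_def[abs_def] by measurable
  have g: "g \<in> borel_measurable (Pi\<^sub>M UNIV (\<lambda>_. borel))"
    unfolding g_def[abs_def]
    by (rule borel_measurable_lim_metric) (rule measurable_compose[OF km], simp)
  have "g (f x) = x" for x
  proof -
    have "dist x (c (k m (f x))) < (1/2) ^ m" for m
      using LeastI_ex[OF c[of "(1/2) ^ m" x]] by (simp add: k_def f_def)
    then have "(\<lambda>m. c (k m (f x))) \<longlonglongrightarrow> x"
      by (intro metric_tendsto_imp_tendsto[OF LIMSEQ_power_zero[of "1/2 :: real"]] always_eventually allI)
        (auto simp: dist_commute less_imp_le)
    then show ?thesis unfolding g_def by (rule limI)
  qed
  then show ?thesis unfolding real_codable_def using f g by blast
qed

lemma real_codable_PiM:
  fixes M :: "('i::countable \<Rightarrow> 'h::{banach, second_countable_topology}) measure"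
  assumes sets: "sets M = sets (Pi\<^sub>M UNIV (\<lambda>_. borel))"
  shows "real_codable M"
proof -
  obtain f and g :: "(nat \<Rightarrow> real) \<Rightarrow> 'h" where f: "f \<in> measurable borel (Pi\<^sub>M (UNIV :: nat set) (\<lambda>_. borel :: real measure))"
    and g: "g \<in> borel_measurable (Pi\<^sub>M (UNIV :: nat set) (\<lambda>_. borel :: real measure))" and gf0: "\<forall>x\<in>space borel. g (f x) = x"
    using real_codable_borel[where 'h='h] unfolding real_codable_def by blast
  have gf: "g (f x) = x" for x using gf0 by simp
  define F where "F \<omega> n = f (\<omega> (from_nat (fst (prod_decode n)))) (snd (prod_decode n))" for \<omega> :: "'i \<Rightarrow> 'h" and n
  define H where "H y i = g (\<lambda>m. y (prod_encode (to_nat i, m)))" for y and i :: 'i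
  have "(\<lambda>x. f x m) \<in> borel_measurable borel" for m
    using measurable_compose[OF f measurable_component_singleton[of m]] by simp
  then have "(\<lambda>\<omega>. f (\<omega> i) m) \<in> borel_measurable (Pi\<^sub>M UNIV (\<lambda>_. borel))" for i :: 'i and m
    by (rule measurable_compose[rotated]) simp
  then have "F \<in> measurable (Pi\<^sub>M UNIV (\<lambda>_. borel)) (Pi\<^sub>M UNIV (\<lambda>_. borel))"
    unfolding F_def[abs_def] by (intro measurable_PiM_single') auto
  then have F: "F \<in> measurable M (Pi\<^sub>M UNIV (\<lambda>_. borel))"
    using measurable_cong_sets[OF sets refl] by blast
  have "(\<lambda>y m. y (prod_encode (to_nat i, m))) \<in> measurable (Pi\<^sub>M UNIV (\<lambda>_. borel :: real measure)) (Pi\<^sub>M UNIV (\<lambda>_. borel))" for i :: 'i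
    by (rule measurable_PiM_single') auto
  then have "H \<in> measurable (Pi\<^sub>M UNIV (\<lambda>_. borel)) (Pi\<^sub>M UNIV (\<lambda>_. borel))"
    unfolding H_def[abs_def] by (intro measurable_PiM_single' measurable_compose[OF _ g]) auto
  then have H: "H \<in> measurable (Pi\<^sub>M UNIV (\<lambda>_. borel)) M"
    using measurable_cong_sets[OF refl sets] by blast
  have "H (F \<omega>) = \<omega>" for \<omega> by (rule ext) (simp add: F_def H_def gf)
  then show ?thesis unfolding real_codable_def using F H by blast
qed

lemma real_codable_pair:
  assumes "real_codable M" "real_codable N"
  shows "real_codable (M \<Otimes>\<^sub>M N)"
proof -
  obtain f g where f [measurable]: "f \<in> measurable M (Pi\<^sub>M (UNIV :: nat set) (\<lambda>_. borel :: real measure))"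
    and g [measurable]: "g \<in> measurable (Pi\<^sub>M (UNIV :: nat set) (\<lambda>_. borel)) M" and gf: "\<And>x. x \<in> space M \<Longrightarrow> g (f x) = x"
    using assms(1) unfolding real_codable_def by blast
  obtain f' g' where f' [measurable]: "f' \<in> measurable N (Pi\<^sub>M (UNIV :: nat set) (\<lambda>_. borel :: real measure))"
    and g' [measurable]: "g' \<in> measurable (Pi\<^sub>M (UNIV :: nat set) (\<lambda>_. borel)) N" and gf': "\<And>x. x \<in> space N \<Longrightarrow> g' (f' x) = x"
    using assms(2) unfolding real_codable_def by blast
  define F where "F p n = (if even n then f (fst p) (n div 2) else f' (snd p) (n div 2))" for p and n :: nat
  define H where "H y = (g (\<lambda>m. y (2 * m)), g' (\<lambda>m. y (Suc (2 * m))))" for y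
  have c: "(\<lambda>p. f (fst p) m) \<in> borel_measurable (M \<Otimes>\<^sub>M N)" "(\<lambda>p. f' (snd p) m) \<in> borel_measurable (M \<Otimes>\<^sub>M N)" for m
    using measurable_compose[OF measurable_compose[OF measurable_fst f] measurable_component_singleton[of m]]
      measurable_compose[OF measurable_compose[OF measurable_snd f'] measurable_component_singleton[of m]] by auto
  have F: "F \<in> measurable (M \<Otimes>\<^sub>M N) (Pi\<^sub>M UNIV (\<lambda>_. borel))"
    unfolding F_def[abs_def] by (rule measurable_PiM_single') (auto intro: c)
  have "(\<lambda>y m. y (2 * m)) \<in> measurable (Pi\<^sub>M UNIV (\<lambda>_. borel :: real measure)) (Pi\<^sub>M UNIV (\<lambda>_. borel))"
    "(\<lambda>y m. y (Suc (2 * m))) \<in> measurable (Pi\<^sub>M UNIV (\<lambda>_. borel :: real measure)) (Pi\<^sub>M UNIV (\<lambda>_. borel))"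
    by (rule measurable_PiM_single'; auto)+
  then have H: "H \<in> measurable (Pi\<^sub>M UNIV (\<lambda>_. borel)) (M \<Otimes>\<^sub>M N)"
    unfolding H_def[abs_def] by (intro measurable_Pair measurable_compose[OF _ g] measurable_compose[OF _ g'])
  have "H (F p) = p" if "p \<in> space (M \<Otimes>\<^sub>M N)" for p
    using that by (auto simp: H_def F_def gf gf' space_pair_measure)
  then show ?thesis unfolding real_codable_def using F H by blast
qed

text \<open>The law is pushed forward along the code. The decoder is then measure-preserving, and
  processes are transported by composing with it.\<close>

lemma real_codable_pullback:
  assumes "real_codable M" "prob_space M"
  obtains M' :: "(nat \<Rightarrow> real) measure" and h where "prob_space M'" "h \<in> measurable M' M" "distr M' M h = M"
proof -
  obtain f g where f: "f \<in> measurable M (Pi\<^sub>M (UNIV :: nat set) (\<lambda>_. borel :: real measure))"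
    and g: "g \<in> measurable (Pi\<^sub>M (UNIV :: nat set) (\<lambda>_. borel)) M" and gf: "\<And>x. x \<in> space M \<Longrightarrow> g (f x) = x"
    using assms(1) unfolding real_codable_def by blast
  let ?M' = "distr M (Pi\<^sub>M UNIV (\<lambda>_. borel)) f"
  have "distr ?M' M g = distr M M (g \<circ> f)" using g f by (rule distr_distr)
  also have "\<dots> = distr M M (\<lambda>x. x)" using gf by (intro distr_cong) auto
  finally have "distr ?M' M g = M" by (simp add: distr_id2)
  moreover have "g \<in> measurable ?M' M" using g by simp
  moreover have "prob_space ?M'" using assms(2) f by (rule prob_space.prob_space_distr)
  ultimately show thesis using that by blast
qed

context gaussian_base
begin

lemma Re_expo: "Re (expo u) \<le> 0"
  using psd_operatorD(3)[OF Q, of u] by (simp add: expo_def)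

text \<open>Brownian motion and clock come from the two factors of a product space, so their path
  laws are independent. Independence is recorded as the equality of the joint path law with the
  product, the form in which \<open>indep_var\<close> is later verified.\<close>

theorem subordinated_brownian_exists:
  assumes "0 < \<alpha>"
  obtains M :: "(nat \<Rightarrow> real) measure" and W :: "real \<Rightarrow> (nat \<Rightarrow> real) \<Rightarrow> 'h" and G where
    "levy_process M W" "levy_exponent M W expo" "\<And>\<omega>. continuous_on {0..} (\<lambda>t. W t \<omega>)"
    "gamma_process \<alpha> 1 M G"
    "distr M (Pi\<^sub>M {0..} (\<lambda>_. borel)) (sample_path W) \<Otimes>\<^sub>M distr M (Pi\<^sub>M {0..} (\<lambda>_. borel)) (sample_path G) =
       distr M (Pi\<^sub>M {0..} (\<lambda>_. borel) \<Otimes>\<^sub>M Pi\<^sub>M {0..} (\<lambda>_. borel)) (\<lambda>\<omega>. (sample_path W \<omega>, sample_path G \<omega>))"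
    "levy_process M (\<lambda>t \<omega>. W (G t \<omega>) \<omega>)"
    "levy_exponent M (\<lambda>t \<omega>. W (G t \<omega>) \<omega>) (\<lambda>u. - complex_of_real \<alpha> * Ln (1 - expo u))"
proof -
  obtain N1 :: "(nat \<times> nat \<Rightarrow> 'h) measure" and B where B: "levy_process N1 B" "levy_exponent N1 B expo"
    "sets N1 = sets (Pi\<^sub>M UNIV (\<lambda>_. borel))" "\<And>\<omega>. continuous_on {0..} (\<lambda>t. B t \<omega>)"
    using brownian_exists by blast
  obtain N2 :: "(nat \<times> nat \<Rightarrow> real) measure" and G where G: "gamma_process \<alpha> 1 N2 G"
    "sets N2 = sets (Pi\<^sub>M UNIV (\<lambda>_. borel))"
    "\<And>\<omega> s t. 0 \<le> s \<Longrightarrow> s \<le> t \<Longrightarrow> G s \<omega> \<le> G t \<omega>" "\<And>\<omega> t. 0 \<le> t \<Longrightarrow> 0 \<le> G t \<omega>"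
    "\<And>\<omega>. cadlag (\<lambda>t. G t \<omega>)"
    using gamma_process_exists[OF assms] by blast
  have GL: "levy_process N2 G" using G(1) by (simp add: gamma_process_def)
  interpret N1: prob_space N1 using B(1) by (rule levy_processD)
  interpret N2: prob_space N2 using GL by (rule levy_processD)
  interpret P: pair_prob_space N1 N2 ..
  have "real_codable (N1 \<Otimes>\<^sub>M N2)" by (intro real_codable_pair real_codable_PiM B(3) G(2))
  then obtain M :: "(nat \<Rightarrow> real) measure" and h where M: "prob_space M"
    and h: "h \<in> measurable M (N1 \<Otimes>\<^sub>M N2)" "distr M (N1 \<Otimes>\<^sub>M N2) h = N1 \<Otimes>\<^sub>M N2"
    using real_codable_pullback[OF _ P.prob_space_axioms] by blast
  have h1: "(\<lambda>\<omega>. fst (h \<omega>)) \<in> measurable M N1" and h2: "(\<lambda>\<omega>. snd (h \<omega>)) \<in> measurable M N2"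
    using h(1) by measurable
  have d1: "distr M N1 (\<lambda>\<omega>. fst (h \<omega>)) = N1"
  proof -
    have "distr M N1 (\<lambda>\<omega>. fst (h \<omega>)) = distr (distr M (N1 \<Otimes>\<^sub>M N2) h) N1 fst"
      using h(1) by (subst distr_distr) (auto simp: o_def)
    then show ?thesis unfolding h(2) using N2.distr_pair_fst[of N1] by simp
  qed
  have d2: "distr M N2 (\<lambda>\<omega>. snd (h \<omega>)) = N2"
  proof -
    have "distr M N2 (\<lambda>\<omega>. snd (h \<omega>)) = distr (distr M (N1 \<Otimes>\<^sub>M N2) h) N2 snd"
      using h(1) by (subst distr_distr) (auto simp: o_def)
    also have "\<dots> = N2"
      unfolding h(2)
    proof (rule measure_eqI)
      fix A assume "A \<in> sets (distr (N1 \<Otimes>\<^sub>M N2) N2 snd)"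
      then have A: "A \<in> sets N2" by simp
      have "snd -` A \<inter> space (N1 \<Otimes>\<^sub>M N2) = space N1 \<times> A"
        using sets.sets_into_space[OF A] by (auto simp: space_pair_measure)
      then show "emeasure (distr (N1 \<Otimes>\<^sub>M N2) N2 snd) A = emeasure N2 A"
        using A by (simp add: emeasure_distr N2.emeasure_pair_measure_Times N1.emeasure_space_1)
    qed simp
    finally show ?thesis .
  qed
  define W' where "W' t \<omega> = B t (fst (h \<omega>))" for t \<omega>
  define G' where "G' t \<omega> = G t (snd (h \<omega>))" for t \<omega>
  let ?S = "Pi\<^sub>M {0..} (\<lambda>_. borel :: 'h measure)" and ?T = "Pi\<^sub>M {0..} (\<lambda>_. borel :: real measure)"
  note mB = measurable_sample_path[of B, OF levy_processD(2)[OF B(1)]]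
    and mG = measurable_sample_path[of G, OF levy_processD(2)[OF GL]]
  have sW: "sample_path W' = sample_path B \<circ> (\<lambda>\<omega>. fst (h \<omega>))" and sG: "sample_path G' = sample_path G \<circ> (\<lambda>\<omega>. snd (h \<omega>))"
    by (auto simp: sample_path_def W'_def G'_def fun_eq_iff)
  have ind: "distr M ?S (sample_path W') \<Otimes>\<^sub>M distr M ?T (sample_path G') =
       distr M (?S \<Otimes>\<^sub>M ?T) (\<lambda>\<omega>. (sample_path W' \<omega>, sample_path G' \<omega>))"
  proof -
    have "distr M ?S (sample_path W') = distr N1 ?S (sample_path B)"
    proof -
      have "distr (distr M N1 (\<lambda>\<omega>. fst (h \<omega>))) ?S (sample_path B) = distr M ?S (sample_path W')"
        unfolding sW by (rule distr_distr[OF mB h1])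
      moreover have "distr (distr M N1 (\<lambda>\<omega>. fst (h \<omega>))) ?S (sample_path B) = distr N1 ?S (sample_path B)"
        using d1 by (rule arg_cong)
      ultimately show ?thesis by metis
    qed
    moreover have "distr M ?T (sample_path G') = distr N2 ?T (sample_path G)"
    proof -
      have "distr (distr M N2 (\<lambda>\<omega>. snd (h \<omega>))) ?T (sample_path G) = distr M ?T (sample_path G')"
        unfolding sG by (rule distr_distr[OF mG h2])
      moreover have "distr (distr M N2 (\<lambda>\<omega>. snd (h \<omega>))) ?T (sample_path G) = distr N2 ?T (sample_path G)"
        using d2 by (rule arg_cong)
      ultimately show ?thesis by metis
    qed
    moreover have "distr N1 ?S (sample_path B) \<Otimes>\<^sub>M distr N2 ?T (sample_path G) =
      distr (N1 \<Otimes>\<^sub>M N2) (?S \<Otimes>\<^sub>M ?T) (\<lambda>(x, y). (sample_path B x, sample_path G y))"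
      using N2.prob_space_distr[OF mG] by (intro pair_measure_distr mB mG prob_space_imp_sigma_finite)
    moreover have "distr M (?S \<Otimes>\<^sub>M ?T) (\<lambda>\<omega>. (sample_path W' \<omega>, sample_path G' \<omega>)) =
      distr (distr M (N1 \<Otimes>\<^sub>M N2) h) (?S \<Otimes>\<^sub>M ?T) (\<lambda>(x, y). (sample_path B x, sample_path G y))"
    proof (subst distr_distr[OF _ h(1)])
      show "(\<lambda>(x, y). (sample_path B x, sample_path G y)) \<in> measurable (N1 \<Otimes>\<^sub>M N2) (?S \<Otimes>\<^sub>M ?T)"
        using mB mG by measurable
    qed (auto simp: sW sG o_def case_prod_beta)
    ultimately show ?thesis
      unfolding h(2) by simp
  qed
  note sub = subordinate_levy[OF B(1,2) Re_expo B(4) G(1) G(3,4,5)]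
  show thesis
  proof (rule that[of M W' G'])
    show "levy_process M W'" unfolding W'_def[abs_def] by (rule levy_process_pullback[OF B(1) M h1 d1])
    show "levy_exponent M W' expo" unfolding W'_def[abs_def] by (rule levy_exponent_pullback[OF B(1,2) h1 d1])
    show "continuous_on {0..} (\<lambda>t. W' t \<omega>)" for \<omega> unfolding W'_def by (rule B(4))
    show "gamma_process \<alpha> 1 M G'" unfolding G'_def[abs_def] by (rule gamma_process_pullback[OF G(1) M h2 d2])
    show "levy_process M (\<lambda>t \<omega>. W' (G' t \<omega>) \<omega>)"
      unfolding W'_def G'_def by (rule levy_process_pullback[OF sub(1) M h])
    show "levy_exponent M (\<lambda>t \<omega>. W' (G' t \<omega>) \<omega>) (\<lambda>u. - complex_of_real \<alpha> * Ln (1 - expo u))"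
      unfolding W'_def G'_def by (rule levy_exponent_pullback[OF sub h])
  qed (rule ind)
qed

end

section \<open>Gaussian mixtures\<close>

context gaussian_base
begin

lemma char_normal_projection: "distr \<gamma> borel (\<lambda>x. u \<bullet> x) = normal_law 0 (Q u \<bullet> u)"
proof (rule normal_law_eqI)
  show "finite_measure (distr \<gamma> borel (\<lambda>x. u \<bullet> x))" by (rule finite_measure_distr) measurable
  show "0 \<le> Q u \<bullet> u" by (rule psd_operatorD[OF Q])
  fix t :: real
  have "(CLINT x|distr \<gamma> borel (\<lambda>x. u \<bullet> x). iexp (t * x)) = (CLINT x|\<gamma>. iexp ((t *\<^sub>R u) \<bullet> x))"
    by (subst integral_distr) auto
  also have "\<dots> = exp (\<i> * complex_of_real (t * 0) - complex_of_real (Q u \<bullet> u * t\<^sup>2 / 2))"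
    unfolding char_gamma
    by (simp add: linear_cmul[OF bounded_linear.linear[OF psd_operatorD(1)[OF Q]]] power2_eq_square mult_ac)
  finally show "(CLINT x|distr \<gamma> borel (\<lambda>x. u \<bullet> x). iexp (t * x)) = exp (\<i> * complex_of_real (t * 0) - complex_of_real (Q u \<bullet> u * t\<^sup>2 / 2))" .
qed simp

lemma projection_moments:
  "integrable \<gamma> (\<lambda>x. u \<bullet> x)" "(LINT x|\<gamma>. u \<bullet> x) = 0"
  "integrable \<gamma> (\<lambda>x. (u \<bullet> x)\<^sup>2)" "(LINT x|\<gamma>. (u \<bullet> x)\<^sup>2) = Q u \<bullet> u"
proof -
  have v: "0 \<le> Q u \<bullet> u" by (rule psd_operatorD[OF Q])
  note m = normal_law_moments[OF v]
  have [measurable]: "(\<lambda>x. u \<bullet> x) \<in> borel_measurable \<gamma>" by measurable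
  show "integrable \<gamma> (\<lambda>x. u \<bullet> x)"
    using m(1)[of 1] unfolding char_normal_projection[symmetric] by (subst (asm) integrable_distr_eq) auto
  show "integrable \<gamma> (\<lambda>x. (u \<bullet> x)\<^sup>2)"
    using m(1)[of 2] unfolding char_normal_projection[symmetric] by (subst (asm) integrable_distr_eq) auto
  show "(LINT x|\<gamma>. u \<bullet> x) = 0"
    using m(2) unfolding char_normal_projection[symmetric] by (subst (asm) integral_distr) auto
  show "(LINT x|\<gamma>. (u \<bullet> x)\<^sup>2) = Q u \<bullet> u"
    using m(3) unfolding char_normal_projection[symmetric] by (subst (asm) integral_distr) auto
qed

text \<open>Polarisation: the one-dimensional projections supply variances only.\<close>

lemma projection_covariance:
  "integrable \<gamma> (\<lambda>z. (z \<bullet> x) * (z \<bullet> y))" "(LINT z|\<gamma>. (z \<bullet> x) * (z \<bullet> y)) = Q x \<bullet> y"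
proof -
  have e: "(z \<bullet> x) * (z \<bullet> y) = (((x + y) \<bullet> z)\<^sup>2 - ((x - y) \<bullet> z)\<^sup>2) / 4" for z
    by (simp add: inner_add_left inner_diff_left power2_eq_square inner_commute algebra_simps)
  show "integrable \<gamma> (\<lambda>z. (z \<bullet> x) * (z \<bullet> y))"
    unfolding e by (intro integrable_divide_zero Bochner_Integration.integrable_diff projection_moments)
  note l = bounded_linear.linear[OF psd_operatorD(1)[OF Q]]
  have "(LINT z|\<gamma>. (z \<bullet> x) * (z \<bullet> y)) = (Q (x + y) \<bullet> (x + y) - Q (x - y) \<bullet> (x - y)) / 4"
    unfolding e by (simp add: projection_moments)
  also have "\<dots> = Q x \<bullet> y"
    using psd_operatorD(2)[OF Q, of x y]
    by (simp add: linear_add[OF l] linear_diff[OF l] inner_add_left inner_add_right inner_diff_left inner_diff_right inner_commute[of x])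
  finally show "(LINT z|\<gamma>. (z \<bullet> x) * (z \<bullet> y)) = Q x \<bullet> y" .
qed

lemma norm_moments: "integrable \<gamma> (\<lambda>z. norm z)" "integrable \<gamma> (\<lambda>z. (norm z)\<^sup>2)"
proof -
  have b: "x \<le> 1 + x ^ 4" "x\<^sup>2 \<le> 1 + x ^ 4" if "0 \<le> x" for x :: real
  proof -
    have "x ^ 4 = (x\<^sup>2)\<^sup>2" by (simp flip: power_mult)
    then show 2: "x\<^sup>2 \<le> 1 + x ^ 4"
      using sum_squares_bound[of 1 "x\<^sup>2"] zero_le_power2[of x] unfolding power_one mult_1_right by linarith
    show "x \<le> 1 + x ^ 4"
    proof (cases "x \<le> 1")
      case False
      then have "x ^ 1 \<le> x ^ 4" by (intro power_increasing) auto
      then show ?thesis by simp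
    qed (use that in \<open>simp add: add_increasing2\<close>)
  qed
  have i: "integrable \<gamma> (\<lambda>z. 1 + norm z ^ 4)" using fourth_moment_integrable by simp
  show "integrable \<gamma> (\<lambda>z. norm z)" "integrable \<gamma> (\<lambda>z. (norm z)\<^sup>2)"
    by (rule Bochner_Integration.integrable_bound[OF i]; use b in auto)+
qed

text \<open>This makes the definite description meaningful: the projections determine the
  characteristic function, which determines the measure.\<close>

lemma gaussian_measure_eq:
  assumes t: "0 \<le> t"
  shows "gaussian_measure (t *\<^sub>R b) (\<lambda>x. t *\<^sub>R Q x) = gauss t"
  unfolding gaussian_measure_def
proof (rule the_equality)
  have v: "0 \<le> (t *\<^sub>R Q u) \<bullet> u" for u using t psd_operatorD(3)[OF Q, of u] by simp
  show "sets (gauss t) = sets borel \<and>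
    (\<forall>u. distr (gauss t) borel (\<lambda>x. x \<bullet> u) = normal_law ((t *\<^sub>R b) \<bullet> u) ((t *\<^sub>R Q u) \<bullet> u))"
  proof (intro conjI allI)
    fix u
    show "distr (gauss t) borel (\<lambda>x. x \<bullet> u) = normal_law ((t *\<^sub>R b) \<bullet> u) ((t *\<^sub>R Q u) \<bullet> u)"
    proof (rule normal_law_eqI[OF _ _ v])
      interpret G: prob_space "gauss t" by (rule prob_space_gauss)
      show "finite_measure (distr (gauss t) borel (\<lambda>x. x \<bullet> u))" by (rule G.finite_measure_distr) measurable
      fix s :: real
      have "(CLINT x|distr (gauss t) borel (\<lambda>x. x \<bullet> u). iexp (s * x)) = (CLINT x|gauss t. iexp ((s *\<^sub>R u) \<bullet> x))"
        by (subst integral_distr) (auto simp: inner_commute)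
      also have "\<dots> = exp (\<i> * complex_of_real (s * ((t *\<^sub>R b) \<bullet> u)) - complex_of_real ((t *\<^sub>R Q u) \<bullet> u * s\<^sup>2 / 2))"
        unfolding char_gauss[OF t]
        by (intro arg_cong[where f=exp]) (simp add: expo_def linear_cmul[OF bounded_linear.linear[OF psd_operatorD(1)[OF Q]]]
           inner_commute power2_eq_square algebra_simps)
      finally show "(CLINT x|distr (gauss t) borel (\<lambda>x. x \<bullet> u). iexp (s * x)) =
        exp (\<i> * complex_of_real (s * ((t *\<^sub>R b) \<bullet> u)) - complex_of_real ((t *\<^sub>R Q u) \<bullet> u * s\<^sup>2 / 2))" .
    qed simp
  qed simp
  fix \<nu> :: "'h measure"
  assume nu: "sets \<nu> = sets borel \<and> (\<forall>u. distr \<nu> borel (\<lambda>x. x \<bullet> u) = normal_law ((t *\<^sub>R b) \<bullet> u) ((t *\<^sub>R Q u) \<bullet> u))"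
  then have [measurable_cong]: "sets \<nu> = sets borel" by simp
  have d: "distr \<nu> borel (\<lambda>x. x \<bullet> u) = normal_law ((t *\<^sub>R b) \<bullet> u) ((t *\<^sub>R Q u) \<bullet> u)" for u using nu by simp
  \<comment> \<open>A competitor \<open>\<nu>\<close> comes without finiteness, which uniqueness by
    characteristic functions requires. Its total mass is read off from the projection along
    0.\<close>
  have "emeasure (distr \<nu> borel (\<lambda>x. x \<bullet> 0)) UNIV = 1"
    unfolding d using prob_space.emeasure_space_1[OF prob_space_normal_law[OF v, of "(t *\<^sub>R b) \<bullet> 0" 0]]
      sets_eq_imp_space_eq[OF sets_normal_law] by simp
  then have "emeasure \<nu> (space \<nu>) = 1" by (subst (asm) emeasure_distr) auto
  then have fin: "finite_measure \<nu>" by (intro finite_measureI) simp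
  show "\<nu> = gauss t"
  proof (rule measure_eqI_char[OF fin])
    show "finite_measure (gauss t)" using prob_space_gauss by (rule prob_space.finite_measure)
    fix u
    have "(CLINT x|\<nu>. iexp (u \<bullet> x)) = (CLINT y|distr \<nu> borel (\<lambda>x. x \<bullet> u). iexp (1 * y))"
      by (subst integral_distr) (auto simp: inner_commute)
    also have "\<dots> = exp (complex_of_real t * expo u)"
      unfolding d char_normal_law[OF v] by (intro arg_cong[where f=exp]) (simp add: expo_def inner_commute algebra_simps)
    finally show "(CLINT x|\<nu>. iexp (u \<bullet> x)) = (CLINT x|gauss t. iexp (u \<bullet> x))" unfolding char_gauss[OF t] .
  qed (use nu in auto)
qed

text \<open>Mixtures \<open>\<integral> gauss t K(dt)\<close> are handled as images of product measures under \<open>affine\<close>.\<close>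

definition mix :: "real measure \<Rightarrow> 'h measure" where
  "mix K = distr (K \<Otimes>\<^sub>M \<gamma>) borel (\<lambda>p. affine (fst p) (snd p))"

lemma affine_pair_measurable [measurable]:
  "sets K = sets borel \<Longrightarrow> (\<lambda>p. affine (fst p) (snd p)) \<in> borel_measurable (K \<Otimes>\<^sub>M \<gamma>)"
proof -
  assume [measurable_cong]: "sets K = sets borel"
  show ?thesis unfolding affine_def by measurable
qed

lemma sets_mix [simp, measurable_cong]: "sets (mix K) = sets borel"
  by (simp add: mix_def)

text \<open>The measure \<open>K\<close> may be infinite, so that both the Levy measure and the law
  at time one are covered. Near \<open>t = 0\<close> the vector \<open>affine t z\<close> is of
  order \<open>sqrt t\<close>, which explains the condition on \<open>sqrt\<close>.\<close>

lemma mix_integrable: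
  assumes K: "sigma_finite_measure K" "sets K = sets borel"
    and i: "integrable K (\<lambda>t. t)" "integrable K sqrt"
  shows "integrable (mix K) (\<lambda>x. x)" "(LINT x|mix K. u \<bullet> x) = (LINT t|K. t) * (u \<bullet> b)"
    "integrable (mix K) (\<lambda>x. norm x)" "integrable K (\<lambda>t. t\<^sup>2) \<Longrightarrow> integrable (mix K) (\<lambda>x. (norm x)\<^sup>2)"
proof -
  note sg = K(1) sigma_finite_measure_axioms
  note [measurable_cong] = K(2)
  have b1: "integrable (K \<Otimes>\<^sub>M \<gamma>) (\<lambda>p. \<bar>fst p\<bar> * norm b + \<bar>sqrt (fst p)\<bar> * norm (snd p))"
    using integrable_pair_mult(1)[OF sg integrable_abs[OF i(1)], of "\<lambda>_. norm b"]
      integrable_pair_mult(1)[OF sg integrable_abs[OF i(2)] norm_moments(1)] by simp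
  have n1: "norm (affine t z) \<le> \<bar>t\<bar> * norm b + \<bar>sqrt t\<bar> * norm z" for t z
    using norm_triangle_ineq[of "t *\<^sub>R b" "sqrt t *\<^sub>R z"] by (simp add: affine_def)
  have im: "integrable (K \<Otimes>\<^sub>M \<gamma>) (\<lambda>p. affine (fst p) (snd p))"
    using n1 by (intro Bochner_Integration.integrable_bound[OF b1] AE_I2) (auto intro!: affine_pair_measurable K order_trans[OF n1])
  then show im': "integrable (mix K) (\<lambda>x. x)"
    unfolding mix_def by (subst integrable_distr_eq) (auto intro: affine_pair_measurable K)
  then show "integrable (mix K) (\<lambda>x. norm x)" by (rule integrable_norm)
  have "(LINT x|mix K. u \<bullet> x) = (LINT p|(K \<Otimes>\<^sub>M \<gamma>). u \<bullet> affine (fst p) (snd p))"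
    unfolding mix_def by (subst integral_distr) (auto intro: affine_pair_measurable K)
  also have "\<dots> = (LINT p|(K \<Otimes>\<^sub>M \<gamma>). fst p * (u \<bullet> b) + sqrt (fst p) * (u \<bullet> snd p))"
    by (simp add: affine_def inner_add_right)
  also have "\<dots> = (LINT t|K. t) * (u \<bullet> b)"
    using integrable_pair_mult[OF sg i(1), of "\<lambda>_. u \<bullet> b"] integrable_pair_mult[OF sg i(2) projection_moments(1)[of u]]
    by (simp add: projection_moments prob_space)
  finally show "(LINT x|mix K. u \<bullet> x) = (LINT t|K. t) * (u \<bullet> b)" .
  assume i2: "integrable K (\<lambda>t. t\<^sup>2)"
  have b2: "integrable (K \<Otimes>\<^sub>M \<gamma>) (\<lambda>p. (fst p)\<^sup>2 * (2 * (norm b)\<^sup>2) + \<bar>fst p\<bar> * (2 * (norm (snd p))\<^sup>2))"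
    using integrable_pair_mult(1)[OF sg i2, of "\<lambda>_. 2 * (norm b)\<^sup>2"]
      integrable_pair_mult(1)[OF sg integrable_abs[OF i(1)], of "\<lambda>z. 2 * (norm z)\<^sup>2"] norm_moments(2) by simp
  have n2: "(norm (affine t z))\<^sup>2 \<le> t\<^sup>2 * (2 * (norm b)\<^sup>2) + \<bar>t\<bar> * (2 * (norm z)\<^sup>2)" for t z
  proof -
    have "(norm (affine t z))\<^sup>2 \<le> (\<bar>t\<bar> * norm b + \<bar>sqrt t\<bar> * norm z)\<^sup>2" by (rule power_mono[OF n1]) simp
    also have "\<dots> \<le> 2 * (\<bar>t\<bar> * norm b)\<^sup>2 + 2 * (\<bar>sqrt t\<bar> * norm z)\<^sup>2"
      using sum_squares_bound[of "\<bar>t\<bar> * norm b" "\<bar>sqrt t\<bar> * norm z"] by (simp add: power2_sum)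
    also have "(\<bar>sqrt t\<bar> * norm z)\<^sup>2 = \<bar>t\<bar> * (norm z)\<^sup>2"
      by (simp add: power_mult_distrib power2_eq_square[of "sqrt t"])
    finally show ?thesis by (simp add: power_mult_distrib algebra_simps)
  qed
  have [measurable]: "(\<lambda>p. affine (fst p) (snd p)) \<in> borel_measurable (K \<Otimes>\<^sub>M \<gamma>)" by (rule affine_pair_measurable[OF K(2)])
  have "integrable (K \<Otimes>\<^sub>M \<gamma>) (\<lambda>p. (norm (affine (fst p) (snd p)))\<^sup>2)"
  proof (rule Bochner_Integration.integrable_bound[OF b2])
    have "norm ((norm (affine (fst p) (snd p)))\<^sup>2) \<le> norm ((fst p)\<^sup>2 * (2 * (norm b)\<^sup>2) + \<bar>fst p\<bar> * (2 * (norm (snd p))\<^sup>2))" for p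
      using n2[of "fst p" "snd p"] by simp
    then show "AE p in K \<Otimes>\<^sub>M \<gamma>. norm ((norm (affine (fst p) (snd p)))\<^sup>2) \<le> norm ((fst p)\<^sup>2 * (2 * (norm b)\<^sup>2) + \<bar>fst p\<bar> * (2 * (norm (snd p))\<^sup>2))"
      by (intro AE_I2)
  qed measurable
  then show "integrable (mix K) (\<lambda>x. (norm x)\<^sup>2)"
    unfolding mix_def by (subst integrable_distr_eq) auto
qed

lemma mix_fubini:
  fixes f :: "'h \<Rightarrow> complex"
  assumes K: "sigma_finite_measure K" "sets K = sets borel" and f: "integrable (mix K) f"
  shows "(CLINT x|mix K. f x) = (CLINT t|K. CLINT x|gauss t. f x)"
proof -
  interpret K: sigma_finite_measure K by fact
  interpret P: pair_sigma_finite K \<gamma> ..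
  have [measurable]: "f \<in> borel_measurable borel" using f by (simp add: measurable_cong_sets[OF sets_mix refl, symmetric] borel_measurable_integrable)
  note m = affine_pair_measurable[OF K(2)]
  have i: "integrable (K \<Otimes>\<^sub>M \<gamma>) (\<lambda>p. f (affine (fst p) (snd p)))"
    using f m unfolding mix_def by (subst (asm) integrable_distr_eq) auto
  have "(CLINT x|mix K. f x) = (CLINT p|(K \<Otimes>\<^sub>M \<gamma>). f (affine (fst p) (snd p)))"
    unfolding mix_def using m by (subst integral_distr) auto
  also have "\<dots> = (CLINT t|K. CLINT z|\<gamma>. f (affine t z))"
    using P.integral_fst'[OF i] by simp
  also have "\<dots> = (CLINT t|K. CLINT x|gauss t. f x)"
    unfolding gauss_def by (subst integral_distr) auto
  finally show ?thesis .
qed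

lemma gauss_emeasure:
  assumes A: "A \<in> sets borel"
  shows "emeasure (gauss t) A = (\<integral>\<^sup>+z. indicator A (affine t z) \<partial>\<gamma>)"
proof -
  note [measurable] = A
  have "(\<integral>\<^sup>+z. indicator A (affine t z) \<partial>\<gamma>) = (\<integral>\<^sup>+x. indicator A x \<partial>gauss t)"
    unfolding gauss_def by (subst nn_integral_distr) auto
  then show ?thesis using A by simp
qed

lemma mix_emeasure:
  assumes K: "sigma_finite_measure K" "sets K = sets borel" and A: "A \<in> sets borel"
  shows "emeasure (mix K) A = (\<integral>\<^sup>+t. emeasure (gauss t) A \<partial>K)"
proof -
  note [measurable] = A
  note m = affine_pair_measurable[OF K(2)]
  have "emeasure (mix K) A = (\<integral>\<^sup>+x. indicator A x \<partial>mix K)" by simp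
  also have "\<dots> = (\<integral>\<^sup>+p. indicator A (affine (fst p) (snd p)) \<partial>(K \<Otimes>\<^sub>M \<gamma>))"
    unfolding mix_def using m by (subst nn_integral_distr) auto
  also have "\<dots> = (\<integral>\<^sup>+t. \<integral>\<^sup>+z. indicator A (affine t z) \<partial>\<gamma> \<partial>K)"
    using nn_integral_fst[of "\<lambda>p. indicator A (affine (fst p) (snd p))" K] m by simp
  also have "\<dots> = (\<integral>\<^sup>+t. emeasure (gauss t) A \<partial>K)" unfolding gauss_emeasure[OF A] ..
  finally show ?thesis .
qed

end

section \<open>The Levy measure\<close>

text \<open>The Levy measure of the gamma process. For \<open>a > 0\<close> it has infinite mass
  near 0, but it integrates \<open>t powr p\<close> for every \<open>p > 0\<close>, in particular
  \<open>sqrt t\<close>.\<close>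

definition gamma_levy :: "real \<Rightarrow> real measure" where
  "gamma_levy a = density lborel (\<lambda>t. ennreal (indicator {0<..} t * (a * inverse t * exp (- t))))"

lemma gamma_levy_density_nonneg: "0 \<le> a \<Longrightarrow> 0 \<le> indicator {0<..} t * (a * inverse t * exp (- t :: real))"
  by (simp add: indicator_def)

lemma sets_gamma_levy [simp, measurable_cong]: "sets (gamma_levy a) = sets borel"
  by (simp add: gamma_levy_def)

lemma sigma_finite_gamma_levy: "sigma_finite_measure (gamma_levy a)"
  unfolding gamma_levy_def by (subst sigma_finite_measure.sigma_finite_iff_density_finite[OF lborel.sigma_finite_measure_axioms]) auto

lemma gamma_levy_powr:
  assumes a: "0 \<le> a" and p: "0 < p"
  shows "has_bochner_integral (gamma_levy a) (\<lambda>t. t powr p) (a * Gamma p)"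
proof -
  have "has_bochner_integral lborel (\<lambda>t. a * (indicator {0<..} t * (t powr (p - 1) * exp (- (1 * t))))) (a * (Gamma p * 1 powr (- p)))"
    using p by (intro has_bochner_integral_mult_right gamma_kernel_integral) auto
  moreover have "a * (indicator {0<..} t * (t powr (p - 1) * exp (- (1 * t)))) =
      (indicator {0<..} t * (a * inverse t * exp (- t))) *\<^sub>R (t powr p)" for t
    by (cases "0 < t") (simp_all add: powr_diff divide_inverse mult_ac)
  ultimately have "has_bochner_integral lborel (\<lambda>t. (indicator {0<..} t * (a * inverse t * exp (- t))) *\<^sub>R (t powr p)) (a * Gamma p)"
    by (simp only: powr_one_eq_one mult_1_right)
  then show ?thesis unfolding gamma_levy_def
    by (intro has_bochner_integral_density) (auto simp: gamma_levy_density_nonneg[OF a])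
qed

lemma gamma_levy_pos: "AE t in gamma_levy a. 0 < t"
  unfolding gamma_levy_def by (subst AE_density) (auto simp: indicator_def)

lemma gamma_levy_moments:
  assumes a: "0 \<le> a"
  shows "integrable (gamma_levy a) (\<lambda>t. t)" "(LINT t|gamma_levy a. t) = a"
    "integrable (gamma_levy a) sqrt" "integrable (gamma_levy a) (\<lambda>t. t\<^sup>2)"
proof -
  have ae: "AE t in gamma_levy a. t powr 1 = t" "AE t in gamma_levy a. t powr (1/2) = sqrt t"
    "AE t in gamma_levy a. t powr 2 = t\<^sup>2"
    using gamma_levy_pos by (eventually_elim, simp add: powr_half_sqrt powr_numeral)+
  have "has_bochner_integral (gamma_levy a) (\<lambda>t. t) a"
    using gamma_levy_powr[OF a, of 1] by (subst has_bochner_integral_cong_AE[symmetric, OF _ _ ae(1)]) auto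
  then show "integrable (gamma_levy a) (\<lambda>t. t)" "(LINT t|gamma_levy a. t) = a"
    by (auto simp: has_bochner_integral_iff)
  have "has_bochner_integral (gamma_levy a) sqrt (a * Gamma (1/2))"
    using gamma_levy_powr[OF a, of "1/2"] by (subst has_bochner_integral_cong_AE[symmetric, OF _ _ ae(2)]) auto
  then show "integrable (gamma_levy a) sqrt" by (auto simp: has_bochner_integral_iff)
  have "has_bochner_integral (gamma_levy a) (\<lambda>t. t\<^sup>2) (a * Gamma 2)"
    using gamma_levy_powr[OF a, of 2] by (subst has_bochner_integral_cong_AE[symmetric, OF _ _ ae(3)]) auto
  then show "integrable (gamma_levy a) (\<lambda>t. t\<^sup>2)" by (auto simp: has_bochner_integral_iff)
qed

lemma gamma_levy_frullani:
  assumes a: "0 \<le> a" and z: "0 \<le> Re z"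
  shows "(CLINT t|gamma_levy a. exp (- (z * complex_of_real t)) - 1) = - complex_of_real a * Ln (1 + z)"
proof -
  have "(CLINT t|gamma_levy a. exp (- (z * complex_of_real t)) - 1) =
    (CLINT t|lborel. complex_of_real a * (complex_of_real (indicator {0<..} t * (inverse t * exp (- t))) * (exp (- (z * complex_of_real t)) - 1)))"
    unfolding gamma_levy_def
  proof (subst integral_density)
    show "AE t in lborel. 0 \<le> indicator {0<..} t * (a * inverse t * exp (- t))"
      by (rule AE_I2) (rule gamma_levy_density_nonneg[OF a])
  qed (auto simp: scaleR_conv_of_real mult_ac intro!: Bochner_Integration.integral_cong)
  also have "\<dots> = complex_of_real a * - Ln (1 + z)"
    unfolding integral_mult_right_zero frullani[OF z] ..
  finally show ?thesis by simp
qed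

context gaussian_base
begin

text \<open>The restriction matters: for \<open>b = 0\<close>, \<open>Q = 0\<close> and
  \<open>a > 0\<close> the mixture is an infinite mass at 0. Integrands that vanish at 0 do not
  notice it.\<close>

definition hvg_levy_measure :: "real \<Rightarrow> 'h measure" where
  "hvg_levy_measure a = restrict_space (mix (gamma_levy a)) (- {0})"

lemma hvg_levy_measure_integral:
  fixes f :: "'h \<Rightarrow> 'c::{banach, second_countable_topology}"
  assumes "f 0 = 0"
  shows "(LINT x|hvg_levy_measure a. f x) = (LINT x|mix (gamma_levy a). f x)"
    "integrable (hvg_levy_measure a) f \<longleftrightarrow> integrable (mix (gamma_levy a)) f"
proof -
  have e: "indicator (- {0}) x *\<^sub>R f x = f x" for x using assms by (cases "x = 0") auto
  show "(LINT x|hvg_levy_measure a. f x) = (LINT x|mix (gamma_levy a). f x)"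
    unfolding hvg_levy_measure_def by (subst integral_restrict_space) (auto simp: e)
  show "integrable (hvg_levy_measure a) f \<longleftrightarrow> integrable (mix (gamma_levy a)) f"
    unfolding hvg_levy_measure_def by (subst integrable_restrict_space) (auto simp: e)
qed

lemma hvg_levy_measure_emeasure:
  assumes A: "A \<in> sets borel" "A \<subseteq> - {0}"
  shows "emeasure (hvg_levy_measure a) A =
    (\<integral>\<^sup>+ t \<in> {0<..}. emeasure (gaussian_measure (t *\<^sub>R b) (\<lambda>x. t *\<^sub>R Q x)) A *
       ennreal (a * inverse t * exp (- t)) \<partial>lborel)"
proof -
  have gm: "(\<lambda>t. emeasure (gauss t) A) \<in> borel_measurable borel"
    unfolding gauss_emeasure[OF A(1)]
  proof (rule borel_measurable_nn_integral)
    have [measurable]: "(\<lambda>p. affine (fst p) (snd p)) \<in> borel_measurable (borel \<Otimes>\<^sub>M \<gamma>)"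
      by (rule affine_pair_measurable) simp
    show "(\<lambda>(t, z). indicator A (affine t z)) \<in> borel_measurable (borel \<Otimes>\<^sub>M \<gamma>)"
      using A(1) by (simp add: case_prod_beta')
  qed
  have "emeasure (hvg_levy_measure a) A = emeasure (mix (gamma_levy a)) A"
    unfolding hvg_levy_measure_def using A by (intro emeasure_restrict_space) auto
  also have "\<dots> = (\<integral>\<^sup>+t. emeasure (gauss t) A \<partial>gamma_levy a)"
    by (rule mix_emeasure[OF sigma_finite_gamma_levy sets_gamma_levy A(1)])
  also have "\<dots> = (\<integral>\<^sup>+t. ennreal (indicator {0<..} t * (a * inverse t * exp (- t))) * emeasure (gauss t) A \<partial>lborel)"
    unfolding gamma_levy_def using gm by (intro nn_integral_density) auto
  also have "\<dots> = (\<integral>\<^sup>+ t \<in> {0<..}. emeasure (gaussian_measure (t *\<^sub>R b) (\<lambda>x. t *\<^sub>R Q x)) A *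
       ennreal (a * inverse t * exp (- t)) \<partial>lborel)"
    by (intro nn_integral_cong) (auto simp: gaussian_measure_eq indicator_def mult.commute)
  finally show ?thesis .
qed

context
  fixes a :: real
  assumes a: "0 \<le> a"
begin

lemmas levy_mix = mix_integrable[OF sigma_finite_gamma_levy sets_gamma_levy gamma_levy_moments(1,3)[OF a]]

lemma hvg_levy_measure_levy: "levy_measure (hvg_levy_measure a)"
  unfolding levy_measure_def
proof
  show "sets (hvg_levy_measure a) = sets (restrict_space borel (- {0}))"
    unfolding hvg_levy_measure_def by (rule sets_restrict_space_cong) simp
  have i: "integrable (hvg_levy_measure a) (\<lambda>x. (norm x)\<^sup>2)"
    using levy_mix(4)[OF gamma_levy_moments(4)[OF a]] by (subst hvg_levy_measure_integral) auto
  have "(\<integral>\<^sup>+ x. ennreal (min 1 ((norm x)\<^sup>2)) \<partial>hvg_levy_measure a) \<le> (\<integral>\<^sup>+ x. ennreal (norm ((norm x)\<^sup>2)) \<partial>hvg_levy_measure a)"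
    by (intro nn_integral_mono ennreal_leI) simp
  also have "\<dots> < \<infinity>" using i unfolding integrable_iff_bounded by simp
  finally show "(\<integral>\<^sup>+ x. ennreal (min 1 ((norm x)\<^sup>2)) \<partial>hvg_levy_measure a) < \<infinity>" .
qed

lemma big_jumps_integrable: "set_integrable (hvg_levy_measure a) {x. norm x > 1} (\<lambda>x. x)"
  unfolding set_integrable_def
proof (subst hvg_levy_measure_integral(2))
  have "{x :: 'h. norm x > 1} \<in> sets borel" by measurable
  then show "integrable (mix (gamma_levy a)) (\<lambda>x. indicator {x. norm x > 1} x *\<^sub>R x)"
    using levy_mix(1) by (intro integrable_mult_indicator) auto
qed simp

text \<open>Since \<open>norm x\<close> is integrable, \<open>iexp (u \<bullet> x) - 1\<close> is
  integrable without compensation. Given \<open>t\<close> it integrates to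
  \<open>exp (t * expo u) - 1\<close>, which leaves the Frullani integral.\<close>

lemma char_levy_integral:
  "integrable (hvg_levy_measure a) (\<lambda>x. iexp (u \<bullet> x) - 1)"
  "(CLINT x|hvg_levy_measure a. iexp (u \<bullet> x) - 1) = - complex_of_real a * Ln (1 - expo u)"
proof -
  have i: "integrable (mix (gamma_levy a)) (\<lambda>x. iexp (u \<bullet> x) - 1)"
  proof (rule Bochner_Integration.integrable_bound)
    show "integrable (mix (gamma_levy a)) (\<lambda>x. norm u * norm x)" using levy_mix(3) by simp
    have "norm (iexp (u \<bullet> x) - 1) \<le> norm (norm u * norm x)" for x
      using iexp_approx1[of "u \<bullet> x" 0] Cauchy_Schwarz_ineq2[of u x] by simp
    then show "AE x in mix (gamma_levy a). norm (iexp (u \<bullet> x) - 1) \<le> norm (norm u * norm x)" by simp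
  qed measurable
  then show "integrable (hvg_levy_measure a) (\<lambda>x. iexp (u \<bullet> x) - 1)"
    by (subst hvg_levy_measure_integral) auto
  have "(CLINT x|hvg_levy_measure a. iexp (u \<bullet> x) - 1) = (CLINT t|gamma_levy a. CLINT x|gauss t. iexp (u \<bullet> x) - 1)"
    using mix_fubini[OF sigma_finite_gamma_levy sets_gamma_levy i] by (subst hvg_levy_measure_integral) auto
  also have "\<dots> = (CLINT t|gamma_levy a. exp (- ((- expo u) * complex_of_real t)) - 1)"
  proof (rule integral_cong_AE)
    have inner: "(CLINT x|gauss t. iexp (u \<bullet> x) - 1) = exp (- ((- expo u) * complex_of_real t)) - 1" if "0 < t" for t
    proof -
      interpret G: prob_space "gauss t" by (rule prob_space_gauss)
      have "(CLINT x|gauss t. iexp (u \<bullet> x) - 1) = (CLINT x|gauss t. iexp (u \<bullet> x)) - 1"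
        using G.integrable_iexp_comp[of "\<lambda>x. u \<bullet> x"] by (subst Bochner_Integration.integral_diff) (auto simp: G.prob_space)
      then show ?thesis using that by (simp add: char_gauss mult.commute)
    qed
    show "AE t in gamma_levy a. (CLINT x|gauss t. iexp (u \<bullet> x) - 1) = exp (- ((- expo u) * complex_of_real t)) - 1"
      using gamma_levy_pos by eventually_elim (rule inner)
    have [measurable]: "(\<lambda>p. affine (fst p) (snd p)) \<in> borel_measurable (gamma_levy a \<Otimes>\<^sub>M \<gamma>)"
      by (rule affine_pair_measurable) simp
    have "(\<lambda>t. CLINT z|\<gamma>. iexp (u \<bullet> affine t z) - 1) \<in> borel_measurable (gamma_levy a)"
      by (rule borel_measurable_lebesgue_integral) (simp add: case_prod_beta')
    moreover have "(CLINT x|gauss t. iexp (u \<bullet> x) - 1) = (CLINT z|\<gamma>. iexp (u \<bullet> affine t z) - 1)" for t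
      unfolding gauss_def by (subst integral_distr) auto
    ultimately show "(\<lambda>t. CLINT x|gauss t. iexp (u \<bullet> x) - 1) \<in> borel_measurable (gamma_levy a)" by simp
  qed measurable
  also have "\<dots> = - complex_of_real a * Ln (1 + - expo u)"
    by (rule gamma_levy_frullani[OF a]) (use Re_expo[of u] in simp)
  finally show "(CLINT x|hvg_levy_measure a. iexp (u \<bullet> x) - 1) = - complex_of_real a * Ln (1 - expo u)" by simp
qed

definition big_jumps :: 'h where
  "big_jumps = (LINT x:{x. norm x > 1}|hvg_levy_measure a. x)"

text \<open>Because \<open>x\<close> itself is integrable, the compensator can be integrated
  separately. It yields the inner product of \<open>u\<close> with
  \<open>a *\<^sub>R b - big_jumps\<close>, which is exactly the drift term, and the two
  cancel.\<close>

lemma levy_khintchine: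
  "\<i> * complex_of_real (u \<bullet> (a *\<^sub>R b - big_jumps)) +
     (CLINT x|hvg_levy_measure a. iexp (u \<bullet> x) - 1 - \<i> * complex_of_real (u \<bullet> truncation x)) =
   - complex_of_real a * Ln (1 - expo u)"
proof -
  let ?\<mu> = "hvg_levy_measure a"
  let ?B = "\<lambda>x :: 'h. indicator {x. norm x > 1} x *\<^sub>R x"
  have iB: "integrable ?\<mu> ?B" using big_jumps_integrable by (simp add: set_integrable_def)
  have ix: "integrable ?\<mu> (\<lambda>x. x)" using levy_mix(1) by (subst hvg_levy_measure_integral) auto
  have tr: "u \<bullet> truncation x = u \<bullet> x - u \<bullet> ?B x" for x
    by (auto simp: truncation_def indicator_def)
  have it: "integrable ?\<mu> (\<lambda>x. u \<bullet> truncation x)"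
    unfolding tr using ix iB by (intro Bochner_Integration.integrable_diff integrable_inner_right)
  have "(LINT x|?\<mu>. u \<bullet> truncation x) = (LINT x|?\<mu>. u \<bullet> x) - (LINT x|?\<mu>. u \<bullet> ?B x)"
    unfolding tr using ix iB by (intro Bochner_Integration.integral_diff integrable_inner_right)
  also have "(LINT x|?\<mu>. u \<bullet> ?B x) = u \<bullet> big_jumps"
    unfolding big_jumps_def set_lebesgue_integral_def using iB by (intro integral_inner_right)
  also have "(LINT x|?\<mu>. u \<bullet> x) = a * (u \<bullet> b)"
    using levy_mix(2)[of u] gamma_levy_moments(2)[OF a] by (subst hvg_levy_measure_integral) auto
  finally have t: "(LINT x|?\<mu>. u \<bullet> truncation x) = u \<bullet> (a *\<^sub>R b - big_jumps)"
    by (simp add: inner_diff_right)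
  have "(CLINT x|?\<mu>. iexp (u \<bullet> x) - 1 - \<i> * complex_of_real (u \<bullet> truncation x)) =
    (CLINT x|?\<mu>. iexp (u \<bullet> x) - 1) - (CLINT x|?\<mu>. \<i> * complex_of_real (u \<bullet> truncation x))"
    using it by (intro Bochner_Integration.integral_diff char_levy_integral(1) integrable_mult_right integrable_of_real)
  also have "(CLINT x|?\<mu>. \<i> * complex_of_real (u \<bullet> truncation x)) = \<i> * complex_of_real (LINT x|?\<mu>. u \<bullet> truncation x)"
    by simp
  finally show ?thesis unfolding char_levy_integral(2) t by simp
qed

text \<open>Without drift, \<open>affine t\<close> is odd in \<open>z\<close>, and the product
  measure is invariant under changing the sign of \<open>z\<close>. Hence the integral equals its
  own negative.\<close>

lemma big_jumps_symmetric:
  assumes b: "b = 0"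
  shows "big_jumps = 0"
proof -
  let ?K = "gamma_levy a"
  let ?B = "\<lambda>x :: 'h. indicator {x. norm x > 1} x *\<^sub>R x"
  interpret K: sigma_finite_measure ?K by (rule sigma_finite_gamma_levy)
  have [measurable]: "{x :: 'h. norm x > 1} \<in> sets borel" by measurable
  have Bm [measurable]: "?B \<in> borel_measurable borel" by measurable
  have [measurable]: "(\<lambda>p. affine (fst p) (snd p)) \<in> borel_measurable (?K \<Otimes>\<^sub>M \<gamma>)"
    by (rule affine_pair_measurable) simp
  have sym: "distr \<gamma> \<gamma> uminus = \<gamma>"
  proof -
    have "distr \<gamma> borel (\<lambda>x. - x) = \<gamma>"
    proof (rule distr_eqI_char)
      fix u
      have "(CLINT x|\<gamma>. iexp (u \<bullet> (- x))) = (CLINT x|\<gamma>. iexp ((- u) \<bullet> x))" by simp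
      also have "\<dots> = (CLINT x|\<gamma>. iexp (u \<bullet> x))"
        unfolding char_gamma by (simp add: linear_neg[OF bounded_linear.linear[OF psd_operatorD(1)[OF Q]]])
      finally show "(CLINT x|\<gamma>. iexp (u \<bullet> (- x))) = (CLINT x|\<gamma>. iexp (u \<bullet> x))" .
    qed (auto simp: prob_space_axioms sets_gamma)
    moreover have "distr \<gamma> \<gamma> uminus = distr \<gamma> borel (\<lambda>x. - x)"
      by (rule distr_cong) (auto simp: sets_gamma)
    ultimately show ?thesis by simp
  qed
  have pair: "distr (?K \<Otimes>\<^sub>M \<gamma>) (?K \<Otimes>\<^sub>M \<gamma>) (\<lambda>(t, z). (t, - z)) = ?K \<Otimes>\<^sub>M \<gamma>"
  proof -
    have "distr ?K ?K (\<lambda>t. t) \<Otimes>\<^sub>M distr \<gamma> \<gamma> uminus = distr (?K \<Otimes>\<^sub>M \<gamma>) (?K \<Otimes>\<^sub>M \<gamma>) (\<lambda>(t, z). (t, - z))"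
      by (rule pair_measure_distr) (auto simp: sym sigma_finite_measure_axioms)
    then show ?thesis by (simp add: sym distr_id2)
  qed
  have J: "big_jumps = (LINT p|(?K \<Otimes>\<^sub>M \<gamma>). ?B (affine (fst p) (snd p)))"
  proof -
    have "big_jumps = (LINT x|mix ?K. ?B x)"
      unfolding big_jumps_def set_lebesgue_integral_def by (rule hvg_levy_measure_integral) simp
    also have "\<dots> = (LINT p|(?K \<Otimes>\<^sub>M \<gamma>). ?B (affine (fst p) (snd p)))"
      unfolding mix_def by (rule integral_distr) measurable
    finally show ?thesis .
  qed
  also have "\<dots> = (LINT p|distr (?K \<Otimes>\<^sub>M \<gamma>) (?K \<Otimes>\<^sub>M \<gamma>) (\<lambda>(t, z). (t, - z)). ?B (affine (fst p) (snd p)))"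
    unfolding pair ..
  also have "\<dots> = (LINT p|(?K \<Otimes>\<^sub>M \<gamma>). ?B (affine (fst (case p of (t, z) \<Rightarrow> (t, - z))) (snd (case p of (t, z) \<Rightarrow> (t, - z)))))"
    by (rule integral_distr) measurable
  also have "\<dots> = (LINT p|(?K \<Otimes>\<^sub>M \<gamma>). - ?B (affine (fst p) (snd p)))"
  proof -
    have "affine t (- z) = - affine t z" for t z unfolding affine_def using b by simp
    then show ?thesis by (intro Bochner_Integration.integral_cong refl) (auto simp: indicator_def)
  qed
  also have "\<dots> = - big_jumps" unfolding J by simp
  finally have "big_jumps + big_jumps = 0" unfolding eq_neg_iff_add_eq_0 .
  then show ?thesis using scaleR_2[of big_jumps] by simp
qed

end

text \<open>At \<open>a = 0\<close> the gamma density is junk and the law is the point mass at \<open>0\<close>.\<close>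

definition mixing_law :: "real \<Rightarrow> real measure" where
  "mixing_law a = (if a = 0 then return borel 0 else gamma_law a)"

lemma mixing_law:
  assumes a: "0 \<le> a"
  shows "prob_space (mixing_law a)" "sets (mixing_law a) = sets borel" "AE t in mixing_law a. 0 \<le> t"
    "integrable (mixing_law a) (\<lambda>t. t)" "(LINT t|mixing_law a. t) = a"
    "integrable (mixing_law a) (\<lambda>t. t\<^sup>2)" "(LINT t|mixing_law a. t\<^sup>2) = a\<^sup>2 + a"
    "0 \<le> Re z \<Longrightarrow> (CLINT t|mixing_law a. exp (- (z * complex_of_real t))) = exp (- (complex_of_real a * Ln (1 + z)))"
proof -
  show "prob_space (mixing_law a)"
    using a prob_space_gamma_law[of a] by (auto simp: mixing_law_def intro: prob_space_return)
  show "sets (mixing_law a) = sets borel" by (simp add: mixing_law_def)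
  show "AE t in mixing_law a. 0 \<le> t"
  proof (cases "a = 0")
    case False
    then have "mixing_law a = gamma_law a" by (simp add: mixing_law_def)
    moreover have "AE t in gamma_law a. 0 \<le> t" using gamma_law_pos by eventually_elim simp
    ultimately show ?thesis by (simp only:)
  next
    case True
    then have "mixing_law a = return borel 0" by (simp add: mixing_law_def)
    then show ?thesis by (simp only:) (simp add: AE_return)
  qed
  have r: "integrable (return borel 0) f" "(LINT t|return borel 0. f t) = f 0" if "f \<in> borel_measurable borel"
    for f :: "real \<Rightarrow> real"
  proof -
    show "(LINT t|return borel 0. f t) = f 0" using that by (intro integral_return) auto
    show "integrable (return borel 0) f"
      using that by (intro integrableI_bounded) (auto simp: nn_integral_return)
  qed
  show "integrable (mixing_law a) (\<lambda>t. t)" "(LINT t|mixing_law a. t) = a"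
    "integrable (mixing_law a) (\<lambda>t. t\<^sup>2)" "(LINT t|mixing_law a. t\<^sup>2) = a\<^sup>2 + a"
  proof -
    have "integrable (mixing_law a) (\<lambda>t. t) \<and> (LINT t|mixing_law a. t) = a \<and>
      integrable (mixing_law a) (\<lambda>t. t\<^sup>2) \<and> (LINT t|mixing_law a. t\<^sup>2) = a\<^sup>2 + a"
    proof (cases "a = 0")
      case True
      then have m: "mixing_law a = return borel 0" by (simp add: mixing_law_def)
      show ?thesis unfolding m
      proof (intro conjI)
        show "integrable (return borel 0) (\<lambda>t :: real. t)" "integrable (return borel 0) (\<lambda>t :: real. t\<^sup>2)"
          by (rule r(1); simp)+
        show "(LINT t|return borel 0. t) = a" "(LINT t|return borel 0. t\<^sup>2) = a\<^sup>2 + a"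
          by (subst r(2); simp add: True)+
      qed
    next
      case False
      then have m: "mixing_law a = gamma_law a" and "0 < a" using a by (simp_all add: mixing_law_def)
      then show ?thesis unfolding m using gamma_law_moments[of a] by blast
    qed
    then show "integrable (mixing_law a) (\<lambda>t. t)" "(LINT t|mixing_law a. t) = a"
      "integrable (mixing_law a) (\<lambda>t. t\<^sup>2)" "(LINT t|mixing_law a. t\<^sup>2) = a\<^sup>2 + a" by blast+
  qed
  show "(CLINT t|mixing_law a. exp (- (z * complex_of_real t))) = exp (- (complex_of_real a * Ln (1 + z)))" if "0 \<le> Re z"
  proof (cases "a = 0")
    case True
    then show ?thesis by (simp add: mixing_law_def integral_return)
  next
    case False
    then show ?thesis using a gamma_law_laplace[of a z] that by (simp add: mixing_law_def)
  qed
qed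

end

section \<open>The law at time one and the main theorem\<close>

text \<open>Used for the projections \<open>u \<bullet> Y\<close> and for
  \<open>- Y\<close>.\<close>

lemma levy_process_linear:
  fixes X :: "real \<Rightarrow> 'w \<Rightarrow> 'h::{real_normed_vector, second_countable_topology}"
    and T :: "'h \<Rightarrow> 'k::{real_normed_vector, second_countable_topology}"
  assumes X: "levy_process M X" and T: "bounded_linear T"
  shows "levy_process M (\<lambda>t \<omega>. T (X t \<omega>))"
  unfolding levy_process_def
proof (intro conjI allI impI)
  interpret prob_space M using X by (rule levy_processD)
  interpret T: bounded_linear T by (rule T)
  have Tm [measurable]: "T \<in> borel_measurable borel" by (rule borel_measurable_continuous_onI[OF linear_continuous_on[OF T]])
  note m = levy_processD(2)[OF X]
  show "prob_space M" by unfold_locales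
  show "(\<lambda>\<omega>. T (X t \<omega>)) \<in> borel_measurable M" if "0 \<le> t" for t
    using m[OF that] Tm by (rule measurable_compose)
  show "AE \<omega> in M. T (X 0 \<omega>) = 0" using levy_processD(3)[OF X] by eventually_elim (simp add: T.zero)
  show "indep_vars (\<lambda>_. borel) (\<lambda>k \<omega>. T (X (t (Suc k)) \<omega>) - T (X (t k) \<omega>)) {..<n}"
    if t: "0 \<le> t 0 \<and> mono_on {..n} t" for n :: nat and t :: "nat \<Rightarrow> real"
  proof -
    have "indep_vars (\<lambda>_. borel) (\<lambda>k \<omega>. T (X (t (Suc k)) \<omega> - X (t k) \<omega>)) {..<n}"
      by (rule indep_vars_compose2[OF levy_processD(4)[OF X]]) (use t in auto)
    then show ?thesis by (simp only: T.diff)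
  qed
  show "distr M borel (\<lambda>\<omega>. T (X t \<omega>) - T (X s \<omega>)) = distr M borel (\<lambda>\<omega>. T (X (t - s) \<omega>))"
    if st: "0 \<le> s \<and> s \<le> t" for s t
  proof -
    have "distr M borel (\<lambda>\<omega>. T (X t \<omega>) - T (X s \<omega>)) = distr M borel (T \<circ> (\<lambda>\<omega>. X t \<omega> - X s \<omega>))"
      by (simp only: T.diff[symmetric] o_def)
    also have "\<dots> = distr (distr M borel (\<lambda>\<omega>. X t \<omega> - X s \<omega>)) borel T"
      using st by (intro distr_distr[symmetric] Tm borel_measurable_diff m) auto
    also have "\<dots> = distr (distr M borel (X (t - s))) borel T"
      using levy_processD(5)[OF X, of s t] st by simp
    also have "\<dots> = distr M borel (\<lambda>\<omega>. T (X (t - s) \<omega>))"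
      using st by (subst distr_distr) (auto simp: o_def intro: m)
    finally show ?thesis .
  qed
  show "AE \<omega> in M. cadlag (\<lambda>t. T (X t \<omega>))"
    using levy_processD(6)[OF X]
  proof eventually_elim
    case (elim \<omega>)
    then show ?case unfolding cadlag_def using T.tendsto by blast
  qed
qed

lemma levy_process_zero:
  assumes "prob_space M"
  shows "levy_process M (\<lambda>t \<omega>. 0 :: 'h::{real_inner, second_countable_topology})"
    "levy_exponent M (\<lambda>t \<omega>. 0 :: 'h) (\<lambda>u. 0)"
proof -
  have c: "cadlag (\<lambda>t :: real. 0 :: 'h)" by (rule continuous_on_cadlag) simp
  interpret prob_space M by fact
  show "levy_process M (\<lambda>t \<omega>. 0 :: 'h)" "levy_exponent M (\<lambda>t \<omega>. 0 :: 'h) (\<lambda>u. 0)"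
    by (rule levy_process_charI[where \<psi>="\<lambda>_. 0"]; (intro AE_I2 c assms)?; simp add: prob_space)+
qed

section \<open>The law of an HVG-process at time one: mean, covariance and characteristics\<close>

context gaussian_base
begin

lemma prob_space_mix:
  assumes "prob_space K" "sets K = sets borel"
  shows "prob_space (mix K)"
proof -
  interpret K: prob_space K by fact
  interpret P: pair_prob_space K \<gamma> ..
  show ?thesis unfolding mix_def by (rule P.prob_space_distr) (rule affine_pair_measurable[OF assms(2)])
qed

lemma char_mix:
  assumes a: "0 \<le> a"
  shows "(CLINT x|mix (mixing_law a). iexp (u \<bullet> x)) = exp (- complex_of_real a * Ln (1 - expo u))"
proof -
  note K = mixing_law[OF a]
  interpret K: prob_space "mixing_law a" by (rule K)
  interpret X: prob_space "mix (mixing_law a)" by (rule prob_space_mix[OF K(1,2)])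
  note [measurable_cong] = K(2)
  have "(CLINT x|mix (mixing_law a). iexp (u \<bullet> x)) = (CLINT t|mixing_law a. CLINT x|gauss t. iexp (u \<bullet> x))"
    by (rule mix_fubini[OF K.sigma_finite_measure_axioms K(2)]) (rule X.integrable_iexp_comp, measurable)
  also have "\<dots> = (CLINT t|mixing_law a. exp (- ((- expo u) * complex_of_real t)))"
  proof (rule integral_cong_AE)
    show "AE t in mixing_law a. (CLINT x|gauss t. iexp (u \<bullet> x)) = exp (- ((- expo u) * complex_of_real t))"
      using K(3) by eventually_elim (simp add: char_gauss mult.commute)
    have [measurable]: "(\<lambda>p. affine (fst p) (snd p)) \<in> borel_measurable (mixing_law a \<Otimes>\<^sub>M \<gamma>)"
      by (rule affine_pair_measurable) (rule K)
    have "(\<lambda>t. CLINT z|\<gamma>. iexp (u \<bullet> affine t z)) \<in> borel_measurable (mixing_law a)"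
      by (rule borel_measurable_lebesgue_integral) (simp add: case_prod_beta')
    moreover have "(CLINT x|gauss t. iexp (u \<bullet> x)) = (CLINT z|\<gamma>. iexp (u \<bullet> affine t z))" for t
      unfolding gauss_def by (subst integral_distr) auto
    ultimately show "(\<lambda>t. CLINT x|gauss t. iexp (u \<bullet> x)) \<in> borel_measurable (mixing_law a)" by simp
  qed measurable
  also have "\<dots> = exp (- (complex_of_real a * Ln (1 + - expo u)))"
    by (rule K(8)) (use Re_expo[of u] in simp)
  finally show ?thesis by simp
qed

lemma mixing_law_sqrt: "0 \<le> a \<Longrightarrow> integrable (mixing_law a) sqrt"
proof -
  assume a: "0 \<le> a"
  note K = mixing_law[OF a]
  interpret K: prob_space "mixing_law a" by (rule K)
  note [measurable_cong] = K(2)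
  have b: "\<bar>sqrt t\<bar> \<le> 1 + \<bar>t\<bar>" for t
  proof -
    have "2 * 1 * sqrt \<bar>t\<bar> \<le> 1\<^sup>2 + (sqrt \<bar>t\<bar>)\<^sup>2" by (rule sum_squares_bound)
    moreover have "0 \<le> sqrt \<bar>t\<bar>" "\<bar>sqrt t\<bar> = sqrt \<bar>t\<bar>" by (simp_all add: real_sqrt_abs2 flip: real_sqrt_abs')
    ultimately show ?thesis by simp
  qed
  have "integrable (mixing_law a) (\<lambda>t. 1 + \<bar>t\<bar>)" using K(4) by simp
  then show ?thesis by (rule Bochner_Integration.integrable_bound) (use b in auto)
qed

context
  fixes a :: real and M :: "'w measure" and Y :: "real \<Rightarrow> 'w \<Rightarrow> 'h"
  assumes a: "0 \<le> a" and Y: "levy_process M Y"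
    and expY: "levy_exponent M Y (\<lambda>u. - complex_of_real a * Ln (1 - expo u))"
begin

text \<open>Valid on any sample space, as only the exponent is used; the moments can now be computed
  in the mixture.\<close>

lemma law_at_1: "distr M borel (Y 1) = mix (mixing_law a)"
proof (rule distr_eqI_char)
  show "prob_space M" using Y by (rule levy_processD)
  show "Y 1 \<in> borel_measurable M" using levy_processD(2)[OF Y, of 1] by simp
  show "prob_space (mix (mixing_law a))" by (intro prob_space_mix mixing_law a)
  show "(CLINT \<omega>|M. iexp (u \<bullet> Y 1 \<omega>)) = (CLINT x|mix (mixing_law a). iexp (u \<bullet> x))" for u
  proof -
    have "(CLINT \<omega>|M. iexp (u \<bullet> Y 1 \<omega>)) = exp (complex_of_real 1 * (- complex_of_real a * Ln (1 - expo u)))"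
      using expY unfolding levy_exponent_def by (meson zero_le_one)
    then show ?thesis unfolding char_mix[OF a] by simp
  qed
qed simp

lemmas K_mix = mix_integrable[OF prob_space_imp_sigma_finite[OF mixing_law(1)[OF a]] mixing_law(2)[OF a] mixing_law(4)[OF a] mixing_law_sqrt[OF a]]

lemma Y1_measurable [measurable]: "Y 1 \<in> borel_measurable M"
  using levy_processD(2)[OF Y, of 1] by simp

lemma Y1_integrable: "integrable M (Y 1)"
  using K_mix(1) unfolding law_at_1[symmetric] by (subst (asm) integrable_distr_eq) auto

lemma Y1_mean: "(LINT \<omega>|M. Y 1 \<omega>) = a *\<^sub>R b"
proof -
  have "u \<bullet> (LINT \<omega>|M. Y 1 \<omega>) = u \<bullet> (a *\<^sub>R b)" for u
  proof -
    have "u \<bullet> (LINT \<omega>|M. Y 1 \<omega>) = (LINT \<omega>|M. u \<bullet> Y 1 \<omega>)"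
      using Y1_integrable by (intro integral_inner_right[symmetric]) auto
    also have "\<dots> = (LINT x|mix (mixing_law a). u \<bullet> x)"
      unfolding law_at_1[symmetric] by (subst integral_distr) auto
    also have "\<dots> = u \<bullet> (a *\<^sub>R b)" unfolding K_mix(2) mixing_law(5)[OF a] by simp
    finally show ?thesis .
  qed
  then show ?thesis using vector_eq_ldot by blast
qed

lemma Y1_covariance: "is_covariance M (Y 1) (\<lambda>z. a *\<^sub>R ((b \<bullet> z) *\<^sub>R b) + a *\<^sub>R Q z)"
  unfolding is_covariance_def Let_def Y1_mean
proof (intro conjI allI Y1_integrable)
  fix x y
  note K = mixing_law[OF a]
  interpret K: prob_space "mixing_law a" by (rule K)
  note sg = K.sigma_finite_measure_axioms sigma_finite_measure_axioms
  note [measurable_cong] = K(2)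
  have [measurable]: "(\<lambda>p. affine (fst p) (snd p)) \<in> borel_measurable (mixing_law a \<Otimes>\<^sub>M \<gamma>)"
    by (rule affine_pair_measurable) (rule K)
  let ?P = "mixing_law a \<Otimes>\<^sub>M \<gamma>"
  let ?f = "\<lambda>v. ((v - a *\<^sub>R b) \<bullet> x) * ((v - a *\<^sub>R b) \<bullet> y)"
  \<comment> \<open>The deviation from the mean is
    \<open>(t - a) *\<^sub>R b + sqrt t *\<^sub>R z\<close>. The first term carries the variance
    \<open>a\<close> of the mixing law, the cross term vanishes since \<open>z\<close> is centred,
    and the last one gives \<open>a\<close> times \<open>Q\<close>. The absolute value makes the
    identity hold for every real \<open>t\<close>.\<close>
  have expand: "?f (affine t z) = (t - a)\<^sup>2 * ((b \<bullet> x) * (b \<bullet> y))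
      + ((t - a) * sqrt t) * ((b \<bullet> x) * (y \<bullet> z) + (b \<bullet> y) * (x \<bullet> z)) + \<bar>t\<bar> * ((z \<bullet> x) * (z \<bullet> y))" for t z
  proof -
    have "sqrt t * sqrt t = \<bar>t\<bar>" by simp
    then have "\<bar>t\<bar> * ((z \<bullet> x) * (z \<bullet> y)) = (sqrt t * (z \<bullet> x)) * (sqrt t * (z \<bullet> y))" by simp
    then show ?thesis
      by (simp only: affine_def inner_diff_left inner_add_left inner_scaleR_left inner_commute[of y z] inner_commute[of x z] power2_eq_square)
        (simp add: algebra_simps)
  qed
  have i1: "integrable (mixing_law a) (\<lambda>t. (t - a)\<^sup>2)" "(LINT t|mixing_law a. (t - a)\<^sup>2) = a"
  proof -
    have e: "(t - a)\<^sup>2 = t\<^sup>2 - 2 * a * t + a\<^sup>2" for t by (simp add: power2_diff)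
    show "integrable (mixing_law a) (\<lambda>t. (t - a)\<^sup>2)" unfolding e using K(4,6) by simp
    show "(LINT t|mixing_law a. (t - a)\<^sup>2) = a" unfolding e using K(4-7) by (simp add: K.prob_space power2_eq_square algebra_simps)
  qed
  have i2: "integrable (mixing_law a) (\<lambda>t. (t - a) * sqrt t)"
  proof (rule Bochner_Integration.integrable_bound)
    show "integrable (mixing_law a) (\<lambda>t. (t - a)\<^sup>2 + \<bar>t\<bar>)" using i1(1) K(4) by simp
    have "\<bar>(t - a) * sqrt t\<bar> \<le> (t - a)\<^sup>2 + \<bar>t\<bar>" for t
    proof -
      have "2 * (\<bar>t - a\<bar> * \<bar>sqrt t\<bar>) \<le> \<bar>t - a\<bar>\<^sup>2 + \<bar>sqrt t\<bar>\<^sup>2"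
        using sum_squares_bound[of "\<bar>t - a\<bar>" "\<bar>sqrt t\<bar>"] by (simp only: mult.assoc)
      moreover have "0 \<le> \<bar>t - a\<bar> * \<bar>sqrt t\<bar>" by simp
      moreover have "\<bar>sqrt t\<bar>\<^sup>2 = \<bar>t\<bar>" by (simp add: power2_eq_square)
      moreover have "\<bar>(t - a) * sqrt t\<bar> = \<bar>t - a\<bar> * \<bar>sqrt t\<bar>" "\<bar>t - a\<bar>\<^sup>2 = (t - a)\<^sup>2" by (simp_all only: abs_mult power2_abs)
      ultimately show ?thesis by linarith
    qed
    then show "AE t in mixing_law a. norm ((t - a) * sqrt t) \<le> norm ((t - a)\<^sup>2 + \<bar>t\<bar>)"
      by (intro AE_I2) auto
  qed measurable
  have i3: "integrable (mixing_law a) (\<lambda>t. \<bar>t\<bar>)" "(LINT t|mixing_law a. \<bar>t\<bar>) = a"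
  proof -
    show "integrable (mixing_law a) (\<lambda>t. \<bar>t\<bar>)" using K(4) by simp
    have "(LINT t|mixing_law a. \<bar>t\<bar>) = (LINT t|mixing_law a. t)"
      by (rule integral_cong_AE) (use K(3) in auto)
    then show "(LINT t|mixing_law a. \<bar>t\<bar>) = a" unfolding K(5) .
  qed
  have g2: "integrable \<gamma> (\<lambda>z. (b \<bullet> x) * (y \<bullet> z) + (b \<bullet> y) * (x \<bullet> z))"
    "(LINT z|\<gamma>. (b \<bullet> x) * (y \<bullet> z) + (b \<bullet> y) * (x \<bullet> z)) = 0"
    by (simp_all add: projection_moments)
  note p1 = integrable_pair_mult[OF sg i1(1), of "\<lambda>_. (b \<bullet> x) * (b \<bullet> y)"]
    and p2 = integrable_pair_mult[OF sg i2 g2(1)]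
    and p3 = integrable_pair_mult[OF sg i3(1) projection_covariance(1)[of x y]]
  have iP: "integrable ?P (\<lambda>p. ?f (affine (fst p) (snd p)))"
    unfolding expand using p1(1) p2(1) p3(1) by (intro Bochner_Integration.integrable_add) auto
  have "integrable (distr M borel (Y 1)) ?f"
    unfolding law_at_1 mix_def using iP by (subst integrable_distr_eq) auto
  then show "integrable M (\<lambda>\<omega>. ?f (Y 1 \<omega>))" by (subst (asm) integrable_distr_eq) auto
  have "(LINT \<omega>|M. ?f (Y 1 \<omega>)) = (LINT v|distr M borel (Y 1). ?f v)"
    by (subst integral_distr) auto
  also have "\<dots> = (LINT p|?P. ?f (affine (fst p) (snd p)))"
    unfolding law_at_1 mix_def by (subst integral_distr) auto
  also have "\<dots> = (LINT p|?P. (fst p - a)\<^sup>2 * ((b \<bullet> x) * (b \<bullet> y)))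
      + (LINT p|?P. ((fst p - a) * sqrt (fst p)) * ((b \<bullet> x) * (y \<bullet> snd p) + (b \<bullet> y) * (x \<bullet> snd p)))
      + (LINT p|?P. \<bar>fst p\<bar> * ((snd p \<bullet> x) * (snd p \<bullet> y)))"
    unfolding expand using p1(1) p2(1) p3(1)
    by (subst Bochner_Integration.integral_add; (subst Bochner_Integration.integral_add)?; simp)
  also have "\<dots> = a * ((b \<bullet> x) * (b \<bullet> y)) + a * (Q x \<bullet> y)"
    unfolding p2(2) p3(2) g2(2) i3(2) projection_covariance(2) using p1(2) i1(2) by (simp add: prob_space)
  finally show "(a *\<^sub>R ((b \<bullet> x) *\<^sub>R b) + a *\<^sub>R Q x) \<bullet> y = (LINT \<omega>|M. ?f (Y 1 \<omega>))"
    by (simp add: inner_add_left)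
qed

lemma hvg_characteristics:
  assumes zero: "trace_class (\<lambda>_ :: 'h. 0 :: 'h)"
  shows "levy_characteristics M Y (a *\<^sub>R b - big_jumps a) (\<lambda>_. 0) (hvg_levy_measure a)"
  unfolding levy_characteristics_def
proof (intro conjI zero hvg_levy_measure_levy[OF a])
  show "psd_operator (\<lambda>_ :: 'h. 0 :: 'h)" by (simp add: psd_operator_def)
  show "levy_exponent M Y (\<lambda>u. \<i> * complex_of_real (u \<bullet> (a *\<^sub>R b - big_jumps a)) - complex_of_real (0 \<bullet> u) / 2 +
       (CLINT x|hvg_levy_measure a. iexp (u \<bullet> x) - 1 - \<i> * complex_of_real (u \<bullet> truncation x)))"
    using expY by (simp only: inner_zero_left of_real_0 div_0 diff_0_right levy_khintchine[OF a])
qed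

end

end

section \<open>Real variance gamma processes\<close>

lemma gaussian_base_real:
  assumes "0 \<le> v"
  shows "gaussian_base (normal_law 0 v) (\<lambda>x. v * x)"
proof -
  interpret prob_space "normal_law 0 v" using assms by (rule prob_space_normal_law)
  show ?thesis
  proof
    show "psd_operator (\<lambda>x. v * x)"
      using assms by (auto simp: psd_operator_def bounded_linear_mult_right mult.assoc zero_le_mult_iff)
    show "(CLINT x|normal_law 0 v. iexp (u \<bullet> x)) = exp (- complex_of_real ((v * u) \<bullet> u / 2))" for u :: real
      using char_normal_law[OF assms, of 0 u] by (simp add: power2_eq_square mult.assoc)
    show "(\<integral>\<^sup>+x. ennreal (norm x ^ 4) \<partial>normal_law 0 v) < \<infinity>"
    proof -
      have "norm x ^ 4 = x ^ 4" for x :: real by simp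
      then show ?thesis using nn_integral_normal_law(2)[OF assms] by simp
    qed
  qed simp
qed

text \<open>The exponent determines the path law, so any subordinated Brownian motion with the same
  exponent may serve as the witness; the one constructed above already lives on
  \<open>nat \<Rightarrow> real\<close>.\<close>

theorem variance_gamma_processI:
  fixes X :: "real \<Rightarrow> 'w \<Rightarrow> real"
  assumes X: "levy_process M X" and a: "0 \<le> a" and v: "0 \<le> v"
    and cf: "\<And>t s. 0 \<le> t \<Longrightarrow> (CLINT \<omega>|M. iexp (s * X t \<omega>)) =
      exp (complex_of_real t * (- complex_of_real a * Ln (1 + complex_of_real (v * s\<^sup>2) / 2 - \<i> * complex_of_real (m * s))))"
  shows "variance_gamma_process M X"
proof -
  \<comment> \<open>A gamma process has positive shape. For \<open>a = 0\<close> the zero process is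
    therefore presented as the zero Brownian motion run by a clock of shape 1.\<close>
  define \<alpha> where "\<alpha> = (if a = 0 then 1 else a)"
  define v' where "v' = (if a = 0 then 0 else v)"
  define m' where "m' = (if a = 0 then 0 else m)"
  have v': "0 \<le> v'" and \<alpha>: "0 < \<alpha>" using a v by (auto simp: v'_def \<alpha>_def)
  interpret gaussian_base "normal_law 0 v'" m' "\<lambda>x. v' * x" by (rule gaussian_base_real[OF v'])
  obtain N :: "(nat \<Rightarrow> real) measure" and W G where W: "levy_process N W" "levy_exponent N W expo"
    "\<And>\<omega>. continuous_on {0..} (\<lambda>t. W t \<omega>)" and G: "gamma_process \<alpha> 1 N G"
    and ind: "distr N (Pi\<^sub>M {0..} (\<lambda>_. borel)) (sample_path W) \<Otimes>\<^sub>M distr N (Pi\<^sub>M {0..} (\<lambda>_. borel)) (sample_path G) =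
       distr N (Pi\<^sub>M {0..} (\<lambda>_. borel) \<Otimes>\<^sub>M Pi\<^sub>M {0..} (\<lambda>_. borel)) (\<lambda>\<omega>. (sample_path W \<omega>, sample_path G \<omega>))"
    and WG: "levy_process N (\<lambda>t \<omega>. W (G t \<omega>) \<omega>)"
    "levy_exponent N (\<lambda>t \<omega>. W (G t \<omega>) \<omega>) (\<lambda>u. - complex_of_real \<alpha> * Ln (1 - expo u))"
    using subordinated_brownian_exists[OF \<alpha>] by blast
  have pN: "prob_space N" using W(1) by (rule levy_processD)
  have GL: "levy_process N G" using G by (simp add: gamma_process_def)
  have expo_real: "expo s = \<i> * complex_of_real (m' * s) - complex_of_real (v' * s\<^sup>2 / 2)" for s
    unfolding expo_def by (simp add: power2_eq_square mult_ac)
  have bm: "brownian_motion m' v' N W"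
    unfolding brownian_motion_def
  proof (intro conjI v' W(1) allI impI ballI W(3))
    fix t :: real assume t: "0 \<le> t"
    have [measurable]: "W t \<in> borel_measurable N" using levy_processD(2)[OF W(1) t] .
    show "distr N borel (W t) = normal_law (m' * t) (v' * t)"
    proof (rule normal_law_eqI)
      show "finite_measure (distr N borel (W t))"
        using prob_space.prob_space_distr[OF pN, of "W t" borel] by (intro prob_space.finite_measure) simp
      show "0 \<le> v' * t" using v' t by simp
      fix s
      have "(CLINT x|distr N borel (W t). iexp (s * x)) = (CLINT \<omega>|N. iexp (s \<bullet> W t \<omega>))"
        by (subst integral_distr) auto
      also have "\<dots> = exp (complex_of_real t * expo s)" using W(2) t by (simp add: levy_exponent_def)
      also have "\<dots> = exp (\<i> * complex_of_real (s * (m' * t)) - complex_of_real (v' * t * s\<^sup>2 / 2))"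
        unfolding expo_real by (intro arg_cong[where f=exp]) (simp add: algebra_simps)
      finally show "(CLINT x|distr N borel (W t). iexp (s * x)) =
        exp (\<i> * complex_of_real (s * (m' * t)) - complex_of_real (v' * t * s\<^sup>2 / 2))" .
    qed simp
  qed
  have indv: "prob_space.indep_var N (Pi\<^sub>M {0..} (\<lambda>_. borel)) (sample_path W)
          (Pi\<^sub>M {0..} (\<lambda>_. borel)) (sample_path G)"
    unfolding prob_space.indep_var_distribution_eq[OF pN]
    by (intro conjI ind measurable_sample_path levy_processD(2)[OF W(1)] levy_processD(2)[OF GL])
  have law: "process_law M X = process_law N (\<lambda>t \<omega>. W (G t \<omega>) \<omega>)"
  proof (rule process_law_eqI[OF X WG(1)])
    fix t s :: real assume t: "0 \<le> t"
    have "(CLINT \<omega>|N. iexp (s \<bullet> W (G t \<omega>) \<omega>)) = exp (complex_of_real t * (- complex_of_real \<alpha> * Ln (1 - expo s)))"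
      using WG(2) t by (simp add: levy_exponent_def)
    also have "\<dots> = exp (complex_of_real t * (- complex_of_real a * Ln (1 + complex_of_real (v * s\<^sup>2) / 2 - \<i> * complex_of_real (m * s))))"
    proof (cases "a = 0")
      case True
      then have "expo s = 0" unfolding expo_real by (simp add: m'_def v'_def)
      then show ?thesis using True by (simp only:) simp
    next
      case False
      then have "1 - expo s = 1 + complex_of_real (v * s\<^sup>2) / 2 - \<i> * complex_of_real (m * s)"
        unfolding expo_real by (simp add: m'_def v'_def)
      then show ?thesis using False by (simp only: \<alpha>_def if_False)
    qed
    finally show "(CLINT \<omega>|M. iexp (s \<bullet> X t \<omega>)) = (CLINT \<omega>|N. iexp (s \<bullet> W (G t \<omega>) \<omega>))"
      using cf[OF t, of s] by simp
  qed
  show ?thesis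
    unfolding variance_gamma_process_def using X bm G indv law by blast
qed

theorem theorem4p10:
  fixes a :: real
    and b :: "'h::{real_inner, banach, polish_space}"
    and Q :: "'h \<Rightarrow> 'h"
  assumes "0 \<le> a"
    and "psd_operator Q"
    and "trace_class Q"
  shows "(\<exists>(M :: (nat \<Rightarrow> real) measure) (Y :: real \<Rightarrow> (nat \<Rightarrow> real) \<Rightarrow> 'h). hvg_process M Y a b Q) \<and>
    (\<forall>(M :: 'w measure) (Y :: real \<Rightarrow> 'w \<Rightarrow> 'h). hvg_process M Y a b Q \<longrightarrow>
      (\<exists>\<beta> \<Gamma> \<mu>. levy_characteristics M Y \<beta> \<Gamma> \<mu> \<and>
         set_integrable \<mu> {x. norm x > 1} (\<lambda>x. x) \<and>
         \<beta> = a *\<^sub>R b - (LINT x:{x. norm x > 1}|\<mu>. x) \<and>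
         \<Gamma> = (\<lambda>_. 0) \<and>
         (\<forall>A \<in> sets borel. A \<subseteq> - {0} \<longrightarrow>
            emeasure \<mu> A =
              (\<integral>\<^sup>+ t \<in> {0<..}. emeasure (gaussian_measure (t *\<^sub>R b) (\<lambda>x. t *\<^sub>R Q x)) A *
                 ennreal (a * inverse t * exp (- t)) \<partial>lborel)) \<and>
         (b = 0 \<longrightarrow> \<beta> = 0)) \<and>
      integrable M (Y 1) \<and>
      (LINT \<omega>|M. Y 1 \<omega>) = a *\<^sub>R b \<and>
      is_covariance M (Y 1) (\<lambda>z. a *\<^sub>R ((b \<bullet> z) *\<^sub>R b) + a *\<^sub>R Q z) \<and>
      (\<forall>u. variance_gamma_process M (\<lambda>t \<omega>. u \<bullet> Y t \<omega>)) \<and>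
      (b = 0 \<longrightarrow> process_law M Y = process_law M (\<lambda>t \<omega>. - Y t \<omega>)))"
proof -
  note a = assms(1) and Q = assms(2)
  note Ql = bounded_linear.linear[OF psd_operatorD(1)[OF Q]]
  obtain \<gamma> :: "'h measure" where \<gamma>: "prob_space \<gamma>" "sets \<gamma> = sets borel"
    "\<And>u. (CLINT x|\<gamma>. iexp (u \<bullet> x)) = exp (- complex_of_real (Q u \<bullet> u / 2))"
    "(\<integral>\<^sup>+x. ennreal (norm x ^ 4) \<partial>\<gamma>) < \<infinity>"
    using gaussian_exists[OF Q assms(3)] by blast
  interpret gaussian_base \<gamma> b Q
    using \<gamma> Q by (intro gaussian_base.intro gaussian_base_axioms.intro) auto
  have hvg_expo: "1 + complex_of_real (Q u \<bullet> u) / 2 - \<i> * complex_of_real (b \<bullet> u) = 1 - expo u" for u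
    by (simp add: expo_def inner_commute)
  have hvgD: "levy_process M Y" "levy_exponent M Y (\<lambda>u. - complex_of_real a * Ln (1 - expo u))"
    if "hvg_process M Y a b Q" for M :: "'v measure" and Y :: "real \<Rightarrow> 'v \<Rightarrow> 'h"
    using that unfolding hvg_process_def hvg_expo by auto
  have ex: "\<exists>(M :: (nat \<Rightarrow> real) measure) (Y :: real \<Rightarrow> (nat \<Rightarrow> real) \<Rightarrow> 'h). hvg_process M Y a b Q"
  proof (cases "a = 0")
    case True
    \<comment> \<open>For \<open>a = 0\<close> the exponent vanishes identically, and the zero
      process over a point mass realises it.\<close>
    have "prob_space (return (count_space UNIV) (\<lambda>_ :: nat. 0 :: real))" by (rule prob_space_return) simp
    from levy_process_zero[OF this, where 'h='h] True show ?thesis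
      unfolding hvg_process_def by (intro exI[of _ "return (count_space UNIV) (\<lambda>_ :: nat. 0 :: real)"] exI[of _ "\<lambda>t \<omega>. 0"]) simp
  next
    case False
    with a have "0 < a" by simp
    from subordinated_brownian_exists[OF this] show ?thesis
      unfolding hvg_process_def hvg_expo by blast
  qed
  have zero: "trace_class (\<lambda>_ :: 'h. 0 :: 'h)"
  proof -
    \<comment> \<open>Trace class asks for an orthonormal basis even in the case of the zero
      operator; the one provided by \<open>trace_class Q\<close> is reused.\<close>
    obtain E :: "'h set" where "orthonormal_basis E" using assms(3) unfolding trace_class_def by blast
    moreover have "psd_operator (\<lambda>_ :: 'h. 0 :: 'h)" by (simp add: psd_operator_def)
    ultimately show ?thesis unfolding trace_class_def by (intro conjI exI[of _ "\<lambda>_. 0"] exI[of _ E]) auto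
  qed
  have main: "(\<exists>\<beta> \<Gamma> \<mu>. levy_characteristics M Y \<beta> \<Gamma> \<mu> \<and>
         set_integrable \<mu> {x. norm x > 1} (\<lambda>x. x) \<and>
         \<beta> = a *\<^sub>R b - (LINT x:{x. norm x > 1}|\<mu>. x) \<and>
         \<Gamma> = (\<lambda>_. 0) \<and>
         (\<forall>A \<in> sets borel. A \<subseteq> - {0} \<longrightarrow>
            emeasure \<mu> A =
              (\<integral>\<^sup>+ t \<in> {0<..}. emeasure (gaussian_measure (t *\<^sub>R b) (\<lambda>x. t *\<^sub>R Q x)) A *
                 ennreal (a * inverse t * exp (- t)) \<partial>lborel)) \<and>
         (b = 0 \<longrightarrow> \<beta> = 0)) \<and>
      integrable M (Y 1) \<and>
      (LINT \<omega>|M. Y 1 \<omega>) = a *\<^sub>R b \<and>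
      is_covariance M (Y 1) (\<lambda>z. a *\<^sub>R ((b \<bullet> z) *\<^sub>R b) + a *\<^sub>R Q z) \<and>
      (\<forall>u. variance_gamma_process M (\<lambda>t \<omega>. u \<bullet> Y t \<omega>)) \<and>
      (b = 0 \<longrightarrow> process_law M Y = process_law M (\<lambda>t \<omega>. - Y t \<omega>))"
    if hvg: "hvg_process M Y a b Q" for M :: "'w measure" and Y :: "real \<Rightarrow> 'w \<Rightarrow> 'h"
  proof (intro conjI allI impI)
    note Y = hvgD[OF hvg]
    have charY: "(CLINT \<omega>|M. iexp (u \<bullet> Y t \<omega>)) = exp (complex_of_real t * (- complex_of_real a * Ln (1 - expo u)))"
      if "0 \<le> t" for t u
      using Y(2) that unfolding levy_exponent_def by blast
    show "\<exists>\<beta> \<Gamma> \<mu>. levy_characteristics M Y \<beta> \<Gamma> \<mu> \<and>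
         set_integrable \<mu> {x. norm x > 1} (\<lambda>x. x) \<and>
         \<beta> = a *\<^sub>R b - (LINT x:{x. norm x > 1}|\<mu>. x) \<and>
         \<Gamma> = (\<lambda>_. 0) \<and>
         (\<forall>A \<in> sets borel. A \<subseteq> - {0} \<longrightarrow>
            emeasure \<mu> A =
              (\<integral>\<^sup>+ t \<in> {0<..}. emeasure (gaussian_measure (t *\<^sub>R b) (\<lambda>x. t *\<^sub>R Q x)) A *
                 ennreal (a * inverse t * exp (- t)) \<partial>lborel)) \<and>
         (b = 0 \<longrightarrow> \<beta> = 0)"
    proof (intro exI conjI ballI impI)
      show "levy_characteristics M Y (a *\<^sub>R b - big_jumps a) (\<lambda>_. 0) (hvg_levy_measure a)"
        by (rule hvg_characteristics[OF a Y zero])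
      show "set_integrable (hvg_levy_measure a) {x. norm x > 1} (\<lambda>x. x)" by (rule big_jumps_integrable[OF a])
      show "a *\<^sub>R b - big_jumps a = a *\<^sub>R b - (LINT x:{x. norm x > 1}|hvg_levy_measure a. x)"
        by (simp only: big_jumps_def[OF a])
      show "a *\<^sub>R b - big_jumps a = 0" if "b = 0"
        using big_jumps_symmetric[OF a that] that by simp
    qed (rule refl hvg_levy_measure_emeasure; assumption)+
    show "integrable M (Y 1)" by (rule Y1_integrable[OF a Y])
    show "(LINT \<omega>|M. Y 1 \<omega>) = a *\<^sub>R b" by (rule Y1_mean[OF a Y])
    show "is_covariance M (Y 1) (\<lambda>z. a *\<^sub>R ((b \<bullet> z) *\<^sub>R b) + a *\<^sub>R Q z)" by (rule Y1_covariance[OF a Y])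
    show "variance_gamma_process M (\<lambda>t \<omega>. u \<bullet> Y t \<omega>)" for u
    proof (rule variance_gamma_processI[OF _ a])
      show "levy_process M (\<lambda>t \<omega>. u \<bullet> Y t \<omega>)"
        by (rule levy_process_linear[OF Y(1) bounded_linear_inner_right])
      show "0 \<le> Q u \<bullet> u" by (rule psd_operatorD[OF Q])
      fix t s :: real assume t: "0 \<le> t"
      have "(CLINT \<omega>|M. iexp (s * (u \<bullet> Y t \<omega>))) = (CLINT \<omega>|M. iexp ((s *\<^sub>R u) \<bullet> Y t \<omega>))" by simp
      also have "\<dots> = exp (complex_of_real t * (- complex_of_real a * Ln (1 - expo (s *\<^sub>R u))))" by (rule charY[OF t])
      \<comment> \<open>The projection has variance parameter \<open>Q u \<bullet> u\<close> and
        drift \<open>u \<bullet> b\<close>.\<close>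
      also have "1 - expo (s *\<^sub>R u) = 1 + complex_of_real ((Q u \<bullet> u) * s\<^sup>2) / 2 - \<i> * complex_of_real ((u \<bullet> b) * s)"
        by (simp add: expo_def linear_cmul[OF Ql] power2_eq_square mult_ac)
      finally show "(CLINT \<omega>|M. iexp (s * (u \<bullet> Y t \<omega>))) =
        exp (complex_of_real t * (- complex_of_real a * Ln (1 + complex_of_real ((Q u \<bullet> u) * s\<^sup>2) / 2 - \<i> * complex_of_real ((u \<bullet> b) * s))))" .
    qed
    show "process_law M Y = process_law M (\<lambda>t \<omega>. - Y t \<omega>)" if b: "b = 0"
    proof (rule process_law_eqI[OF Y(1)])
      show "levy_process M (\<lambda>t \<omega>. - Y t \<omega>)"
        by (rule levy_process_linear[OF Y(1) bounded_linear_minus[OF bounded_linear_ident]])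
      fix t :: real and u :: 'h assume t: "0 \<le> t"
      have "(CLINT \<omega>|M. iexp (u \<bullet> (- Y t \<omega>))) = (CLINT \<omega>|M. iexp ((- u) \<bullet> Y t \<omega>))" by simp
      also have "\<dots> = exp (complex_of_real t * (- complex_of_real a * Ln (1 - expo (- u))))" by (rule charY[OF t])
      \<comment> \<open>Without drift the exponent is a quadratic form, hence even, and
        \<open>- Y\<close> shares the exponent of \<open>Y\<close>.\<close>
      also have "expo (- u) = expo u" unfolding expo_def using b by (simp add: linear_neg[OF Ql])
      also have "exp (complex_of_real t * (- complex_of_real a * Ln (1 - expo u))) = (CLINT \<omega>|M. iexp (u \<bullet> Y t \<omega>))"
        by (rule charY[OF t, symmetric])
      finally show "(CLINT \<omega>|M. iexp (u \<bullet> Y t \<omega>)) = (CLINT \<omega>|M. iexp (u \<bullet> (- Y t \<omega>)))" ..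
    qed
  qed
  show ?thesis using ex main by blast
qed

end
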